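(* For a square-free negative integer $D$ define the binary quadratic form $Q_D(x,y)=x^2+xy+\frac{1-D}{4}y^2$ if $D\equiv 1\pmod 4$, and $Q_D(x,y)=x^2-Dy^2$ otherwise; let $r_D(n)=|\{(x,y)\in\mathbb{Z}^2: Q_D(x,y)=n\}|$, let $S_D=\sqrt{2}(-D)^{-1/4}$ if $D\equiv 1\pmod 4$ and $S_D=(-D)^{-1/4}$ otherwise, and set $E_{D,2}(N)=\sum_{n\leq N/S_D^2}r_D(n)^2$. Then for $N$ sufficiently large: $E_{D,2}(N)<E_{-3,2}(N)$ for every such $D\neq -3$ with $D\equiv 1\pmod 4$, and $E_{D,2}(N)<E_{-1,2}(N)$ for every such $D\neq -1$ with $D\not\equiv 1\pmod 4$. Moreover, for a lattice $L\subset\mathbb{R}^2$ of covolume $1$ define the pointwise distance energy $E_{L,2}(N)=|\{(p_1,p_2)\in L^2: \|p_1\|^2=\|p_2\|^2\leq N\}|$; then, for $N$ large, $E_{L,2}(N)$ attains its maximum over covolume-one lattices only when $L$ is the hexagonal lattice (up to rotation).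
   Context: $\|\cdot\|$ is the Euclidean norm. The hexagonal lattice of covolume $1$ is $\mathbb{Z}(a,0)\oplus\mathbb{Z}(b,1/a)$ with $a=\sqrt{2/\sqrt{3}}$, $b=\frac12\sqrt{2/\sqrt{3}}$; it is the Eisenstein integers $\mathbb{Z}[\frac{1+\sqrt{-3}}{2}]\subset\mathbb{C}\cong\mathbb{R}^2$ scaled by $S_{-3}$, while for general $D$ the ring of integers of $\mathbb{Q}(\sqrt{D})$ (with norm form $Q_D$) scaled by $S_D$ has covolume $1$.
   Formalization: "N sufficiently large" is taken for each fixed D or L (the threshold may depend on D or L): for fixed N the energies are unbounded as D tends to minus infinity and over covolume-one lattices, so no uniform threshold or maximum at fixed N exists. *)

theory Defs
  imports "HOL-Analysis.Analysis" "HOL-Computational_Algebra.Squarefree"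
begin

section \<open>Norm forms of imaginary quadratic fields\<close>

text \<open>On \<^typ>\<open>int\<close> the remainder modulo 4 lies in {0..3}, so \<open>D mod 4 = 1\<close> is the usual congruence
  also for negative \<open>D\<close>; in that case the division by 4 below is exact.\<close>

definition Q_form :: "int \<Rightarrow> int \<Rightarrow> int \<Rightarrow> int" where
  "Q_form D x y =
     (if D mod 4 = 1 then x\<^sup>2 + x * y + ((1 - D) div 4) * y\<^sup>2 else x\<^sup>2 - D * y\<^sup>2)"

definition rep_count :: "int \<Rightarrow> nat \<Rightarrow> nat" where
  "rep_count D n = card {(x, y). Q_form D x y = int n}"

definition S_scale :: "int \<Rightarrow> real" where
  "S_scale D =
     (if D mod 4 = 1 then sqrt 2 * (- real_of_int D) powr (- 1 / 4)
      else (- real_of_int D) powr (- 1 / 4))"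

text \<open>The sum includes \<open>n = 0\<close>, in accordance with the pair of zero vectors being counted by
  \<open>lattice_energy2\<close> below. As \<open>rep_count D 0 = 1\<close> for every negative \<open>D\<close>, starting at \<open>n = 1\<close>
  would lower all energies by the same amount 1.\<close>

definition energy2 :: "int \<Rightarrow> real \<Rightarrow> nat" where
  "energy2 D N = (\<Sum>n | real n \<le> N / (S_scale D)\<^sup>2. (rep_count D n)\<^sup>2)"

lemma Q_form_times_4:
  assumes "D mod 4 = 1"
  shows "4 * Q_form D x y = (2 * x + y)\<^sup>2 + (- D) * y\<^sup>2"
proof -
  have "4 dvd 1 - D" using assms by presburger
  then obtain k where k: "1 - D = 4 * k" by (auto simp: dvd_def)
  then have D: "D = 1 - 4 * k" and "(1 - D) div 4 = k" by simp_all
  then have "Q_form D x y = x\<^sup>2 + x * y + k * y\<^sup>2" using assms by (simp add: Q_form_def)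
  then show ?thesis by (simp add: D power2_eq_square algebra_simps)
qed

lemma finite_rep:
  assumes "D < 0"
  shows "finite {(x, y). Q_form D x y = int n}"
proof -
  have sq: "\<bar>a\<bar> \<le> a\<^sup>2" for a :: int
  proof -
    have "\<bar>a\<bar> * 1 \<le> \<bar>a\<bar> * \<bar>a\<bar>"
      by (cases "a = 0") (auto intro!: mult_left_mono simp del: abs_mult_self_eq)
    then show ?thesis by (simp add: power2_eq_square)
  qed
  have D: "y\<^sup>2 \<le> (- D) * y\<^sup>2" for y :: int
    using assms mult_right_mono[of 1 "- D" "y\<^sup>2"] by simp
  have "{(x, y). Q_form D x y = int n} \<subseteq> {- 4 * int n..4 * int n} \<times> {- 4 * int n..4 * int n}"
  proof (rule subrelI)
    fix x y assume "(x, y) \<in> {(x, y). Q_form D x y = int n}"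
    then have q: "Q_form D x y = int n" by simp
    have "\<bar>x\<bar> \<le> 4 * int n \<and> \<bar>y\<bar> \<le> 4 * int n"
    proof (cases "D mod 4 = 1")
      case True
      have "(2 * x + y)\<^sup>2 + (- D) * y\<^sup>2 = 4 * int n" using Q_form_times_4[OF True, of x y] q by simp
      then have "(2 * x + y)\<^sup>2 + y\<^sup>2 \<le> 4 * int n" using D[of y] by linarith
      moreover have "0 \<le> (2 * x + y)\<^sup>2" "0 \<le> y\<^sup>2" by auto
      ultimately show ?thesis using sq[of y] sq[of "2 * x + y"] by linarith
    next
      case False
      then have "x\<^sup>2 + (- D) * y\<^sup>2 = int n" using q by (simp add: Q_form_def)
      then have "x\<^sup>2 + y\<^sup>2 \<le> int n" using D[of y] by linarith
      moreover have "0 \<le> x\<^sup>2" "0 \<le> y\<^sup>2" by auto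
      ultimately show ?thesis using sq[of x] sq[of y] by linarith
    qed
    then show "(x, y) \<in> {- 4 * int n..4 * int n} \<times> {- 4 * int n..4 * int n}" by auto
  qed
  then show ?thesis by (rule finite_subset) simp
qed


section \<open>Planar lattices\<close>

definition lattice_of :: "real^2 \<Rightarrow> real^2 \<Rightarrow> (real^2) set" where
  "lattice_of u v = {of_int m *\<^sub>R u + of_int n *\<^sub>R v | m n. True}"

definition is_lattice :: "(real^2) set \<Rightarrow> bool" where
  "is_lattice L \<longleftrightarrow> (\<exists>u v. det (vector [u, v] :: real^2^2) \<noteq> 0 \<and> L = lattice_of u v)"

text \<open>The area of a fundamental parallelogram; \<open>covolume_lattice_of\<close> shows that it does not depend
  on the basis.\<close>

definition covolume :: "(real^2) set \<Rightarrow> real" where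
  "covolume L = (THE c. \<exists>u v. L = lattice_of u v \<and> c = \<bar>det (vector [u, v] :: real^2^2)\<bar>)"

definition lattice_energy2 :: "(real^2) set \<Rightarrow> real \<Rightarrow> nat" where
  "lattice_energy2 L N =
     card {(p1, p2). p1 \<in> L \<and> p2 \<in> L \<and> (norm p1)\<^sup>2 = (norm p2)\<^sup>2 \<and> (norm p2)\<^sup>2 \<le> N}"

definition hexagonal_lattice :: "(real^2) set" where
  "hexagonal_lattice =
     (let a = sqrt (2 / sqrt 3); b = 1 / 2 * sqrt (2 / sqrt 3)
      in lattice_of (vector [a, 0]) (vector [b, 1 / a]))"

definition is_hexagonal :: "(real^2) set \<Rightarrow> bool" where
  "is_hexagonal L \<longleftrightarrow> (\<exists>R :: real^2^2. rotation_matrix R \<and> L = (\<lambda>p. R *v p) ` hexagonal_lattice)"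

lemma lattice_of_basis: "u \<in> lattice_of u v" "v \<in> lattice_of u v"
proof -
  have "u = of_int 1 *\<^sub>R u + of_int 0 *\<^sub>R v" "v = of_int 0 *\<^sub>R u + of_int 1 *\<^sub>R v" by auto
  then show "u \<in> lattice_of u v" "v \<in> lattice_of u v" unfolding lattice_of_def by blast+
qed

lemma det_in_lattice_of:
  assumes "u' \<in> lattice_of u v" "v' \<in> lattice_of u v"
  obtains k :: int where
    "det (vector [u', v'] :: real^2^2) = of_int k * det (vector [u, v] :: real^2^2)"
proof -
  obtain m n p q where
    "u' = of_int m *\<^sub>R u + of_int n *\<^sub>R v" "v' = of_int p *\<^sub>R u + of_int q *\<^sub>R v"
    using assms unfolding lattice_of_def by blast
  then have "det (vector [u', v'] :: real^2^2)
      = of_int (m * q - n * p) * det (vector [u, v] :: real^2^2)"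
    by (simp add: det_2 algebra_simps)
  then show thesis by (rule that)
qed

lemma covolume_lattice_of: "covolume (lattice_of u v) = \<bar>det (vector [u, v] :: real^2^2)\<bar>"
proof -
  have le: "\<bar>det (vector [u, v] :: real^2^2)\<bar> \<le> \<bar>det (vector [u', v'] :: real^2^2)\<bar>"
    if eq: "lattice_of u v = lattice_of u' v'" and nz: "det (vector [u', v'] :: real^2^2) \<noteq> 0"
    for u v u' v'
  proof -
    obtain k :: int where
      k: "det (vector [u', v'] :: real^2^2) = of_int k * det (vector [u, v] :: real^2^2)"
      using det_in_lattice_of[of u' u v v'] lattice_of_basis(1)[of u' v'] lattice_of_basis(2)[of v' u']
      unfolding eq by metis
    then have "k \<noteq> 0" using nz by auto
    then have "1 \<le> \<bar>real_of_int k\<bar>" by linarith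
    then show ?thesis
      using k mult_right_mono[of 1 "\<bar>real_of_int k\<bar>" "\<bar>det (vector [u, v] :: real^2^2)\<bar>"]
      by (simp add: abs_mult)
  qed
  have zero: "det (vector [u', v'] :: real^2^2) = 0"
    if eq: "lattice_of u v = lattice_of u' v'" and z: "det (vector [u, v] :: real^2^2) = 0"
    for u v u' v'
    using det_in_lattice_of[of u' u v v'] lattice_of_basis(1)[of u' v']
      lattice_of_basis(2)[of v' u'] z
    unfolding eq by (metis mult_zero_right)
  have eq: "\<bar>det (vector [u', v'] :: real^2^2)\<bar> = \<bar>det (vector [u, v] :: real^2^2)\<bar>"
    if "lattice_of u v = lattice_of u' v'" for u' v'
    using le[OF that] le[OF that[symmetric]] zero[OF that] zero[OF that[symmetric]]
    by (metis order_antisym)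
  show ?thesis unfolding covolume_def
    by (rule the_equality) (use eq in blast)+
qed

lemma hexagonal_lattice_covolume:
  "is_lattice hexagonal_lattice" "covolume hexagonal_lattice = 1"
proof -
  define a :: real where "a = sqrt (2 / sqrt 3)"
  have "a \<noteq> 0" by (simp add: a_def)
  then have d: "det (vector [vector [a, 0], vector [1 / 2 * a, 1 / a]] :: real^2^2) = 1"
    by (simp add: det_2)
  have h: "hexagonal_lattice = lattice_of (vector [a, 0]) (vector [1 / 2 * a, 1 / a])"
    by (simp add: hexagonal_lattice_def a_def Let_def)
  show "covolume hexagonal_lattice = 1" unfolding h covolume_lattice_of d by simp
  show "is_lattice hexagonal_lattice" unfolding is_lattice_def h using d by (metis zero_neq_one)
qed

lemma finite_lattice_ball:
  assumes "is_lattice L"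
  shows "finite {p \<in> L. (norm p)\<^sup>2 \<le> N}"
proof -
  obtain u v where d: "det (vector [u, v] :: real^2^2) \<noteq> 0" and L: "L = lattice_of u v"
    using assms unfolding is_lattice_def by blast
  define d where "d = \<bar>u $ 1 * v $ 2 - u $ 2 * v $ 1\<bar>"
  have dpos: "d > 0" using d by (simp add: d_def det_2)
  define B where "B = sqrt N * (2 * norm u + 2 * norm v) / d"
  define K :: "int set" where "K = {- \<lceil>B\<rceil>..\<lceil>B\<rceil>}"
  have cross: "\<bar>p $ 1 * w $ 2 - p $ 2 * w $ 1\<bar> \<le> 2 * (norm p * norm w)" for p w :: "real^2"
  proof -
    have "\<bar>p $ 1 * w $ 2\<bar> \<le> norm p * norm w" "\<bar>p $ 2 * w $ 1\<bar> \<le> norm p * norm w"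
      unfolding abs_mult by (intro mult_mono component_le_norm_cart; simp)+
    then show ?thesis by linarith
  qed
  have bnd: "k \<in> K" if "\<bar>of_int k\<bar> * d \<le> 2 * (norm p * norm w)" "(norm p)\<^sup>2 \<le> N" "w = u \<or> w = v"
    for k :: int and p w :: "real^2"
  proof -
    have "norm p \<le> sqrt N" using that(2) by (simp add: real_le_rsqrt)
    moreover have "2 * norm w \<le> 2 * norm u + 2 * norm v" using that(3) by auto
    moreover have "0 \<le> sqrt N" using calculation(1) norm_ge_zero[of p] by linarith
    ultimately have "norm p * (2 * norm w) \<le> sqrt N * (2 * norm u + 2 * norm v)"
      by (intro mult_mono) auto
    then have "2 * (norm p * norm w) \<le> sqrt N * (2 * norm u + 2 * norm v)" by simp
    then have "\<bar>real_of_int k\<bar> \<le> B"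
      using that(1) dpos by (simp add: B_def pos_le_divide_eq)
    then show ?thesis unfolding K_def by (simp; linarith)
  qed
  have "{p \<in> L. (norm p)\<^sup>2 \<le> N} \<subseteq> (\<lambda>(m, n). of_int m *\<^sub>R u + of_int n *\<^sub>R v) ` (K \<times> K)"
  proof clarify
    fix p assume "p \<in> L" and N: "(norm p)\<^sup>2 \<le> N"
    then obtain m n where p: "p = of_int m *\<^sub>R u + of_int n *\<^sub>R v"
      unfolding L lattice_of_def by blast
    have "p $ 1 * v $ 2 - p $ 2 * v $ 1 = of_int m * (u $ 1 * v $ 2 - u $ 2 * v $ 1)"
      by (simp add: p algebra_simps)
    then have "\<bar>of_int m\<bar> * d \<le> 2 * (norm p * norm v)"
      using cross[of p v] by (simp add: d_def abs_mult)
    then have m: "m \<in> K" using N by (intro bnd) auto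
    have "p $ 1 * u $ 2 - p $ 2 * u $ 1 = - (of_int n * (u $ 1 * v $ 2 - u $ 2 * v $ 1))"
      by (simp add: p algebra_simps)
    then have "\<bar>of_int n\<bar> * d \<le> 2 * (norm p * norm u)"
      using cross[of p u] by (simp add: d_def abs_mult)
    then have n: "n \<in> K" using N by (intro bnd) auto
    show "p \<in> (\<lambda>(m, n). of_int m *\<^sub>R u + of_int n *\<^sub>R v) ` (K \<times> K)"
      using m n p by auto
  qed
  then show ?thesis by (rule finite_subset) (simp add: K_def)
qed

text \<open>Hence \<open>lattice_energy2\<close> is the cardinality of a finite set.\<close>

lemma finite_energy_pairs:
  assumes "is_lattice L"
  shows "finite {(p1, p2). p1 \<in> L \<and> p2 \<in> L \<and> (norm p1)\<^sup>2 = (norm p2)\<^sup>2 \<and> (norm p2)\<^sup>2 \<le> N}"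
  by (rule finite_subset[of _ "{p \<in> L. (norm p)\<^sup>2 \<le> N} \<times> {p \<in> L. (norm p)\<^sup>2 \<le> N}"])
     (use finite_lattice_ball[OF assms] in auto)

text \<open>\<open>N sufficiently large\<close> has to be read for a fixed competitor (\<open>D\<close> or \<open>L\<close>): no threshold is
  uniform in the competitor. For fixed \<open>N > 0\<close> the energy is unbounded over the lattices of
  covolume 1, since \<open>lattice_of (vector [t, 0]) (vector [0, 1 / t])\<close> has about \<open>2 * sqrt N / t\<close>
  points \<open>(k * t, 0)\<close> in the disc, and \<open>energy2 D N\<close> is unbounded as \<open>D\<close> tends to minus infinity
  through either congruence class, because of the representations \<open>n = x\<^sup>2 = Q_form D x 0\<close>.\<close>

end

theory Submission
  imports Defs "HOL-Number_Theory.Totient"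
begin

text \<open>
  Let \<open>f\<close> be a primitive positive definite integral form of discriminant \<open>-D\<close>. If \<open>f p = f q\<close>, then
  \<open>q\<close> is the mirror image of \<open>p\<close> in the line orthogonal to \<open>p - q\<close>; so, apart from the diagonal, the
  energy counts, for every primitive vector \<open>v\<close>, the points of a ball whose reflection along \<open>v\<close>
  is integral. These form a sublattice of index \<open>f v / h v\<close>, where \<open>h v\<close> is a divisor of \<open>D\<close>,
  and counting points in ellipses shows that the energy of the normalised lattice up to \<open>N\<close> is
  governed, up to \<open>O(N)\<close>, by the sum of \<open>h v / f v\<close> over the primitive \<open>v\<close> with \<open>f v \<le> T\<close>,
  where \<open>T\<close> is proportional to \<open>N\<close>.

  The sum of \<open>1 / f v\<close> over primitive \<open>v\<close> is \<open>C / sqrt D * ln T + O(1)\<close> with a universal constant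
  \<open>C\<close>, so only the mean of \<open>h v / sqrt D\<close> matters. Writing \<open>h\<close> as the sum of \<open>totient e\<close> over its
  divisors \<open>e\<close>, and noting that the \<open>v\<close> with \<open>e dvd h v\<close> lie in a sublattice of index about \<open>e\<close>,
  this mean is at most \<open>0.81\<close> unless \<open>D = 3\<close>, and at most \<open>0.61\<close> for the norm forms competing
  with the Gaussian integers. Multiplication by a square root of \<open>-3\<close>, respectively by \<open>1 + i\<close>,
  gives the lower bounds \<open>sqrt 3 / 2\<close> and \<open>2 / 3\<close> for the two maximisers. A lattice that is not similar
  to an integral one has at most one pair of orthogonal lines through lattice points, hence energy \<open>O(N)\<close> only.
\<close>

section \<open>Lattice points in ellipses\<close>

text \<open>For an arbitrary form the representation numbers need not be multiplicative, since
  several classes may share a discriminant. Counting reflections bypasses them and treats every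
  integral form, hence every lattice similar to one, in the same way. The obstacle is uniformity:
  the number of directions \<open>v\<close> grows like \<open>N\<close>, so each ellipse count needs
  an error explicit in \<open>f v\<close>. That error is a constant times
  \<open>sqrt (X / f v)\<close>, and the sum of \<open>1 / sqrt (f v)\<close> over
  \<open>f v \<le> 4 * X\<close> is only of order \<open>sqrt X\<close>, so the total error stays
  linear. The mean of \<open>h v\<close> is only estimated from one side on each form, and the
  estimates leave a gap. The constant 0.81 lies just above \<open>9 / (5 * sqrt 5)\<close>, the
  value of the arithmetic bound at the odd number 5, and below \<open>sqrt 3 / 2\<close>. As it
  exceeds \<open>2 / 3\<close>, the Gaussian comparison has to use the special shape of the
  competing norm forms; there 0.61 lies just above \<open>27 / (20 * sqrt 5)\<close>, the value at
  -5.\<close>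

definition circ :: "real \<Rightarrow> real" where
  "circ s = sqrt (max 0 (1 - s\<^sup>2))"

text \<open>This is pi/4, kept as an integral: it enters both sides of every comparison through the
  common factor \<open>lead_const\<close>.\<close>

definition quarter_disc :: real where
  "quarter_disc = integral {0..1} circ"

lemma circ_0 [simp]: "circ 0 = 1"
  by (simp add: circ_def)

lemma circ_minus [simp]: "circ (- s) = circ s"
  by (simp add: circ_def)

lemma circ_nonneg: "0 \<le> circ s"
  by (simp add: circ_def)

lemma circ_antimono: "0 \<le> s \<Longrightarrow> s \<le> t \<Longrightarrow> circ t \<le> circ s"
  unfolding circ_def by (intro real_sqrt_le_mono max.mono diff_left_mono power_mono) auto

lemma circ_eq_0: "1 \<le> s \<Longrightarrow> circ s = 0"
  by (simp add: circ_def)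

lemma circ_integrable: "circ integrable_on {a..b}"
  unfolding circ_def by (intro integrable_continuous_real continuous_intros)

lemma circ_integral_step:
  assumes "0 \<le> s" "s \<le> t"
  shows "(t - s) * circ t \<le> integral {s..t} circ" "integral {s..t} circ \<le> (t - s) * circ s"
proof -
  have "integral {s..t} (\<lambda>_. circ t) \<le> integral {s..t} circ"
    using assms by (intro integral_le circ_integrable) (auto intro: circ_antimono)
  then show "(t - s) * circ t \<le> integral {s..t} circ" using assms by simp
  have "integral {s..t} circ \<le> integral {s..t} (\<lambda>_. circ s)"
    using assms by (intro integral_le circ_integrable) (auto intro: circ_antimono)
  then show "integral {s..t} circ \<le> (t - s) * circ s" using assms by simp
qed

text \<open>Right and left endpoint Riemann sums of mesh \<open>1 / Y\<close> enclose the integral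
  of a function that decreases on the nonnegative reals.\<close>

lemma circ_sum_bounds_aux:
  fixes Y :: real and n :: nat
  assumes "Y > 0"
  shows "(\<Sum>y=1..n. circ (y / Y)) \<le> Y * integral {0..n / Y} circ"
    and "Y * integral {0..n / Y} circ \<le> (\<Sum>y<n. circ (y / Y))"
proof (induction n)
  case (Suc n)
  have split: "integral {0..Suc n / Y} circ
      = integral {0..n / Y} circ + integral {n / Y..Suc n / Y} circ"
    by (rule Henstock_Kurzweil_Integration.integral_combine[symmetric])
       (use assms circ_integrable in \<open>auto simp: divide_right_mono\<close>)
  have step: "Suc n / Y - n / Y = 1 / Y"
    by (simp add: diff_divide_distrib[symmetric])
  have le: "0 \<le> n / Y" "n / Y \<le> Suc n / Y"
    using assms by (auto simp: divide_right_mono)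
  have "circ (Suc n / Y) \<le> Y * integral {n / Y..Suc n / Y} circ"
    using circ_integral_step(1)[OF le] assms unfolding step by (simp add: field_simps)
  moreover have "Y * integral {n / Y..Suc n / Y} circ \<le> circ (n / Y)"
    using circ_integral_step(2)[OF le] assms unfolding step by (simp add: field_simps)
  ultimately show "(\<Sum>y=1..Suc n. circ (y / Y)) \<le> Y * integral {0..Suc n / Y} circ"
    "Y * integral {0..Suc n / Y} circ \<le> (\<Sum>y<Suc n. circ (y / Y))"
    using Suc unfolding split by (simp_all add: algebra_simps)
qed auto

text \<open>Truncation by \<open>max 0\<close> makes \<open>circ\<close> vanish beyond 1, so every
  \<open>n\<close> with \<open>Y \<le> n\<close> gives the same integral. The loss of 1 is the term
  \<open>y = 0\<close> of the left endpoint sum.\<close>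

lemma circ_sum_bounds:
  fixes Y :: real and n :: nat
  assumes "Y > 0" "Y \<le> n"
  shows "(\<Sum>y=1..n. circ (y / Y)) \<le> Y * quarter_disc"
    and "Y * quarter_disc - 1 \<le> (\<Sum>y=1..n. circ (y / Y))"
proof -
  have n: "1 \<le> n / Y" using assms by simp
  have "integral {1..n / Y} circ = integral {1..n / Y} (\<lambda>_. 0)"
    by (rule integral_cong) (simp add: circ_eq_0)
  then have eq: "integral {0..n / Y} circ = quarter_disc"
    using Henstock_Kurzweil_Integration.integral_combine[of 0 1 "n / Y" circ] n circ_integrable
    by (simp add: quarter_disc_def)
  show "(\<Sum>y=1..n. circ (y / Y)) \<le> Y * quarter_disc"
    using circ_sum_bounds_aux(1)[OF assms(1), of n] by (simp add: eq)
  have "n > 0" using assms by (cases n) auto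
  then have "(\<Sum>y<n. circ (y / Y)) = 1 + (\<Sum>y=1..<n. circ (y / Y))"
    by (simp add: lessThan_atLeast0 sum.atLeast_Suc_lessThan)
  also have "\<dots> \<le> 1 + (\<Sum>y=1..n. circ (y / Y))"
    by (intro add_left_mono sum_mono2) (auto simp: circ_nonneg)
  finally show "Y * quarter_disc - 1 \<le> (\<Sum>y=1..n. circ (y / Y))"
    using circ_sum_bounds_aux(2)[OF assms(1), of n] by (simp add: eq)
qed

lemma quarter_disc_pos: "quarter_disc > 0"
proof -
  have "(\<Sum>y=1..2::nat. circ (y / 2)) \<le> 2 * quarter_disc"
    by (rule circ_sum_bounds) auto
  moreover have "circ (1 / 2) > 0"
    by (simp add: circ_def power2_eq_square)
  ultimately show ?thesis
    using circ_nonneg[of 1] by (simp add: numeral_2_eq_2)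
qed

lemma card_int_interval:
  fixes r w :: real
  assumes "w \<ge> 0"
  shows "finite {x::int. (x + r)\<^sup>2 \<le> w}" "\<bar>real (card {x::int. (x + r)\<^sup>2 \<le> w}) - 2 * sqrt w\<bar> \<le> 1"
proof -
  have eq: "{x::int. (x + r)\<^sup>2 \<le> w} = {\<lceil>- sqrt w - r\<rceil>..\<lfloor>sqrt w - r\<rfloor>}"
  proof (intro set_eqI)
    fix x :: int
    have "(x + r)\<^sup>2 \<le> w \<longleftrightarrow> \<bar>x + r\<bar> \<le> sqrt w"
      using assms by (metis real_sqrt_abs real_sqrt_le_iff)
    then show "x \<in> {x::int. (x + r)\<^sup>2 \<le> w} \<longleftrightarrow> x \<in> {\<lceil>- sqrt w - r\<rceil>..\<lfloor>sqrt w - r\<rfloor>}"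
      by (auto simp: abs_le_iff ceiling_le_iff le_floor_iff)
  qed
  show "finite {x::int. (x + r)\<^sup>2 \<le> w}" unfolding eq by simp
  define d where "d = \<lfloor>sqrt w - r\<rfloor> - \<lceil>- sqrt w - r\<rceil> + 1"
  have d: "2 * sqrt w - 1 < d" "d \<le> 2 * sqrt w + 1"
    unfolding d_def by linarith+
  have "0 \<le> sqrt w" using assms by simp
  then have "0 \<le> d" using d by linarith
  then have "real (card {\<lceil>- sqrt w - r\<rceil>..\<lfloor>sqrt w - r\<rfloor>}) = d"
    by (simp add: d_def)
  then show "\<bar>real (card {x::int. (x + r)\<^sup>2 \<le> w}) - 2 * sqrt w\<bar> \<le> 1"
    unfolding eq using d by linarith
qed

definition qf :: "int \<Rightarrow> int \<Rightarrow> int \<Rightarrow> int \<times> int \<Rightarrow> int" where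
  "qf a b c v = a * (fst v)\<^sup>2 + b * fst v * snd v + c * (snd v)\<^sup>2"

abbreviation disc :: "int \<Rightarrow> int \<Rightarrow> int \<Rightarrow> int" where
  "disc a b c \<equiv> 4 * a * c - b\<^sup>2"

definition posdef :: "int \<Rightarrow> int \<Rightarrow> int \<Rightarrow> bool" where
  "posdef a b c \<longleftrightarrow> 0 < a \<and> 0 < disc a b c"

lemma qf_complete_square:
  "4 * a * qf a b c (x, y) = (2 * a * x + b * y)\<^sup>2 + (disc a b c) * y\<^sup>2"
  by (simp add: qf_def power2_eq_square algebra_simps)

definition qf_slice :: "int \<Rightarrow> int \<Rightarrow> int \<Rightarrow> real \<Rightarrow> int \<Rightarrow> int set" where
  "qf_slice a b c X y = {x. real_of_int (qf a b c (x, y)) \<le> X}"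

text \<open>Completing the square: \<open>Y\<close> is the half-height of the ellipse, and the row
  at height \<open>y\<close> is an interval centred at \<open>- b * y / (2 * a)\<close> of
  half-length \<open>sqrt (X / a) * circ (y / Y)\<close>.\<close>

lemma qf_le_iff:
  fixes X :: real
  assumes "posdef a b c" "X > 0"
  defines "Y \<equiv> 2 * sqrt (real_of_int a * X / real_of_int (disc a b c))"
  shows "qf a b c (x, y) \<le> X \<longleftrightarrow> (x + b * y / (2 * a))\<^sup>2 \<le> X / a * (1 - (y / Y)\<^sup>2)"
proof -
  define D where "D = disc a b c"
  have a: "a > 0" "D > 0" using assms(1) by (auto simp: posdef_def D_def)
  have Y2: "Y\<^sup>2 = 4 * (a * X / D)"
    unfolding Y_def D_def[symmetric] using a assms by (simp add: power_mult_distrib)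
  have Y: "(y / Y)\<^sup>2 = D * y\<^sup>2 / (4 * a * X)"
    using a assms(2) by (simp add: power_divide Y2 field_simps)
  have "real_of_int (4 * a * qf a b c (x, y)) = (real_of_int (2 * a * x + b * y))\<^sup>2 + D * (real_of_int y)\<^sup>2"
    unfolding qf_complete_square D_def by simp
  also have "(real_of_int (2 * a * x + b * y))\<^sup>2 = (2 * real_of_int a)\<^sup>2 * (x + b * y / (2 * a))\<^sup>2"
    using a by (simp add: power_mult_distrib[symmetric] field_simps)
  finally have "real_of_int (4 * a) * qf a b c (x, y)
      = real_of_int (4 * a) * (a * (x + b * y / (2 * a))\<^sup>2 + D * y\<^sup>2 / (4 * a))"
    using a by (simp add: distrib_left power2_eq_square)
  then have q: "qf a b c (x, y) = a * (x + b * y / (2 * a))\<^sup>2 + D * y\<^sup>2 / (4 * a)"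
    using a by simp
  show ?thesis
  proof -
    have "X / a * (1 - D * y\<^sup>2 / (4 * a * X)) = (X - D * y\<^sup>2 / (4 * a)) / a"
      using a assms(2) by (simp add: field_simps)
    moreover have "real_of_int a > 0" using a by simp
    ultimately show ?thesis
      unfolding q Y by (simp only: pos_le_divide_eq le_diff_eq mult.commute of_int_mult of_int_numeral)
  qed
qed

lemma qf_rows:
  fixes X :: real and n :: nat
  assumes "posdef a b c" "X > 0"
  defines "Y \<equiv> 2 * sqrt (real_of_int a * X / real_of_int (disc a b c))"
  assumes n: "Y \<le> n"
  shows "Y > 0"
    and "finite (qf_slice a b c X y)"
    and "\<bar>real (card (qf_slice a b c X y)) - 2 * sqrt (X / real_of_int a) * circ (real_of_int y / Y)\<bar> \<le> 1"
    and "{v. real_of_int (qf a b c v) \<le> X} = (\<lambda>(y, x). (x, y)) ` (SIGMA y:{-int n..int n}. qf_slice a b c X y)"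
proof -
  define D where "D = disc a b c"
  have a: "a > 0" "D > 0" using assms(1) by (auto simp: posdef_def D_def)
  show Y: "Y > 0" unfolding Y_def D_def[symmetric] using a assms by simp
  note iff = qf_le_iff[OF assms(1,2), folded Y_def]
  have big: "qf_slice a b c X y = {}" if "\<bar>y\<bar> > Y" for y :: int
  proof -
    have "1 < \<bar>y\<bar> / Y" using that Y by simp
    then have "1 < (\<bar>y\<bar> / Y)\<^sup>2" by (simp add: one_less_power)
    then have "1 - (y / Y)\<^sup>2 < 0" by (simp add: power_divide)
    then have neg: "X / a * (1 - (y / Y)\<^sup>2) < 0"
      using assms(2) a by (intro mult_pos_neg) auto
    show ?thesis unfolding qf_slice_def iff using less_le_trans[OF neg zero_le_power2]
      by (simp add: not_le)
  qed
  have "finite (qf_slice a b c X y) \<and> \<bar>real (card (qf_slice a b c X y)) - 2 * sqrt (X / a) * circ (y / Y)\<bar> \<le> 1" for y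
  proof (cases "\<bar>y\<bar> > Y")
    case True
    have "circ (\<bar>y\<bar> / Y) = 0" using True Y by (intro circ_eq_0) simp
    then have "circ (y / Y) = 0" by (cases "y \<ge> 0") auto
    then show ?thesis using big[OF True] by simp
  next
    case False
    then have "\<bar>y\<bar> / Y \<le> 1" using Y by simp
    then have "\<bar>y / Y\<bar> \<le> 1" using Y by simp
    then have le: "(y / Y)\<^sup>2 \<le> 1" by (simp add: abs_square_le_1)
    then have w: "0 \<le> X / a * (1 - (y / Y)\<^sup>2)" using assms(2) a by simp
    have "sqrt (X / a * (1 - (y / Y)\<^sup>2)) = sqrt (X / a) * circ (y / Y)"
      unfolding circ_def real_sqrt_mult using le by (simp add: max_def)
    then show ?thesis
      unfolding qf_slice_def iff using card_int_interval[OF w, of "b * y / (2 * a)"] by simp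
  qed
  then show "finite (qf_slice a b c X y)" "\<bar>real (card (qf_slice a b c X y)) - 2 * sqrt (X / a) * circ (y / Y)\<bar> \<le> 1"
    by auto
  have "y \<in> {-int n..int n}" if "x \<in> qf_slice a b c X y" for x y
  proof -
    have "\<bar>y\<bar> \<le> Y" using big[of y] that by force
    then show ?thesis using n by auto
  qed
  then show "{v. real_of_int (qf a b c v) \<le> X} = (\<lambda>(y, x). (x, y)) ` (SIGMA y:{-int n..int n}. qf_slice a b c X y)"
    by (auto simp: qf_slice_def image_iff)
qed

lemma sum_symmetric_int:
  fixes g :: "int \<Rightarrow> real"
  assumes "\<And>y. g (- y) = g y"
  shows "sum g {-int n..int n} = g 0 + 2 * (\<Sum>y=1..n. g (int y))"
proof (induction n)
  case (Suc n)
  have "{-int (Suc n)..int (Suc n)} = insert (- int (Suc n)) (insert (int (Suc n)) {-int n..int n})"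
    by auto
  then have "sum g {-int (Suc n)..int (Suc n)} = 2 * g (int (Suc n)) + sum g {-int n..int n}"
    by (simp add: assms[of "int (Suc n)", simplified])
  then show ?case using Suc by simp
qed simp

text \<open>The \<open>2 * n + 1\<close> rows, with \<open>n \<le> Y + 1\<close>, each contribute an
  error of at most 1, and the Riemann sum one of \<open>2 * sqrt (X / a)\<close>. The error is
  explicit in \<open>a\<close> and \<open>D\<close> because the estimate is later applied to a
  different sublattice for each direction.\<close>

lemma qf_ellipse_count:
  fixes X :: real
  assumes "posdef a b c" "X > 0"
  defines "D \<equiv> real_of_int (disc a b c)"
  shows "finite {v. real_of_int (qf a b c v) \<le> X}"
    and "\<bar>real (card {v. real_of_int (qf a b c v) \<le> X}) - 8 * quarter_disc * X / sqrt D\<bar>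
           \<le> 2 * sqrt (X / a) + 4 * sqrt (a * X / D) + 3"
proof -
  define Y where "Y = 2 * sqrt (a * X / D)"
  define n where "n = nat \<lceil>Y\<rceil>"
  have pos: "a > 0" "D > 0" using assms(1) unfolding posdef_def D_def by linarith+
  have n: "Y \<le> n" unfolding n_def by linarith
  note rows = qf_rows[OF assms(1,2) n[unfolded Y_def D_def], folded D_def, folded Y_def, folded qf_slice_def]
  have n': "n \<le> Y + 1" using rows(1) unfolding n_def by linarith
  have set: "{v. real_of_int (qf a b c v) \<le> X} = (\<lambda>(y, x). (x, y)) ` (SIGMA y:{-int n..int n}. qf_slice a b c X y)"
    by (rule rows(4))
  show "finite {v. real_of_int (qf a b c v) \<le> X}"
    unfolding set using rows(2) by auto
  have "card {v. real_of_int (qf a b c v) \<le> X} = (\<Sum>y\<in>{-int n..int n}. card (qf_slice a b c X y))"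
    unfolding set using rows(2) by (subst card_image) (auto simp: inj_on_def)
  then have card: "real (card {v. real_of_int (qf a b c v) \<le> X}) = (\<Sum>y\<in>{-int n..int n}. real (card (qf_slice a b c X y)))"
    by simp
  have "\<bar>(\<Sum>y\<in>{-int n..int n}. real (card (qf_slice a b c X y)) - 2 * sqrt (X / a) * circ (y / Y))\<bar>
      \<le> (\<Sum>y\<in>{-int n..int n}. 1)"
    by (rule order_trans[OF sum_abs]) (intro sum_mono rows(3))
  also have "\<dots> \<le> 2 * Y + 3" using n' by simp
  finally have err: "\<bar>real (card {v. real_of_int (qf a b c v) \<le> X})
      - 2 * sqrt (X / a) * (\<Sum>y\<in>{-int n..int n}. circ (y / Y))\<bar> \<le> 2 * Y + 3"
    by (simp add: card sum_subtractf sum_distrib_left)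
  define S where "S = (\<Sum>y=1..n. circ (y / Y))"
  have S: "S \<le> Y * quarter_disc" "Y * quarter_disc - 1 \<le> S"
    using circ_sum_bounds[OF rows(1) n] by (auto simp: S_def)
  have "(\<Sum>y\<in>{-int n..int n}. circ (y / Y)) = 1 + 2 * S"
    by (subst sum_symmetric_int) (auto simp: S_def)
  moreover have "\<bar>2 * sqrt (X / a) * (1 + 2 * S) - 2 * sqrt (X / a) * (2 * (Y * quarter_disc))\<bar>
      \<le> 2 * sqrt (X / a)"
  proof -
    have "\<bar>1 + 2 * S - 2 * (Y * quarter_disc)\<bar> \<le> 1" using S by linarith
    then have "2 * sqrt (X / a) * \<bar>1 + 2 * S - 2 * (Y * quarter_disc)\<bar> \<le> 2 * sqrt (X / a) * 1"
      using assms(2) pos by (intro mult_left_mono) auto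
    moreover have "2 * sqrt (X / a) * \<bar>1 + 2 * S - 2 * (Y * quarter_disc)\<bar>
        = \<bar>2 * sqrt (X / a) * (1 + 2 * S - 2 * (Y * quarter_disc))\<bar>"
      using assms(2) pos by (simp add: abs_mult)
    ultimately show ?thesis by (simp add: algebra_simps)
  qed
  moreover have "2 * sqrt (X / a) * (2 * (Y * quarter_disc)) = 8 * quarter_disc * X / sqrt D"
  proof -
    have "sqrt (X / a) * sqrt (a * X / D) = sqrt (X * X / D)"
      unfolding real_sqrt_mult[symmetric] using pos by (simp add: field_simps)
    also have "\<dots> = X / sqrt D" using assms(2) by (simp add: real_sqrt_divide)
    finally show ?thesis by (simp add: Y_def algebra_simps)
  qed
  ultimately show "\<bar>real (card {v. real_of_int (qf a b c v) \<le> X}) - 8 * quarter_disc * X / sqrt D\<bar>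
      \<le> 2 * sqrt (X / a) + 4 * sqrt (a * X / D) + 3"
    using err by (simp add: Y_def)
qed

section \<open>Sums over the values of a form\<close>

definition qball :: "int \<Rightarrow> int \<Rightarrow> int \<Rightarrow> real \<Rightarrow> (int \<times> int) set" where
  "qball a b c T = {v. v \<noteq> (0, 0) \<and> real_of_int (qf a b c v) \<le> T}"

lemma qf_nonneg: "posdef a b c \<Longrightarrow> 0 \<le> qf a b c v"
proof -
  assume "posdef a b c"
  then have a: "a > 0" "disc a b c > 0" by (auto simp: posdef_def)
  have "0 \<le> 4 * a * qf a b c (fst v, snd v)"
    unfolding qf_complete_square using a by simp
  then show ?thesis using a by (simp add: zero_le_mult_iff)
qed

lemma qf_eq_0_iff: "posdef a b c \<Longrightarrow> qf a b c v = 0 \<longleftrightarrow> v = (0, 0)"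
proof
  assume "posdef a b c"
  then have a: "a > 0" "disc a b c > 0" by (auto simp: posdef_def)
  assume "qf a b c v = 0"
  then have z: "(2 * a * fst v + b * snd v)\<^sup>2 + (disc a b c) * (snd v)\<^sup>2 = 0"
    using qf_complete_square[of a b c "fst v" "snd v"] by simp
  moreover have "0 \<le> (disc a b c) * (snd v)\<^sup>2" using a by simp
  ultimately have "(disc a b c) * (snd v)\<^sup>2 = 0" "(2 * a * fst v + b * snd v)\<^sup>2 = 0"
    using zero_le_power2[of "2 * a * fst v + b * snd v"] by linarith+
  then show "v = (0, 0)" using a by (cases v) auto
qed (simp add: qf_def)

lemma qf_pos: "posdef a b c \<Longrightarrow> v \<noteq> (0, 0) \<Longrightarrow> 1 \<le> qf a b c v"
  using qf_nonneg[of a b c v] qf_eq_0_iff[of a b c v] by linarith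

lemma qball_empty: "posdef a b c \<Longrightarrow> T < 1 \<Longrightarrow> qball a b c T = {}"
proof -
  assume *: "posdef a b c" "T < 1"
  have False if "v \<noteq> (0, 0)" "real_of_int (qf a b c v) \<le> T" for v
    using qf_pos[OF *(1) that(1)] that(2) *(2) by linarith
  then show ?thesis unfolding qball_def by blast
qed

lemma finite_qball:
  assumes "posdef a b c"
  shows "finite (qball a b c T)"
proof (cases "T < 1")
  case False
  then have "finite {v. real_of_int (qf a b c v) \<le> T}"
    by (intro qf_ellipse_count(1)[OF assms]) simp
  then show ?thesis by (rule rev_finite_subset) (auto simp: qball_def)
qed (simp add: qball_empty[OF assms])

lemma qball_mono: "S \<le> T \<Longrightarrow> qball a b c S \<subseteq> qball a b c T"
  by (auto simp: qball_def)

text \<open>The area 2 pi / sqrt D of the ellipse where the form is at most 1, hence the number of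
  lattice vectors per unit of the bound.\<close>

definition qdens :: "int \<Rightarrow> int \<Rightarrow> int \<Rightarrow> real" where
  "qdens a b c = 8 * quarter_disc / sqrt (real_of_int (disc a b c))"

lemma qdens_pos: "posdef a b c \<Longrightarrow> 0 < qdens a b c"
  using quarter_disc_pos unfolding qdens_def posdef_def
  by (intro divide_pos_pos) (auto simp flip: of_int_power of_int_mult of_int_diff)

lemma card_qball:
  assumes "posdef a b c"
  obtains K where "K > 0" "\<And>T. T \<ge> 1 \<Longrightarrow> \<bar>card (qball a b c T) - qdens a b c * T\<bar> \<le> K * sqrt T"
proof -
  define D where "D = real_of_int (disc a b c)"
  have pos: "real_of_int a > 0" "D > 0"
    using assms unfolding posdef_def D_def by linarith+
  define K where "K = 2 / sqrt a + 4 * sqrt a / sqrt D + 4"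
  have "K > 0" using pos by (auto simp: K_def intro!: add_nonneg_pos)
  moreover have "\<bar>card (qball a b c T) - qdens a b c * T\<bar> \<le> K * sqrt T" if T: "T \<ge> 1" for T
  proof -
    have "{v. real_of_int (qf a b c v) \<le> T} = insert (0, 0) (qball a b c T)"
      using T by (auto simp: qball_def qf_def)
    then have "card {v. real_of_int (qf a b c v) \<le> T} = Suc (card (qball a b c T))"
      using finite_qball[OF assms] by (simp add: qball_def)
    then have "\<bar>1 + real (card (qball a b c T)) - qdens a b c * T\<bar>
        \<le> 2 * sqrt (T / a) + 4 * sqrt (a * T / D) + 3"
      using qf_ellipse_count(2)[OF assms, of T] T by (simp add: qdens_def D_def)
    moreover have "1 \<le> sqrt T" using T by simp
    moreover have "2 * sqrt (T / a) + 4 * sqrt (a * T / D) + 4 * sqrt T = K * sqrt T"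
      using pos by (simp add: K_def real_sqrt_divide real_sqrt_mult field_simps)
    ultimately show ?thesis by linarith
  qed
  ultimately show thesis by (rule that)
qed

text \<open>Summation by parts over the level sets of the form, turning an asymptotic count of balls
  into asymptotics of weighted sums.\<close>

lemma qball_abel_sum:
  fixes g :: "nat \<Rightarrow> real"
  assumes "posdef a b c"
  shows "(\<Sum>v\<in>qball a b c (real n). g (nat (qf a b c v)))
    = (\<Sum>m=1..n. card (qball a b c (real m)) * (g m - g (Suc m)))
      + card (qball a b c (real n)) * g (Suc n)"
proof (induction n)
  case 0
  then show ?case by (simp add: qball_empty[OF assms])
next
  case (Suc n)
  define N where "N = {v. qf a b c v = int (Suc n)}"
  have split: "qball a b c (real (Suc n)) = qball a b c (real n) \<union> N"
    unfolding qball_def N_def by (auto simp: qf_eq_0_iff[OF assms]; simp add: qf_def)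
  have disj: "qball a b c (real n) \<inter> N = {}"
    unfolding qball_def N_def by auto
  have fin: "finite (qball a b c (real n))" "finite N"
    using finite_qball[OF assms, of "real n"] finite_qball[OF assms, of "real (Suc n)"]
    unfolding split by auto
  have "(\<Sum>v\<in>N. g (nat (qf a b c v))) = (\<Sum>v\<in>N. g (Suc n))"
  proof (intro sum.cong refl)
    fix v assume "v \<in> N"
    then have "nat (qf a b c v) = Suc n" unfolding N_def by simp
    then show "g (nat (qf a b c v)) = g (Suc n)" by simp
  qed
  then have "(\<Sum>v\<in>N. g (nat (qf a b c v))) = real (card N) * g (Suc n)"
    by simp
  then have "(\<Sum>v\<in>qball a b c (real (Suc n)). g (nat (qf a b c v)))
      = (\<Sum>v\<in>qball a b c (real n). g (nat (qf a b c v))) + card N * g (Suc n)"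
    unfolding split by (subst sum.union_disjoint[OF fin disj]) simp
  moreover have "card (qball a b c (real (Suc n))) = card (qball a b c (real n)) + card N"
    unfolding split by (rule card_Un_disjoint[OF fin disj])
  ultimately show ?case using Suc.IH by (simp add: algebra_simps)
qed

lemma qball_floor: "T \<ge> 0 \<Longrightarrow> qball a b c T = qball a b c (real (nat \<lfloor>T\<rfloor>))"
  by (simp add: qball_def le_floor_iff)

text \<open>A telescoping majorant for the counting error \<open>sqrt m\<close> after division by
  \<open>m * (m + 1)\<close>.\<close>

lemma inverse_sqrt_telescope:
  fixes m :: nat
  assumes "m \<ge> 1"
  shows "1 / (sqrt m * (m + 1)) \<le> 2 * (1 / sqrt m - 1 / sqrt (m + 1))"
proof -
  define s t where "s = sqrt m" and "t = sqrt (m + 1)"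
  have s: "s > 0" "t > 0" "s \<le> t" "t\<^sup>2 = s\<^sup>2 + 1" using assms by (auto simp: s_def t_def)
  have "t - s = 1 / (t + s)"
    using s by (simp add: field_simps power2_eq_square)
  moreover have "1 / (t + s) \<ge> 1 / (2 * t)"
    using s by (intro divide_left_mono) auto
  ultimately have "1 / (2 * t) * (2 / (s * t)) \<le> (t - s) * (2 / (s * t))"
    using s by (intro mult_right_mono) auto
  moreover have "1 / (2 * t) * (2 / (s * t)) = 1 / (s * t\<^sup>2)"
    by (simp add: power2_eq_square)
  moreover have "(t - s) * (2 / (s * t)) = 2 * (1 / s - 1 / t)"
    using s by (simp add: field_simps)
  ultimately have "1 / (s * t\<^sup>2) \<le> 2 * (1 / s - 1 / t)" by metis
  then show ?thesis by (simp add: s_def t_def)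
qed

lemma inverse_sqrt_telescope_sum: "(\<Sum>m=1..n. 1 / (sqrt (real m) * (real m + 1))) \<le> 2"
proof -
  have "(\<Sum>m=1..n. 1 / (sqrt (real m) * (real m + 1))) \<le> 2 - 2 / sqrt (n + 1)"
  proof (induction n)
    case (Suc n)
    then show ?case using inverse_sqrt_telescope[of "Suc n"] by (simp add: algebra_simps)
  qed simp
  also have "\<dots> \<le> 2" by simp
  finally show ?thesis .
qed

lemma harm_le_ln: "n \<ge> 1 \<Longrightarrow> harm n \<le> ln (real n) + 1"
proof (induction n rule: dec_induct)
  case (step n)
  have "ln (n / Suc n) \<le> n / Suc n - 1" using step by (intro ln_le_minus_one) auto
  also have "\<dots> = - (1 / Suc n)" by (simp add: field_simps)
  finally have "1 / Suc n \<le> ln (Suc n) - ln n" using step by (simp add: ln_div)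
  then show ?case using step by (simp add: harm_Suc inverse_eq_divide)
qed (simp add: harm_def)

text \<open>In the Abel sum for \<open>1 / m\<close> the main term \<open>k * m\<close> of the count
  produces a harmonic sum, while its error \<open>K * sqrt m\<close> produces a convergent
  series.\<close>

lemma qball_inverse_sum:
  assumes "posdef a b c"
  obtains K where "\<And>T. T \<ge> 1 \<Longrightarrow> \<bar>(\<Sum>v\<in>qball a b c T. 1 / qf a b c v) - qdens a b c * ln T\<bar> \<le> K"
proof -
  define k where "k = qdens a b c"
  have k: "k > 0" using qdens_pos[OF assms] by (simp add: k_def)
  obtain K where K: "K > 0" "\<And>T. T \<ge> 1 \<Longrightarrow> \<bar>card (qball a b c T) - k * T\<bar> \<le> K * sqrt T"
    using card_qball[OF assms] unfolding k_def by blast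
  have nat: "\<bar>(\<Sum>v\<in>qball a b c (real n). 1 / qf a b c v) - k * ln n\<bar> \<le> 4 * k + 3 * K" if n: "n \<ge> 1" for n
  proof -
    define R where "R = (\<lambda>m. real (card (qball a b c (real m))))"
    have R: "\<bar>R m - k * m\<bar> \<le> K * sqrt m" if "m \<ge> 1" for m
      using K(2)[of m] that by (simp add: R_def)
    have "(\<Sum>v\<in>qball a b c (real n). 1 / qf a b c v)
        = (\<Sum>v\<in>qball a b c (real n). 1 / real (nat (qf a b c v)))"
      using qf_nonneg[OF assms] by (intro sum.cong) auto
    also have "\<dots> = (\<Sum>m=1..n. R m * (1 / m - 1 / Suc m)) + R n * (1 / Suc n)"
      unfolding R_def by (rule qball_abel_sum[OF assms, where g = "\<lambda>m. 1 / real m"])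
    also have "(\<Sum>m=1..n. R m * (1 / m - 1 / Suc m)) = (\<Sum>m=1..n. R m / (real m * (real m + 1)))"
      by (intro sum.cong) (auto simp: field_simps)
    finally have A: "(\<Sum>v\<in>qball a b c (real n). 1 / qf a b c v)
        = (\<Sum>m=1..n. R m / (real m * (real m + 1))) + R n / (real n + 1)"
      by simp
    have "\<bar>(\<Sum>m=1..n. R m / (real m * (real m + 1))) - (\<Sum>m=1..n. k / (real m + 1))\<bar>
        \<le> (\<Sum>m=1..n. K * (1 / (sqrt m * (real m + 1))))"
      unfolding sum_subtractf[symmetric]
    proof (rule order_trans[OF sum_abs], intro sum_mono)
      fix m assume "m \<in> {1..n}"
      then have m: "m \<ge> 1" by simp
      have "k / (real m + 1) = k * m / (real m * (real m + 1))" using m by simp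
      then have "R m / (real m * (real m + 1)) - k / (real m + 1) = (R m - k * m) / (real m * (real m + 1))"
        by (simp add: diff_divide_distrib)
      also have "\<bar>\<dots>\<bar> = \<bar>R m - k * m\<bar> / (real m * (real m + 1))"
        by (simp add: abs_mult)
      also have "\<dots> \<le> K * sqrt m / (real m * (real m + 1))"
        using R[OF m] by (intro divide_right_mono) auto
      also have "\<dots> = K * sqrt m / (sqrt m * sqrt m * (real m + 1))" by simp
      also have "\<dots> = K * (1 / (sqrt m * (real m + 1)))"
      proof -
        have can: "K * s / (s * s * M) = K * (1 / (s * M))" if "s \<noteq> 0" for s M :: real
          using that by simp
        show ?thesis by (rule can) (use m in simp)
      qed
      finally show "\<bar>R m / (real m * (real m + 1)) - k / (real m + 1)\<bar> \<le> K * (1 / (sqrt m * (real m + 1)))" .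
    qed
    also have "\<dots> \<le> K * 2"
      unfolding sum_distrib_left[symmetric] using K(1) inverse_sqrt_telescope_sum
      by (intro mult_left_mono) auto
    finally have 1: "\<bar>(\<Sum>m=1..n. R m / (real m * (real m + 1))) - (\<Sum>m=1..n. k / (real m + 1))\<bar> \<le> K * 2" .
    have "(\<Sum>m=1..n. k / (real m + 1)) = k * (harm (Suc n) - 1)"
    proof (induction n)
      case (Suc n)
      then show ?case by (simp add: harm_def algebra_simps divide_inverse)
    qed (simp add: harm_def)
    moreover have "ln (Suc n) \<le> harm (Suc n)"
    proof -
      have "ln (real (Suc n)) \<le> ln (real (Suc n) + 1)" by (subst ln_le_cancel_iff) auto
      also have "\<dots> \<le> harm (Suc n)" by (rule ln_le_harm)
      finally show ?thesis .
    qed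
    moreover have "harm (Suc n) \<le> ln (Suc n) + 1"
      by (rule harm_le_ln) simp
    moreover have "ln (real n) \<le> ln (Suc n)" "ln (Suc n) \<le> ln n + 1"
    proof -
      show "ln (real n) \<le> ln (Suc n)" using n by simp
      have "ln (real (Suc n)) \<le> ln (2 * real n)" using n by simp
      also have "\<dots> = ln 2 + ln n" using n by (simp add: ln_mult)
      also have "ln (2::real) \<le> 1" using ln_2_less_1 by simp
      finally show "ln (Suc n) \<le> ln n + 1" by simp
    qed
    ultimately have "\<bar>(\<Sum>m=1..n. k / (real m + 1)) - k * ln n\<bar> \<le> k * 2"
    proof -
      assume "(\<Sum>m=1..n. k / (real m + 1)) = k * (harm (Suc n) - 1)"
      then have "(\<Sum>m=1..n. k / (real m + 1)) - k * ln n = k * (harm (Suc n) - 1 - ln n)"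
        by (simp add: algebra_simps)
      moreover assume "ln (Suc n) \<le> harm (Suc n)" "harm (Suc n) \<le> ln (Suc n) + 1"
        "ln (real n) \<le> ln (Suc n)" "ln (Suc n) \<le> ln n + 1"
      then have "\<bar>harm (Suc n) - 1 - ln n\<bar> \<le> 2" by linarith
      ultimately show ?thesis using k by (simp add: abs_mult)
    qed
    moreover have "\<bar>R n / (real n + 1)\<bar> \<le> k + K"
    proof -
      have "R n \<le> k * n + K * sqrt n" using R[OF n] by linarith
      also have "sqrt n \<le> n" using n by (simp add: real_le_lsqrt self_le_power)
      finally have "R n \<le> (k + K) * (n + 1)" using K(1) k by (simp add: algebra_simps)
      then show ?thesis by (simp add: R_def divide_le_eq add.commute)
    qed
    ultimately show ?thesis using 1 k K(1) unfolding A by linarith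
  qed
  \<comment> \<open>Rounding \<open>T\<close> down to an integer changes the logarithm by at most
    \<open>ln 2\<close>, which costs one further \<open>k\<close>.\<close>
  have "\<bar>(\<Sum>v\<in>qball a b c T. 1 / qf a b c v) - k * ln T\<bar> \<le> 5 * k + 3 * K" if T: "T \<ge> 1" for T
  proof -
    define n where "n = nat \<lfloor>T\<rfloor>"
    have "1 \<le> \<lfloor>T\<rfloor>" using T by simp
    moreover from this have "real n = of_int \<lfloor>T\<rfloor>" unfolding n_def by simp
    ultimately have n: "n \<ge> 1" "real n \<le> T" "T \<le> 2 * real n" by linarith+
    have "ln n \<le> ln T" using n by simp
    have "ln T \<le> ln (2 * real n)" using n T by (subst ln_le_cancel_iff) auto
    also have "\<dots> = ln 2 + ln n" using n by (simp add: ln_mult)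
    also have "ln (2::real) \<le> 1" using ln_2_less_1 by simp
    finally have "\<bar>ln n - ln T\<bar> \<le> 1" using \<open>ln n \<le> ln T\<close> by linarith
    then have "\<bar>k * ln n - k * ln T\<bar> \<le> k"
      using k by (simp add: abs_mult flip: right_diff_distrib)
    moreover have "qball a b c T = qball a b c (real n)"
      unfolding n_def using T by (intro qball_floor) simp
    ultimately show ?thesis using nat[OF n(1)] by simp
  qed
  then show thesis by (intro that) (auto simp: k_def)
qed

lemma sum_inverse_sqrt: "(\<Sum>m=1..n. 1 / sqrt (real m)) \<le> 2 * sqrt (real n)"
proof (induction n)
  case (Suc n)
  define s t where "s = sqrt n" and "t = sqrt (Suc n)"
  have s: "s \<ge> 0" "t > 0" "s \<le> t" "t\<^sup>2 = s\<^sup>2 + 1" by (auto simp: s_def t_def)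
  have "1 = (t - s) * (t + s)" using s by (simp add: power2_eq_square algebra_simps)
  also have "\<dots> \<le> (t - s) * (2 * t)" using s by (intro mult_left_mono) auto
  finally have "1 / t \<le> 2 * t - 2 * s" using s by (simp add: field_simps)
  then show ?case using Suc by (simp add: s_def t_def)
qed simp

text \<open>This adds up the errors of the single directions in
  \<open>energy_asymptotic\<close>.\<close>

lemma qball_inverse_sqrt_sum:
  assumes "posdef a b c"
  obtains K where "K > 0" "\<And>T. T \<ge> 1 \<Longrightarrow> (\<Sum>v\<in>qball a b c T. 1 / sqrt (qf a b c v)) \<le> K * sqrt T"
proof -
  obtain K0 where K0: "K0 > 0"
    "\<And>T. T \<ge> 1 \<Longrightarrow> \<bar>card (qball a b c T) - qdens a b c * T\<bar> \<le> K0 * sqrt T"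
    using card_qball[OF assms] by blast
  define K where "K = qdens a b c + K0"
  have K: "K > 0" using K0(1) qdens_pos[OF assms] by (simp add: K_def)
  define R where "R = (\<lambda>m. real (card (qball a b c (real m))))"
  have R: "R m \<le> K * m" for m
  proof (cases "m \<ge> 1")
    case True
    have "R m \<le> qdens a b c * m + K0 * sqrt m" using K0(2)[of m] True by (simp add: R_def)
    also have "sqrt m \<le> m" using True by (simp add: real_le_lsqrt self_le_power)
    finally show ?thesis using K0(1) by (simp add: K_def algebra_simps)
  next
    case False
    then have "m = 0" by simp
    then show ?thesis by (simp add: R_def qball_empty[OF assms])
  qed
  \<comment> \<open>The Abel identity read backwards with the count replaced by \<open>m\<close>:
    after bounding the count by \<open>K * m\<close> the weighted sum collapses again.\<close>
  have abel1: "(\<Sum>m=1..n. real m * (g m - g (Suc m))) + n * g (Suc n) = (\<Sum>m=1..n. g m)"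
    for g :: "nat \<Rightarrow> real" and n
    by (induction n) (auto simp: algebra_simps)
  define g where "g = (\<lambda>m. 1 / sqrt (real m))"
  have nat: "(\<Sum>v\<in>qball a b c (real n). 1 / sqrt (qf a b c v)) \<le> 2 * K * sqrt n" for n
  proof -
    have "(\<Sum>v\<in>qball a b c (real n). 1 / sqrt (qf a b c v))
        = (\<Sum>v\<in>qball a b c (real n). g (nat (qf a b c v)))"
      using qf_nonneg[OF assms] by (intro sum.cong) (auto simp: g_def)
    also have "\<dots> = (\<Sum>m=1..n. R m * (g m - g (Suc m))) + R n * g (Suc n)"
      unfolding R_def by (rule qball_abel_sum[OF assms])
    also have "\<dots> \<le> (\<Sum>m=1..n. K * m * (g m - g (Suc m))) + K * n * g (Suc n)"
    proof (intro add_mono sum_mono mult_right_mono R)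
      show "0 \<le> g m - g (Suc m)" if "m \<in> {1..n}" for m
        using that unfolding g_def by (simp add: divide_left_mono)
      show "0 \<le> g (Suc n)" by (simp add: g_def)
    qed
    also have "\<dots> = K * (\<Sum>m=1..n. g m)"
      by (subst abel1[of g n, symmetric]) (simp only: distrib_left sum_distrib_left mult.assoc)
    also have "\<dots> \<le> K * (2 * sqrt n)"
      unfolding g_def using K sum_inverse_sqrt by (intro mult_left_mono) auto
    finally show ?thesis by simp
  qed
  have "(\<Sum>v\<in>qball a b c T. 1 / sqrt (qf a b c v)) \<le> 2 * K * sqrt T" if "T \<ge> 1" for T
  proof -
    have "(\<Sum>v\<in>qball a b c T. 1 / sqrt (qf a b c v)) \<le> 2 * K * sqrt (real (nat \<lfloor>T\<rfloor>))"
      using nat[of "nat \<lfloor>T\<rfloor>"] that by (subst qball_floor) simp_all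
    also have "\<dots> \<le> 2 * K * sqrt T"
      using K that by (intro mult_left_mono real_sqrt_le_mono) auto
    finally show ?thesis .
  qed
  then show thesis using K by (intro that[of "2 * K"]) auto
qed

section \<open>Sums over primitive vectors\<close>

definition pball :: "int \<Rightarrow> int \<Rightarrow> int \<Rightarrow> real \<Rightarrow> (int \<times> int) set" where
  "pball a b c T = {v \<in> qball a b c T. coprime (fst v) (snd v)}"

definition qsum :: "int \<Rightarrow> int \<Rightarrow> int \<Rightarrow> real \<Rightarrow> real" where
  "qsum a b c T = (\<Sum>v\<in>qball a b c T. 1 / qf a b c v)"

definition psum :: "int \<Rightarrow> int \<Rightarrow> int \<Rightarrow> real \<Rightarrow> real" where
  "psum a b c T = (\<Sum>v\<in>pball a b c T. 1 / qf a b c v)"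

lemma finite_pball: "posdef a b c \<Longrightarrow> finite (pball a b c T)"
  unfolding pball_def using finite_qball by simp

lemma qf_scale: "qf a b c (d * x, d * y) = d\<^sup>2 * qf a b c (x, y)"
  by (simp add: qf_def power2_eq_square algebra_simps)

text \<open>A nonzero vector is uniquely \<open>d * v\<close> with \<open>d\<close> positive and
  \<open>v\<close> primitive, and the form scales by \<open>d^2\<close>. The condition
  \<open>T \<le> real N\<close> makes the range of \<open>d\<close> exhaustive, as \<open>d\<close>
  is at most \<open>d^2 * f v\<close>, which is at most \<open>T\<close>.\<close>

lemma qsum_eq_psum:
  assumes "posdef a b c" "T \<le> real N"
  shows "qsum a b c T = (\<Sum>d=1..N. 1 / (real d)\<^sup>2 * psum a b c (T / (real d)\<^sup>2))"
proof -
  define G where "G = (\<lambda>(d::nat, v::int \<times> int). (int d * fst v, int d * snd v))"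
  define F where "F = (\<lambda>w::int \<times> int. (nat (gcd (fst w) (snd w)),
    (fst w div gcd (fst w) (snd w), snd w div gcd (fst w) (snd w))))"
  define S where "S = (SIGMA d:{1..N}. pball a b c (T / (real d)\<^sup>2))"
  have qfG: "real_of_int (qf a b c (G (d, v))) = (real d)\<^sup>2 * qf a b c v" for d v
    by (cases v) (simp add: G_def qf_scale)
  have GS: "G (d, v) \<in> qball a b c T" "F (G (d, v)) = (d, v)" if "(d, v) \<in> S" for d v
  proof -
    from that have d: "d \<ge> 1" and v: "v \<in> pball a b c (T / (real d)\<^sup>2)"
      by (auto simp: S_def)
    have "v \<noteq> (0, 0)" "real_of_int (qf a b c v) \<le> T / (real d)\<^sup>2"
      and cop: "coprime (fst v) (snd v)"
      using v by (auto simp: pball_def qball_def)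
    then have "(real d)\<^sup>2 * qf a b c v \<le> T" using d by (simp add: pos_le_divide_eq mult.commute)
    moreover have "G (d, v) \<noteq> (0, 0)" using d \<open>v \<noteq> (0, 0)\<close> by (cases v) (auto simp: G_def)
    ultimately show "G (d, v) \<in> qball a b c T" by (simp add: qball_def qfG)
    have "gcd (int d * fst v) (int d * snd v) = int d"
      using cop by (simp add: gcd_mult_left coprime_iff_gcd_eq_1)
    then show "F (G (d, v)) = (d, v)" using d by (simp add: F_def G_def)
  qed
  have FS: "F w \<in> S" "G (F w) = w" if "w \<in> qball a b c T" for w
  proof -
    obtain x y where w: "w = (x, y)" by (cases w)
    define g where "g = gcd x y"
    have wT: "w \<noteq> (0, 0)" "real_of_int (qf a b c w) \<le> T" using that by (auto simp: qball_def)
    then have g: "g > 0" by (auto simp: g_def w)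
    obtain x' y' where xy: "x = x' * g" "y = y' * g" "coprime x' y'"
      using gcd_coprime_exists[of x y] g unfolding g_def by force
    have Fw: "F w = (nat g, (x', y'))" using g by (simp add: F_def w g_def[symmetric]) (simp add: xy)
    have Gw: "G (F w) = w" using g unfolding Fw by (simp add: G_def w xy)
    have v: "(x', y') \<noteq> (0, 0)" using wT(1) by (auto simp: w xy)
    have qw: "real_of_int (qf a b c w) = (real (nat g))\<^sup>2 * qf a b c (x', y')"
      using qfG[of "nat g" "(x', y')"] Gw Fw by simp
    have le: "(real (nat g))\<^sup>2 * qf a b c (x', y') \<le> T" using wT(2) qw by simp
    have "real (nat g) * 1 \<le> (real (nat g))\<^sup>2 * qf a b c (x', y')"
    proof (intro mult_mono)
      show "real (nat g) \<le> (real (nat g))\<^sup>2" using g by (simp add: self_le_power)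
      show "1 \<le> real_of_int (qf a b c (x', y'))" using qf_pos[OF assms(1) v] by simp
    qed auto
    then have "real (nat g) \<le> real N" using le assms(2) by linarith
    then have "nat g \<in> {1..N}" using g by auto
    moreover have "(x', y') \<in> pball a b c (T / (real (nat g))\<^sup>2)"
      using le g v xy(3) unfolding pball_def qball_def
      by (simp add: pos_le_divide_eq mult.commute)
    ultimately show "F w \<in> S" unfolding Fw S_def by blast
    show "G (F w) = w" by (rule Gw)
  qed
  have "(\<Sum>(d, v)\<in>S. 1 / (real d)\<^sup>2 * (1 / qf a b c v)) = (\<Sum>w\<in>qball a b c T. 1 / qf a b c w)"
  proof (rule sum.reindex_bij_witness[of S F G])
    fix s assume s: "s \<in> S"
    then obtain d v where dv: "s = (d, v)" by (cases s)
    show "F (G s) = s" "G s \<in> qball a b c T" using GS s unfolding dv by auto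
    show "1 / real_of_int (qf a b c (G s)) = (case s of (d, v) \<Rightarrow> 1 / (real d)\<^sup>2 * (1 / qf a b c v))"
      unfolding dv qfG by simp
  qed (use FS in auto)
  also have "(\<Sum>(d, v)\<in>S. 1 / (real d)\<^sup>2 * (1 / qf a b c v))
      = (\<Sum>d=1..N. \<Sum>v\<in>pball a b c (T / (real d)\<^sup>2). 1 / (real d)\<^sup>2 * (1 / qf a b c v))"
    unfolding S_def using finite_pball[OF assms(1)] by (subst sum.Sigma) auto
  finally show ?thesis by (simp add: qsum_def psum_def sum_distrib_left)
qed

lemma inverse_squares_tendsto: "(\<lambda>M. \<Sum>d=1..M. 1 / (real d)\<^sup>2) \<longlonglongrightarrow> pi\<^sup>2 / 6"
proof -
  have "(\<Sum>d=1..M. 1 / (real d)\<^sup>2) = (\<Sum>n<M. 1 / (real n + 1)\<^sup>2)" for M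
    by (induction M) (auto simp: add.commute)
  then show ?thesis using inverse_squares_sums unfolding sums_def by (simp add: add.commute)
qed

lemma inverse_squares_le: "(\<Sum>d=1..M. 1 / (real d)\<^sup>2) \<le> pi\<^sup>2 / 6"
proof (rule incseq_le[OF _ inverse_squares_tendsto])
  show "incseq (\<lambda>M. \<Sum>d=1..M. 1 / (real d)\<^sup>2)"
    by (intro incseq_SucI) simp
qed

text \<open>The primitive vectors of a shell are among all its vectors, so the asymptotics of
  \<open>qsum\<close> limit how fast \<open>psum\<close> can grow.\<close>

lemma psum_diff_le:
  assumes "posdef a b c" "S \<le> T"
  shows "psum a b c T - psum a b c S \<le> qsum a b c T - qsum a b c S"
proof -
  have sub: "qball a b c S \<subseteq> qball a b c T" "pball a b c S \<subseteq> pball a b c T"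
    using qball_mono[OF assms(2)] by (auto simp: pball_def)
  have "psum a b c T - psum a b c S = (\<Sum>v\<in>pball a b c T - pball a b c S. 1 / qf a b c v)"
    unfolding psum_def using sum_diff[OF finite_pball[OF assms(1)] sub(2)] by metis
  also have "\<dots> \<le> (\<Sum>v\<in>qball a b c T - qball a b c S. 1 / qf a b c v)"
    using qf_nonneg[OF assms(1)] finite_qball[OF assms(1)]
    by (intro sum_mono2) (auto simp: pball_def)
  also have "\<dots> = qsum a b c T - qsum a b c S"
    unfolding qsum_def using sum_diff[OF finite_qball[OF assms(1)] sub(1)] by metis
  finally show ?thesis .
qed

lemma psum_nonneg: "posdef a b c \<Longrightarrow> 0 \<le> psum a b c T"
  unfolding psum_def by (intro sum_nonneg) (simp add: qf_nonneg)

lemma psum_empty: "posdef a b c \<Longrightarrow> T < 1 \<Longrightarrow> psum a b c T = 0"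
  by (simp add: psum_def pball_def qball_empty)

lemma psum_mono:
  assumes "posdef a b c" "S \<le> T"
  shows "psum a b c S \<le> psum a b c T"
  unfolding psum_def
  using qball_mono[OF assms(2), of a b c] qf_nonneg[OF assms(1)] finite_pball[OF assms(1)]
  by (intro sum_mono2) (auto simp: pball_def)

text \<open>The factor 6 / pi^2 is the proportion of primitive vectors among all vectors.\<close>

definition pdens :: "int \<Rightarrow> int \<Rightarrow> int \<Rightarrow> real" where
  "pdens a b c = qdens a b c * 6 / pi\<^sup>2"

lemma ln_le_sqrt: "x > 0 \<Longrightarrow> ln x \<le> 2 * sqrt (x::real)"
proof -
  assume "x > 0"
  then have "ln (sqrt x) \<le> sqrt x - 1" by (intro ln_le_minus_one) simp
  then show ?thesis using \<open>x > 0\<close> by (simp add: ln_sqrt)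
qed

text \<open>\<open>qsum\<close> at \<open>T\<close> is the sum of \<open>psum\<close> at
  \<open>T / d^2\<close> with weights \<open>1 / d^2\<close>. Since \<open>psum\<close> grows only
  logarithmically, replacing each \<open>T / d^2\<close> by \<open>T\<close> costs a multiple of
  \<open>ln d\<close> plus a constant, which is summable against \<open>1 / d^2\<close>. Hence
  \<open>qsum\<close> equals pi^2 / 6 times \<open>psum\<close> up to a bounded error.\<close>

lemma psum_asymptotic:
  assumes "posdef a b c"
  obtains K where "\<And>T. T \<ge> 1 \<Longrightarrow> \<bar>psum a b c T - pdens a b c * ln T\<bar> \<le> K"
proof -
  define k where "k = qdens a b c"
  have k: "k > 0" using qdens_pos[OF assms] by (simp add: k_def)
  obtain K0 where K0: "\<And>T. T \<ge> 1 \<Longrightarrow> \<bar>qsum a b c T - k * ln T\<bar> \<le> K0"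
    using qball_inverse_sum[OF assms] unfolding k_def qsum_def by blast
  have K0_nonneg: "K0 \<ge> 0" using K0[of 1] by auto
  define Z where "Z = pi\<^sup>2 / 6"
  have Z: "Z > 0" by (simp add: Z_def)
  have lower: "k * ln T - K0 \<le> Z * psum a b c T" if T: "T \<ge> 1" for T
  proof -
    obtain N :: nat where N: "T \<le> real N" using real_arch_simple by blast
    have "qsum a b c T \<le> (\<Sum>d=1..N. 1 / (real d)\<^sup>2 * psum a b c T)"
      unfolding qsum_eq_psum[OF assms N]
    proof (intro sum_mono mult_left_mono psum_mono[OF assms])
      fix d assume "d \<in> {1..N}"
      then have "1 \<le> (real d)\<^sup>2" by simp
      then show "T / (real d)\<^sup>2 \<le> T" using T by (simp add: divide_le_eq)
    qed simp
    also have "\<dots> \<le> Z * psum a b c T"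
      unfolding sum_distrib_right[symmetric] Z_def
      by (intro mult_right_mono inverse_squares_le psum_nonneg[OF assms])
    finally show ?thesis using K0[OF T] by linarith
  qed
  define K1 where "K1 = (4 * k + 2 * K0) * 4"
  have K1: "K1 \<ge> 0" using k K0_nonneg by (simp add: K1_def)
  \<comment> \<open>When \<open>T / d^2\<close> is below 1 the second term is 0, and
    \<open>T < d^2\<close> bounds the first one by the same expression.\<close>
  have diff: "psum a b c T - psum a b c (T / (real d)\<^sup>2) \<le> 2 * k * ln d + 2 * K0"
    if T: "T \<ge> 1" and d: "d \<ge> 1" for T and d :: nat
  proof (cases "T / (real d)\<^sup>2 \<ge> 1")
    case True
    have "psum a b c T - psum a b c (T / (real d)\<^sup>2) \<le> qsum a b c T - qsum a b c (T / (real d)\<^sup>2)"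
      using T d by (intro psum_diff_le[OF assms]) (simp add: divide_le_eq)
    also have "\<dots> \<le> (k * ln T + K0) - (k * ln (T / (real d)\<^sup>2) - K0)"
      using K0[OF T] K0[OF True] by linarith
    also have "ln (T / (real d)\<^sup>2) = ln T - 2 * ln d"
      using T d by (simp add: ln_div ln_realpow)
    finally show ?thesis by (simp add: algebra_simps)
  next
    case False
    have "psum a b c T \<le> qsum a b c T"
      using psum_diff_le[OF assms, of 0 T] T
      by (simp add: psum_empty[OF assms] qsum_def qball_empty[OF assms])
    also have "\<dots> \<le> k * ln T + K0" using K0[OF T] by linarith
    also have "\<dots> \<le> k * ln ((real d)\<^sup>2) + K0"
      using False T d k by (simp add: divide_less_eq)
    also have "\<dots> = 2 * k * ln d + K0" using d by (simp add: ln_realpow)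
    finally show ?thesis using psum_nonneg[OF assms, of "T / (real d)\<^sup>2"] K0_nonneg by linarith
  qed
  have upper: "Z * psum a b c T \<le> k * ln T + K0 + K1" if T: "T \<ge> 1" for T
  proof -
    obtain N :: nat where N: "T \<le> real N" using real_arch_simple by blast
    have "(\<Sum>d=1..M. 1 / (real d)\<^sup>2) * psum a b c T \<le> k * ln T + K0 + K1" if M: "M \<ge> N" for M
    proof -
      have TM: "T \<le> real M" using N M by linarith
      have "(\<Sum>d=1..M. 1 / (real d)\<^sup>2) * psum a b c T - qsum a b c T
          = (\<Sum>d=1..M. 1 / (real d)\<^sup>2 * (psum a b c T - psum a b c (T / (real d)\<^sup>2)))"
        unfolding qsum_eq_psum[OF assms TM] sum_distrib_right right_diff_distrib sum_subtractf ..
      also have "\<dots> \<le> (\<Sum>d=1..M. (4 * k + 2 * K0) * 2 * (1 / (sqrt (real d) * (real d + 1))))"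
      proof (intro sum_mono)
        fix d assume "d \<in> {1..M}"
        then have d: "d \<ge> 1" by simp
        \<comment> \<open>Bounding \<open>ln d\<close> by \<open>2 * s\<close> leaves terms of size
          \<open>1 / s^3\<close>, dominated by twice the telescoping majorant.\<close>
        define s where "s = sqrt (real d)"
        have s: "s \<ge> 1" "real d = s\<^sup>2" using d by (auto simp: s_def)
        have "ln d \<le> 2 * s" unfolding s_def using d by (intro ln_le_sqrt) simp
        then have "2 * k * ln d \<le> 2 * k * (2 * s)" using k by (intro mult_left_mono) auto
        moreover have "2 * K0 \<le> 2 * K0 * s" using mult_left_mono[OF s(1), of "2 * K0"] K0_nonneg by simp
        ultimately have "psum a b c T - psum a b c (T / (real d)\<^sup>2) \<le> (4 * k + 2 * K0) * s"
          using diff[OF T d] by (simp add: algebra_simps)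
        then have "1 / (real d)\<^sup>2 * (psum a b c T - psum a b c (T / (real d)\<^sup>2))
            \<le> 1 / (real d)\<^sup>2 * ((4 * k + 2 * K0) * s)"
          by (intro mult_left_mono) auto
        also have "\<dots> = (4 * k + 2 * K0) * (1 / s ^ 3)"
          using s by (simp add: power2_eq_square power3_eq_cube)
        also have "1 / s ^ 3 \<le> 2 * (1 / (s * (s\<^sup>2 + 1)))"
        proof -
          have "s * (s\<^sup>2 + 1) \<le> 2 * s ^ 3"
            using s mult_right_mono[OF one_le_power[OF s(1), of 2], of s] by (simp add: power2_eq_square power3_eq_cube algebra_simps)
          moreover have "0 < s * (s\<^sup>2 + 1)" using s by (simp add: add_nonneg_pos)
          moreover have "0 < s ^ 3" using s by simp
          ultimately show ?thesis by (simp add: divide_simps)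
        qed
        finally show "1 / (real d)\<^sup>2 * (psum a b c T - psum a b c (T / (real d)\<^sup>2))
            \<le> (4 * k + 2 * K0) * 2 * (1 / (sqrt (real d) * (real d + 1)))"
          using k K0_nonneg unfolding s_def[symmetric] s(2)[symmetric]
          by (simp add: mult.assoc mult_left_mono)
      qed
      also have "\<dots> \<le> (4 * k + 2 * K0) * 2 * 2"
        unfolding sum_distrib_left[symmetric] using k K0_nonneg inverse_sqrt_telescope_sum
        by (intro mult_left_mono) auto
      also have "\<dots> = K1" by (simp add: K1_def)
      finally show ?thesis using K0[OF T] by linarith
    qed
    \<comment> \<open>The bound is uniform in \<open>M\<close>, so the partial sums of the inverse
      squares may be replaced by their limit.\<close>
    moreover have "(\<lambda>M. (\<Sum>d=1..M. 1 / (real d)\<^sup>2) * psum a b c T) \<longlonglongrightarrow> Z * psum a b c T"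
      unfolding Z_def by (intro tendsto_mult inverse_squares_tendsto tendsto_const)
    ultimately show ?thesis
      by (intro LIMSEQ_le_const2) blast+
  qed
  have "\<bar>psum a b c T - pdens a b c * ln T\<bar> \<le> (K0 + K1) / Z" if T: "T \<ge> 1" for T
  proof -
    have "\<bar>Z * psum a b c T - k * ln T\<bar> \<le> K0 + K1" using lower[OF T] upper[OF T] K1 by linarith
    moreover have "Z * psum a b c T - k * ln T = Z * (psum a b c T - pdens a b c * ln T)"
      using Z by (simp add: pdens_def k_def Z_def algebra_simps)
    ultimately show ?thesis using Z by (simp add: abs_mult pos_le_divide_eq mult.commute)
  qed
  then show thesis by (rule that)
qed

section \<open>The energy as a sum over reflections\<close>

text \<open>The polar form \<open>f (v + w) - f v - f w\<close>, so that \<open>bil v v\<close> is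
  \<open>2 * f v\<close>.\<close>

definition bil :: "int \<Rightarrow> int \<Rightarrow> int \<Rightarrow> int \<times> int \<Rightarrow> int \<times> int \<Rightarrow> int" where
  "bil a b c v w = 2 * a * fst v * fst w + b * (fst v * snd w + snd v * fst w) + 2 * c * snd v * snd w"

text \<open>The point with coordinates \<open>w\<close> in the basis \<open>v\<close>,
  \<open>u\<close>, that is, the matrix with columns \<open>v\<close> and \<open>u\<close> applied
  to \<open>w\<close>.\<close>

definition lin :: "int \<times> int \<Rightarrow> int \<times> int \<Rightarrow> int \<times> int \<Rightarrow> int \<times> int" where
  "lin v u w = (fst w * fst v + snd w * fst u, fst w * snd v + snd w * snd u)"

abbreviation unimodular :: "int \<times> int \<Rightarrow> int \<times> int \<Rightarrow> bool" where
  "unimodular v u \<equiv> fst v * snd u - snd v * fst u = 1"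

lemma qf_lin: "qf a b c (lin v u w) = qf (qf a b c v) (bil a b c v u) (qf a b c u) w"
  by (simp add: qf_def bil_def lin_def power2_eq_square algebra_simps)

lemma bil_lin: "bil a b c (lin v u w) v = 2 * qf a b c v * fst w + bil a b c v u * snd w"
  by (simp add: qf_def bil_def lin_def power2_eq_square algebra_simps)

lemma disc_lin:
  assumes "unimodular v u"
  shows "4 * qf a b c v * qf a b c u - (bil a b c v u)\<^sup>2 = disc a b c"
proof -
  have "4 * qf a b c v * qf a b c u - (bil a b c v u)\<^sup>2
      = (disc a b c) * (fst v * snd u - snd v * fst u)\<^sup>2"
    by (simp add: qf_def bil_def power2_eq_square algebra_simps)
  then show ?thesis using assms by simp
qed

lemma posdef_lin:
  assumes "posdef a b c" "unimodular v u"
  shows "posdef (qf a b c v) (bil a b c v u) (qf a b c u)"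
proof -
  have "v \<noteq> (0, 0)" using assms(2) by auto
  then show ?thesis
    using qf_pos[OF assms(1), of v] assms(1) disc_lin[OF assms(2), of a b c] by (simp add: posdef_def)
qed

lemma ex_unimodular:
  assumes "coprime (fst v) (snd v)"
  obtains u where "unimodular v u"
proof -
  obtain r s where "r * fst v + s * snd v = 1"
    using bezout_int[of "fst v" "snd v"] assms by auto
  then have "unimodular v (- s, r)" by (simp add: algebra_simps)
  then show thesis by (rule that)
qed

definition lin_inv :: "int \<times> int \<Rightarrow> int \<times> int \<Rightarrow> int \<times> int \<Rightarrow> int \<times> int" where
  "lin_inv v u w = (fst w * snd u - snd w * fst u, snd w * fst v - fst w * snd v)"

lemma lin_inv_lin:
  assumes "unimodular v u"
  shows "lin_inv v u (lin v u w) = w" "lin v u (lin_inv v u w) = w"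
proof -
  have "lin_inv v u (lin v u w)
      = (fst w * (fst v * snd u - snd v * fst u), snd w * (fst v * snd u - snd v * fst u))"
    by (simp add: lin_def lin_inv_def algebra_simps)
  then show "lin_inv v u (lin v u w) = w" unfolding assms by simp
  have "lin v u (lin_inv v u w)
      = (fst w * (fst v * snd u - snd v * fst u), snd w * (fst v * snd u - snd v * fst u))"
    by (simp add: lin_def lin_inv_def algebra_simps)
  then show "lin v u (lin_inv v u w) = w" unfolding assms by simp
qed

lemma inj_lin: "unimodular v u \<Longrightarrow> inj (lin v u)"
  by (metis injI lin_inv_lin(1))

lemma coprime_lin:
  assumes "unimodular v u"
  shows "coprime (fst (lin v u w)) (snd (lin v u w)) \<longleftrightarrow> coprime (fst w) (snd w)"
proof
  assume *: "coprime (fst w) (snd w)"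
  show "coprime (fst (lin v u w)) (snd (lin v u w))"
  proof (rule coprimeI)
    fix d assume d: "d dvd fst (lin v u w)" "d dvd snd (lin v u w)"
    have "d dvd fst (lin_inv v u (lin v u w))" "d dvd snd (lin_inv v u (lin v u w))"
      using d by (simp_all add: lin_inv_def)
    then show "is_unit d" using * coprime_common_divisor unfolding lin_inv_lin[OF assms] by blast
  qed
next
  assume *: "coprime (fst (lin v u w)) (snd (lin v u w))"
  show "coprime (fst w) (snd w)"
  proof (rule coprimeI)
    fix d assume "d dvd fst w" "d dvd snd w"
    then have "d dvd fst (lin v u w)" "d dvd snd (lin v u w)" by (simp_all add: lin_def)
    then show "is_unit d" using * coprime_common_divisor by blast
  qed
qed

text \<open>The factor by which \<open>f v\<close> exceeds the index of the lattice of points whose reflection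
  along \<open>v\<close> is integral; the inner \<open>gcd\<close> is that of the coordinates of the gradient of \<open>f\<close> at \<open>v\<close>.\<close>

definition defect :: "int \<Rightarrow> int \<Rightarrow> int \<Rightarrow> int \<times> int \<Rightarrow> int" where
  "defect a b c v
     = gcd (qf a b c v) (gcd (2 * a * fst v + b * snd v) (b * fst v + 2 * c * snd v))"

text \<open>In a basis starting with \<open>v\<close> the gradient at \<open>v\<close> has the
  coordinates \<open>2 * f v\<close> and \<open>bil v u\<close>, and a unimodular change of basis
  preserves the gcd of the coordinates.\<close>

lemma defect_eq_gcd:
  assumes "unimodular v u"
  shows "defect a b c v = gcd (qf a b c v) (bil a b c v u)"
proof (rule zdvd_antisym_nonneg)
  define A B where "A = qf a b c v" and "B = bil a b c v u"
  define M1 M2 where "M1 = 2 * a * fst v + b * snd v" and "M2 = b * fst v + 2 * c * snd v"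
  have B: "B = fst u * M1 + snd u * M2"
    by (simp add: B_def bil_def M1_def M2_def algebra_simps)
  have A2: "2 * A = fst v * M1 + snd v * M2"
    by (simp add: A_def qf_def M1_def M2_def power2_eq_square algebra_simps)
  have "2 * A * snd u - B * snd v = M1 * (fst v * snd u - snd v * fst u)"
    unfolding A2 B by (simp add: algebra_simps)
  then have M1: "M1 = 2 * A * snd u - B * snd v" using assms by simp
  have "B * fst v - 2 * A * fst u = M2 * (fst v * snd u - snd v * fst u)"
    unfolding A2 B by (simp add: algebra_simps)
  then have M2: "M2 = B * fst v - 2 * A * fst u" using assms by simp
  have d: "defect a b c v = gcd A (gcd M1 M2)" by (simp add: defect_def A_def M1_def M2_def)
  have "defect a b c v dvd A" "defect a b c v dvd M1" "defect a b c v dvd M2"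
    unfolding d by (auto intro: dvd_trans[OF gcd_dvd2])
  then show "defect a b c v dvd gcd (qf a b c v) (bil a b c v u)"
    unfolding A_def[symmetric] B_def[symmetric] by (simp add: B)
  have "gcd A B dvd M1" "gcd A B dvd M2"
    unfolding M1 M2 by (intro dvd_diff dvd_mult2 dvd_mult; simp)+
  then show "gcd (qf a b c v) (bil a b c v u) dvd defect a b c v"
    unfolding A_def[symmetric] B_def[symmetric] d by simp
qed (auto simp: defect_def)

lemma defect_pos: "posdef a b c \<Longrightarrow> v \<noteq> (0, 0) \<Longrightarrow> 0 < defect a b c v"
  using qf_pos[of a b c v] by (simp add: defect_def)

lemma defect_dvd_disc:
  assumes "coprime (fst v) (snd v)"
  shows "defect a b c v dvd disc a b c"
proof -
  obtain u where u: "unimodular v u" using ex_unimodular[OF assms] .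
  have "defect a b c v dvd qf a b c v" "defect a b c v dvd bil a b c v u"
    unfolding defect_eq_gcd[OF u] by auto
  then have "defect a b c v dvd 4 * qf a b c v * qf a b c u - (bil a b c v u)\<^sup>2"
    unfolding power2_eq_square by (intro dvd_diff) auto
  then show ?thesis unfolding disc_lin[OF u] .
qed

text \<open>The points \<open>p\<close> whose reflection \<open>p - k * v\<close> along \<open>v\<close>, with \<open>k = bil p v / f v\<close>, is integral.
  Requiring \<open>k > 0\<close> makes \<open>v\<close> unique among the two primitive vectors on a line.\<close>

definition mirror_set :: "int \<Rightarrow> int \<Rightarrow> int \<Rightarrow> real \<Rightarrow> int \<times> int \<Rightarrow> (int \<times> int) set" where
  "mirror_set a b c X v
     = {p. real_of_int (qf a b c p) \<le> X \<and> qf a b c v dvd bil a b c p v \<and> 0 < bil a b c p v}"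

definition energy_pairs :: "int \<Rightarrow> int \<Rightarrow> int \<Rightarrow> real \<Rightarrow> ((int \<times> int) \<times> (int \<times> int)) set" where
  "energy_pairs a b c X = {(p, q). qf a b c p = qf a b c q \<and> real_of_int (qf a b c q) \<le> X}"

lemma finite_ball:
  assumes "posdef a b c"
  shows "finite {p. real_of_int (qf a b c p) \<le> X}"
proof -
  have "{p. real_of_int (qf a b c p) \<le> X} \<subseteq> insert (0, 0) (qball a b c X)"
    by (auto simp: qball_def)
  then show ?thesis using finite_qball[OF assms] by (meson finite_insert finite_subset)
qed

lemma qf_diff_multiple:
  "qf a b c (fst p - k * fst v, snd p - k * snd v) = qf a b c p - k * bil a b c p v + k\<^sup>2 * qf a b c v"
  by (simp add: qf_def bil_def power2_eq_square algebra_simps)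

text \<open>Off the diagonal, write \<open>p - q = k * v\<close> with \<open>k\<close> the positive
  gcd of the coordinates and \<open>v\<close> primitive. Equality of the two values then says
  \<open>bil p v = k * f v\<close>, so \<open>k\<close>, and with it \<open>q\<close>, is determined
  by \<open>v\<close> and \<open>p\<close>.\<close>

lemma card_energy_pairs:
  assumes "posdef a b c"
  shows "card (energy_pairs a b c X) = card {p. real_of_int (qf a b c p) \<le> X}
      + (\<Sum>v\<in>pball a b c (4 * X). card (mirror_set a b c X v))"
proof -
  define diag where "diag = (\<lambda>p. (p, p)) ` {p. real_of_int (qf a b c p) \<le> X}"
  define off where "off = {(p, q). p \<noteq> q \<and> (p, q) \<in> energy_pairs a b c X}"
  define S where "S = (SIGMA v:pball a b c (4 * X). mirror_set a b c X v)"
  define F where "F = (\<lambda>(v, p). let k = bil a b c p v div qf a b c v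
    in (p, (fst p - k * fst v, snd p - k * snd v)))"
  define G where "G = (\<lambda>(p, q). let x = fst p - fst q; y = snd p - snd q :: int
    in ((x div gcd x y, y div gcd x y), p))"
  have eq: "energy_pairs a b c X = diag \<union> off" "diag \<inter> off = {}"
    by (auto simp: energy_pairs_def diag_def off_def)
  have fin: "finite (energy_pairs a b c X)"
    by (rule finite_subset[of _ "{p. real_of_int (qf a b c p) \<le> X} \<times> {p. real_of_int (qf a b c p) \<le> X}"])
       (use finite_ball[OF assms] in \<open>auto simp: energy_pairs_def\<close>)
  have finm: "finite (mirror_set a b c X v)" for v
    by (rule finite_subset[OF _ finite_ball[OF assms, of X]]) (auto simp: mirror_set_def)
  have "bij_betw F S off"
  proof (rule bij_betwI[where g = G])
    show "F \<in> S \<rightarrow> off"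
    proof
      fix s assume "s \<in> S"
      then obtain v p where s: "s = (v, p)" and v: "v \<in> pball a b c (4 * X)" "v \<noteq> (0, 0)"
        and p: "real_of_int (qf a b c p) \<le> X" "qf a b c v dvd bil a b c p v" "0 < bil a b c p v"
        by (auto simp: S_def mirror_set_def pball_def qball_def)
      define k where "k = bil a b c p v div qf a b c v"
      have k: "bil a b c p v = k * qf a b c v" using p(2) by (simp add: k_def)
      have "k \<noteq> 0" using p(3) k by auto
      have "qf a b c (fst p - k * fst v, snd p - k * snd v) = qf a b c p"
        unfolding qf_diff_multiple k by (simp add: power2_eq_square)
      moreover have "p \<noteq> (fst p - k * fst v, snd p - k * snd v)"
        using v(2) \<open>k \<noteq> 0\<close> by (cases p; cases v) auto
      ultimately show "F s \<in> off"
        using p(1) by (simp add: s F_def off_def energy_pairs_def k_def[symmetric])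
    qed
    show "G (F s) = s" if "s \<in> S" for s
    proof -
      from that obtain v p where s: "s = (v, p)" and v: "coprime (fst v) (snd v)" "v \<noteq> (0, 0)"
        and p: "qf a b c v dvd bil a b c p v" "0 < bil a b c p v"
        by (auto simp: S_def mirror_set_def pball_def qball_def)
      define k where "k = bil a b c p v div qf a b c v"
      have k: "bil a b c p v = k * qf a b c v" using p(1) by (simp add: k_def)
      have "k > 0" using p(2) qf_pos[OF assms v(2)] unfolding k by (simp add: zero_less_mult_iff)
      moreover have "gcd (k * fst v) (k * snd v) = k"
        using v(1) \<open>k > 0\<close> by (simp add: gcd_mult_left coprime_iff_gcd_eq_1)
      ultimately show ?thesis by (simp add: s F_def G_def k_def[symmetric] Let_def)
    qed
    have *: "G w \<in> S \<and> F (G w) = w" if w: "w \<in> off" for w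
    proof -
      obtain p q where pq: "w = (p, q)" by (cases w)
      have pq': "p \<noteq> q" "qf a b c p = qf a b c q" "real_of_int (qf a b c q) \<le> X"
        using w by (auto simp: off_def energy_pairs_def pq)
      define x y where "x = fst p - fst q" and "y = snd p - snd q"
      define k where "k = gcd x y"
      have "x \<noteq> 0 \<or> y \<noteq> 0" using pq'(1) by (cases p; cases q) (auto simp: x_def y_def)
      then have k: "k > 0" by (simp add: k_def)
      obtain x' y' where xy: "x = x' * k" "y = y' * k" "coprime x' y'"
        using gcd_coprime_exists[of x y] k unfolding k_def by force
      define v where "v = (x', y')"
      have Gw: "G w = (v, p)"
        using k unfolding pq G_def by (simp add: x_def[symmetric] y_def[symmetric] k_def[symmetric])
          (simp add: xy v_def)
      have q: "q = (fst p - k * fst v, snd p - k * snd v)"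
        using xy by (cases p; cases q) (simp add: v_def x_def y_def mult.commute)
      have v0: "v \<noteq> (0, 0)" using xy(3) by (auto simp: v_def)
      have "k * bil a b c p v = k * (k * qf a b c v)"
        using pq'(2) unfolding q qf_diff_multiple power2_eq_square mult.assoc by linarith
      then have bil: "bil a b c p v = k * qf a b c v"
        using k by (metis less_irrefl mult_cancel_left)
      have "k\<^sup>2 * qf a b c v = qf a b c (x, y)"
        unfolding xy v_def by (simp add: qf_scale mult.commute[of _ k])
      \<comment> \<open>The parallelogram law bounds the value at \<open>p - q\<close>; this is the
        origin of the range \<open>4 * X\<close> for \<open>v\<close>.\<close>
      also have "\<dots> \<le> qf a b c (x, y) + qf a b c (fst p + fst q, snd p + snd q)"
        using qf_nonneg[OF assms] by simp
      also have "\<dots> = 2 * qf a b c p + 2 * qf a b c q"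
        by (simp add: qf_def x_def y_def power2_eq_square algebra_simps)
      finally have "k\<^sup>2 * qf a b c v \<le> 4 * qf a b c q" using pq'(2) by simp
      moreover have "1 * qf a b c v \<le> k\<^sup>2 * qf a b c v"
        using k qf_nonneg[OF assms] by (intro mult_right_mono one_le_power) auto
      ultimately have "qf a b c v \<le> 4 * qf a b c q" by simp
      then have "real_of_int (qf a b c v) \<le> 4 * real_of_int (qf a b c q)" by linarith
      then have "real_of_int (qf a b c v) \<le> 4 * X" using pq'(3) by linarith
      then have "v \<in> pball a b c (4 * X)"
        using v0 xy(3) by (simp add: pball_def qball_def v_def)
      moreover have "p \<in> mirror_set a b c X v"
        using pq' bil k qf_pos[OF assms v0] by (simp add: mirror_set_def)
      moreover have "F (v, p) = w"
        using bil qf_pos[OF assms v0] by (simp add: F_def pq Let_def) (simp add: q)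
      ultimately show ?thesis unfolding Gw S_def by simp
    qed
    show "G \<in> off \<rightarrow> S" using * by blast
    show "F (G w) = w" if "w \<in> off" for w using * that by blast
  qed
  then have "card off = card S" by (simp add: bij_betw_same_card)
  also have "card S = (\<Sum>v\<in>pball a b c (4 * X). card (mirror_set a b c X v))"
    unfolding S_def using finite_pball[OF assms] finm by simp
  finally have off: "card off = (\<Sum>v\<in>pball a b c (4 * X). card (mirror_set a b c X v))" .
  have "card diag = card {p. real_of_int (qf a b c p) \<le> X}"
    unfolding diag_def by (intro card_image) (auto simp: inj_on_def)
  moreover have "card (diag \<union> off) = card diag + card off"
    using fin eq by (intro card_Un_disjoint) auto
  ultimately show ?thesis using off eq(1) by simp
qed

text \<open>In coordinates \<open>(x, y)\<close> for a basis \<open>v\<close>, \<open>u\<close> the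
  reflection is integral iff \<open>A\<close> divides \<open>2 * A * x + B * y\<close>, that is, iff
  \<open>m = A / h\<close> divides \<open>y\<close>. This sublattice of index \<open>m\<close>
  carries a form of discriminant \<open>- D * m^2\<close>, to which the ellipse count applies. The
  sign condition selects half of its points, apart from those orthogonal to
  \<open>v\<close>.\<close>

lemma card_mirror_set:
  fixes X :: real
  assumes pd: "posdef a b c" and cop: "coprime (fst v) (snd v)"
    and X: "X > 0" "real_of_int (qf a b c v) \<le> 4 * X"
  defines "D \<equiv> real_of_int (disc a b c)"
  shows "\<bar>2 * real (card (mirror_set a b c X v)) - qdens a b c * X * (defect a b c v / qf a b c v)\<bar>
    \<le> (10 + 8 * sqrt D) * (sqrt X * (1 / sqrt (qf a b c v)))"
proof -
  obtain u where u: "unimodular v u" using ex_unimodular[OF cop] .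
  have v0: "v \<noteq> (0, 0)" using cop by auto
  define A B C where "A = qf a b c v" and "B = bil a b c v u" and "C = qf a b c u"
  define h where "h = defect a b c v"
  have A: "A \<ge> 1" unfolding A_def by (rule qf_pos[OF pd v0])
  have D: "D > 0" using pd unfolding D_def posdef_def by linarith
  have h: "h > 0" unfolding h_def by (rule defect_pos[OF pd v0])
  have hg: "h = gcd A B" unfolding h_def A_def B_def by (rule defect_eq_gcd[OF u])
  have disc: "4 * A * C - B\<^sup>2 = disc a b c"
    unfolding A_def B_def C_def by (rule disc_lin[OF u])
  have hD: "h \<le> D"
    using zdvd_imp_le[OF defect_dvd_disc[OF cop, of a b c]] pd
    unfolding D_def h_def posdef_def by linarith
  have "gcd A B \<noteq> 0" using h hg by simp
  then obtain m B' where "A = m * h" "B = B' * h" and m3: "coprime m B'"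
    using gcd_coprime_exists[of A B] unfolding hg by blast
  then have m: "A = h * m" "B = h * B'" by (simp_all only: mult.commute)
  have "0 < h * m" using A m(1) by linarith
  then have m0: "m > 0" using h by (simp add: zero_less_mult_iff)
  have dvd_iff: "A dvd 2 * A * x + B * y \<longleftrightarrow> m dvd y" for x y
  proof -
    have "A dvd 2 * A * x + B * y \<longleftrightarrow> A dvd B * y"
      by (simp add: dvd_add_right_iff)
    also have "\<dots> \<longleftrightarrow> m dvd B' * y" using h unfolding m(1,2) by (simp add: mult.assoc)
    also have "\<dots> \<longleftrightarrow> m dvd y" using m3 by (simp add: coprime_dvd_mult_right_iff)
    finally show ?thesis .
  qed
  define emb where "emb = (\<lambda>w. lin v u (fst w, m * snd w))"
  have inj: "inj emb"
  proof (rule injI)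
    fix w w' assume "emb w = emb w'"
    then have "(fst w, m * snd w) = (fst w', m * snd w')"
      unfolding emb_def by (rule injD[OF inj_lin[OF u]])
    then show "w = w'" using m0 by (simp add: prod_eq_iff)
  qed
  have qf_emb: "qf a b c (emb w) = qf A (B * m) (C * m\<^sup>2) w" for w
    unfolding emb_def qf_lin A_def[symmetric] B_def[symmetric] C_def[symmetric]
    by (simp add: qf_def power2_eq_square algebra_simps)
  have bil_emb: "bil a b c (emb w) v = 2 * A * fst w + B * m * snd w" for w
    unfolding emb_def bil_lin A_def[symmetric] B_def[symmetric] by simp
  have range: "p \<in> range emb" if "A dvd bil a b c p v" for p
  proof -
    define w where "w = lin_inv v u p"
    have p: "p = lin v u w" unfolding w_def by (simp add: lin_inv_lin[OF u])
    have "m dvd snd w"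
      using that unfolding p bil_lin A_def[symmetric] B_def[symmetric] dvd_iff .
    then obtain t where "snd w = m * t" by blast
    then have "p = emb (fst w, t)" unfolding p emb_def by (metis fst_conv snd_conv prod.collapse)
    then show ?thesis by blast
  qed
  define E where "E = {w. real_of_int (qf A (B * m) (C * m\<^sup>2) w) \<le> X}"
  define P where "P = {w \<in> E. 0 < 2 * A * fst w + B * m * snd w}"
  define N where "N = {w \<in> E. 2 * A * fst w + B * m * snd w < 0}"
  define Z where "Z = {w \<in> E. 2 * A * fst w + B * m * snd w = 0}"
  have disc': "4 * A * (C * m\<^sup>2) - (B * m)\<^sup>2 = (disc a b c) * m\<^sup>2"
    unfolding disc[symmetric] by (simp add: power2_eq_square algebra_simps)
  have pd': "posdef A (B * m) (C * m\<^sup>2)"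
    unfolding posdef_def disc' using A m0 pd by (simp add: posdef_def)
  have finE: "finite E" unfolding E_def by (rule finite_ball[OF pd'])
  have "mirror_set a b c X v = emb ` P"
  proof (intro equalityI subsetI)
    fix p assume p: "p \<in> mirror_set a b c X v"
    then have "A dvd bil a b c p v" by (simp add: mirror_set_def A_def)
    then obtain w where w: "p = emb w" using range by blast
    have "w \<in> P" using p unfolding w by (simp add: mirror_set_def qf_emb bil_emb P_def E_def)
    then show "p \<in> emb ` P" using w by simp
  next
    fix p assume "p \<in> emb ` P"
    then obtain w where w: "p = emb w" "w \<in> P" by blast
    have "A dvd 2 * A * fst w + B * (m * snd w)" unfolding dvd_iff by simp
    then have "A dvd bil a b c p v" unfolding w bil_emb by (simp add: mult.assoc)
    then show "p \<in> mirror_set a b c X v"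
      using w(2) unfolding w(1) by (simp add: mirror_set_def qf_emb bil_emb P_def E_def flip: A_def)
  qed
  then have cardP: "card (mirror_set a b c X v) = card P"
    using inj by (simp add: card_image inj_on_subset)
  have "bij_betw (\<lambda>w. (- fst w, - snd w)) P N"
    by (rule bij_betwI[where g = "\<lambda>w. (- fst w, - snd w)"])
       (auto simp: P_def N_def E_def qf_def)
  then have "card N = card P" by (simp add: bij_betw_same_card)
  moreover have "card E = card P + card N + card Z"
  proof -
    have "E = (P \<union> N) \<union> Z" by (auto simp: P_def N_def Z_def)
    moreover have "card ((P \<union> N) \<union> Z) = card (P \<union> N) + card Z"
      using finE by (intro card_Un_disjoint) (auto simp: P_def N_def Z_def)
    moreover have "card (P \<union> N) = card P + card N"
      using finE by (intro card_Un_disjoint) (auto simp: P_def N_def)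
    ultimately show ?thesis by simp
  qed
  ultimately have cardE: "2 * real (card P) = real (card E) - real (card Z)" by simp
  define R where "R = sqrt (X / A)"
  have R: "R > 0" using X(1) A by (simp add: R_def)
  \<comment> \<open>The restriction \<open>f v \<le> 4 * X\<close> keeps \<open>R\<close> at least
    1/2, so additive constants can be absorbed into multiples of \<open>R\<close>.\<close>
  have "1 / 4 \<le> X / A" using X(2) A unfolding A_def by (simp add: field_simps)
  then have "sqrt (1 / 4) \<le> R" unfolding R_def by (rule real_sqrt_le_mono)
  then have R2: "1 \<le> 2 * R" by (simp add: real_sqrt_divide)
  \<comment> \<open>Bounding \<open>h\<close> by \<open>D\<close> removes the index \<open>m\<close>
    from the error, so that it depends on \<open>v\<close> only through \<open>R\<close>.\<close>
  have sq: "sqrt (A * X / (D * m\<^sup>2)) \<le> sqrt D * R"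
  proof -
    have "A * X / (D * m\<^sup>2) = (h / D)\<^sup>2 * (D * (X / A))"
      using A D h m0 unfolding m(1) by (simp add: field_simps power2_eq_square)
    also have "\<dots> \<le> 1 * (D * (X / A))"
      using h hD D X(1) A by (intro mult_right_mono power_le_one) auto
    finally have "A * X / (D * m\<^sup>2) \<le> D * (X / A)" by simp
    then have "sqrt (A * X / (D * m\<^sup>2)) \<le> sqrt (D * (X / A))" by (rule real_sqrt_le_mono)
    also have "\<dots> = sqrt D * R" unfolding R_def by (rule real_sqrt_mult)
    finally show ?thesis .
  qed
  \<comment> \<open>The points orthogonal to \<open>v\<close> lie on a line and are determined by
    their second coordinate, whose size is of order \<open>R\<close>.\<close>
  have "card Z \<le> card {- \<lfloor>2 * sqrt D * R\<rfloor>..\<lfloor>2 * sqrt D * R\<rfloor>}"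
  proof (rule card_inj_on_le)
    show "inj_on snd Z"
    proof (rule inj_onI)
      fix w w' assume "w \<in> Z" "w' \<in> Z" "snd w = snd w'"
      moreover from this have "2 * A * fst w + B * m * snd w = 0" "2 * A * fst w' + B * m * snd w' = 0"
        by (simp_all only: Z_def mem_Collect_eq)
      ultimately have "2 * A * fst w = 2 * A * fst w'" by (metis add_right_cancel)
      then show "w = w'" using A \<open>snd w = snd w'\<close> by (simp add: prod_eq_iff)
    qed
    show "snd ` Z \<subseteq> {- \<lfloor>2 * sqrt D * R\<rfloor>..\<lfloor>2 * sqrt D * R\<rfloor>}"
    proof
      fix t assume "t \<in> snd ` Z"
      then obtain s where st: "(s, t) \<in> Z" by auto
      have "4 * A * qf A (B * m) (C * m\<^sup>2) (s, t) = (disc a b c) * m\<^sup>2 * t\<^sup>2"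
        using st unfolding qf_complete_square disc' by (simp add: Z_def)
      then have "4 * real_of_int A * real_of_int (qf A (B * m) (C * m\<^sup>2) (s, t)) = D * m\<^sup>2 * t\<^sup>2"
        unfolding D_def by (metis of_int_mult of_int_numeral of_int_power)
      moreover have "real_of_int (qf A (B * m) (C * m\<^sup>2) (s, t)) \<le> X"
        using st by (simp add: Z_def E_def)
      then have "4 * real_of_int A * real_of_int (qf A (B * m) (C * m\<^sup>2) (s, t)) \<le> 4 * real_of_int A * X"
        using A by (intro mult_left_mono) auto
      ultimately have "D * m\<^sup>2 * t\<^sup>2 \<le> 4 * (A * X)" by simp
      then have "(real_of_int t)\<^sup>2 \<le> 4 * (A * X / (D * m\<^sup>2))"
        using D m0 by (simp add: field_simps)
      then have "\<bar>real_of_int t\<bar> \<le> sqrt (4 * (A * X / (D * m\<^sup>2)))"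
        using real_sqrt_le_mono by fastforce
      also have "\<dots> = 2 * sqrt (A * X / (D * m\<^sup>2))" unfolding real_sqrt_mult[of 4] by simp
      also have "\<dots> \<le> 2 * (sqrt D * R)" using sq by simp
      finally have "\<bar>real_of_int t\<bar> \<le> 2 * sqrt D * R" by simp
      then show "t \<in> {- \<lfloor>2 * sqrt D * R\<rfloor>..\<lfloor>2 * sqrt D * R\<rfloor>}"
        by (simp add: le_floor_iff minus_le_iff abs_le_iff)
    qed
  qed simp
  also have "real \<dots> \<le> 4 * sqrt D * R + 1"
  proof -
    have "0 \<le> \<lfloor>2 * sqrt D * R\<rfloor>" using D R by simp
    then have "real (card {- \<lfloor>2 * sqrt D * R\<rfloor>..\<lfloor>2 * sqrt D * R\<rfloor>}) = 2 * of_int \<lfloor>2 * sqrt D * R\<rfloor> + 1"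
      by simp
    then show ?thesis by linarith
  qed
  finally have cardZ: "real (card Z) \<le> 4 * sqrt D * R + 1" by simp
  have "\<bar>real (card E) - 8 * quarter_disc * X / sqrt (D * m\<^sup>2)\<bar>
      \<le> 2 * sqrt (X / A) + 4 * sqrt (A * X / (D * m\<^sup>2)) + 3"
    using qf_ellipse_count(2)[OF pd' X(1)] unfolding disc' E_def[symmetric] D_def by simp
  also have "\<dots> \<le> 2 * R + 4 * (sqrt D * R) + 3"
    using sq by (simp add: R_def)
  finally have "\<bar>real (card E) - 8 * quarter_disc * X / sqrt (D * m\<^sup>2)\<bar> \<le> 2 * R + 4 * sqrt D * R + 3"
    by simp
  moreover have "8 * quarter_disc * X / sqrt (D * m\<^sup>2) = qdens a b c * X * (h / A)"
    using h m0 D unfolding qdens_def D_def[symmetric] m(1) by (simp add: real_sqrt_mult)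
  ultimately have "\<bar>2 * real (card P) - qdens a b c * X * (h / A)\<bar> \<le> 2 * R + 8 * sqrt D * R + 4"
    using cardE cardZ by linarith
  also have "\<dots> \<le> (10 + 8 * sqrt D) * R" using R2 by (simp add: algebra_simps)
  also have "R = sqrt X * (1 / sqrt A)" by (simp add: R_def real_sqrt_divide)
  finally show ?thesis by (simp add: cardP A_def h_def)
qed

text \<open>Each summand is the reciprocal of the index of the sublattice on which the reflection
  along \<open>v\<close> is integral.\<close>

definition wsum :: "int \<Rightarrow> int \<Rightarrow> int \<Rightarrow> real \<Rightarrow> real" where
  "wsum a b c T = (\<Sum>v\<in>pball a b c T. defect a b c v / qf a b c v)"

lemma energy_asymptotic:
  assumes "posdef a b c"
  obtains K where "\<And>X. X \<ge> 1 \<Longrightarrow>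
    \<bar>2 * real (card (energy_pairs a b c X)) - qdens a b c * X * wsum a b c (4 * X)\<bar> \<le> K * X"
proof -
  define D where "D = real_of_int (disc a b c)"
  obtain K1 where K1: "K1 > 0" "\<And>T. T \<ge> 1 \<Longrightarrow> (\<Sum>v\<in>qball a b c T. 1 / sqrt (qf a b c v)) \<le> K1 * sqrt T"
    using qball_inverse_sqrt_sum[OF assms] by blast
  obtain K2 where K2: "K2 > 0" "\<And>T. T \<ge> 1 \<Longrightarrow> \<bar>card (qball a b c T) - qdens a b c * T\<bar> \<le> K2 * sqrt T"
    using card_qball[OF assms] by blast
  define c1 where "c1 = 10 + 8 * sqrt D"
  have "D > 0" using assms unfolding D_def posdef_def by linarith
  then have c1: "c1 \<ge> 0" by (simp add: c1_def)
  have "\<bar>2 * real (card (energy_pairs a b c X)) - qdens a b c * X * wsum a b c (4 * X)\<bar>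
      \<le> (2 + 2 * qdens a b c + 2 * K2 + 2 * c1 * K1) * X" if X: "X \<ge> 1" for X
  proof -
    have "{p. real_of_int (qf a b c p) \<le> X} = insert (0, 0) (qball a b c X)"
      using X by (auto simp: qball_def qf_def)
    then have "real (card {p. real_of_int (qf a b c p) \<le> X}) = 1 + real (card (qball a b c X))"
      using finite_qball[OF assms] by (simp add: qball_def)
    also have "\<dots> \<le> 1 + qdens a b c * X + K2 * sqrt X" using K2(2)[OF X] by linarith
    also have "sqrt X \<le> X" using X by (simp add: real_le_lsqrt self_le_power)
    finally have ball: "real (card {p. real_of_int (qf a b c p) \<le> X}) \<le> (1 + qdens a b c + K2) * X"
      using X K2(1) by (simp add: algebra_simps)
    have "\<bar>(\<Sum>v\<in>pball a b c (4 * X). 2 * real (card (mirror_set a b c X v))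
        - qdens a b c * X * (defect a b c v / qf a b c v))\<bar>
      \<le> (\<Sum>v\<in>pball a b c (4 * X). c1 * (sqrt X * (1 / sqrt (qf a b c v))))"
      unfolding c1_def D_def using X
      by (intro order_trans[OF sum_abs] sum_mono card_mirror_set[OF assms])
         (auto simp: pball_def qball_def)
    also have "\<dots> = c1 * (sqrt X * (\<Sum>v\<in>pball a b c (4 * X). 1 / sqrt (qf a b c v)))"
      by (simp add: sum_distrib_left)
    also have "(\<Sum>v\<in>pball a b c (4 * X). 1 / sqrt (qf a b c v))
        \<le> (\<Sum>v\<in>qball a b c (4 * X). 1 / sqrt (qf a b c v))"
      using finite_qball[OF assms] qf_nonneg[OF assms] by (intro sum_mono2) (auto simp: pball_def)
    also have "\<dots> \<le> K1 * sqrt (4 * X)" using X by (intro K1(2)) simp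
    finally have "\<bar>(\<Sum>v\<in>pball a b c (4 * X). 2 * real (card (mirror_set a b c X v))
        - qdens a b c * X * (defect a b c v / qf a b c v))\<bar> \<le> c1 * (sqrt X * (K1 * sqrt (4 * X)))"
      using c1 X by (simp add: mult_left_mono)
    also have "\<dots> = 2 * c1 * K1 * X"
      using X by (simp add: real_sqrt_mult)
    finally have main: "\<bar>2 * (\<Sum>v\<in>pball a b c (4 * X). real (card (mirror_set a b c X v)))
        - qdens a b c * X * wsum a b c (4 * X)\<bar> \<le> 2 * c1 * K1 * X"
      by (simp add: sum_subtractf sum_distrib_left wsum_def)
    have "2 * real (card (energy_pairs a b c X)) = 2 * real (card {p. real_of_int (qf a b c p) \<le> X})
        + 2 * (\<Sum>v\<in>pball a b c (4 * X). real (card (mirror_set a b c X v)))"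
      unfolding card_energy_pairs[OF assms] by simp
    moreover have "(2 + 2 * qdens a b c + 2 * K2 + 2 * c1 * K1) * X
        = 2 * ((1 + qdens a b c + K2) * X) + 2 * c1 * K1 * X" by (simp add: algebra_simps)
    ultimately show ?thesis using ball main by linarith
  qed
  then show thesis by (rule that)
qed

section \<open>The mean of the defect\<close>

lemma defect_dvd_qf: "defect a b c v dvd qf a b c v"
  by (simp add: defect_def)

lemma defect_dvd_bil: "defect a b c v dvd bil a b c v w"
proof -
  have "defect a b c v dvd 2 * a * fst v + b * snd v" "defect a b c v dvd b * fst v + 2 * c * snd v"
    unfolding defect_def by (auto intro: dvd_trans[OF gcd_dvd2])
  then have "defect a b c v dvd fst w * (2 * a * fst v + b * snd v) + snd w * (b * fst v + 2 * c * snd v)"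
    using dvd_add[OF dvd_mult dvd_mult] by blast
  then show ?thesis by (simp add: bil_def algebra_simps)
qed

text \<open>If \<open>v\<^sub>0\<close> is a primitive vector with \<open>e dvd defect v\<^sub>0\<close>, then every other such vector has, in a
  basis starting with \<open>v\<^sub>0\<close>, second coordinate divisible by \<open>estar e\<close>.\<close>

definition estar :: "nat \<Rightarrow> nat" where
  "estar e = (if 4 dvd e then e div 2 else e)"

lemma estar_pos: "e > 0 \<Longrightarrow> estar e > 0"
  by (auto simp: estar_def)

text \<open>The second divisibility can lose only a factor 2. If \<open>e\<close> is 2 modulo 4, the
  first one restores it by making \<open>y\<close> even; if 4 divides \<open>e\<close>, the loss is
  accepted in \<open>estar\<close>.\<close>

lemma estar_dvd:
  fixes y :: int
  assumes "int e dvd y\<^sup>2" "int e dvd 2 * y"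
  shows "int (estar e) dvd y"
proof (cases "4 dvd e")
  case True
  then obtain j where "e = 4 * j" by blast
  then obtain k where e: "e = 2 * k" by (intro that[of "2 * j"]) simp
  then have "int k dvd y" using assms(2) by simp
  then show ?thesis using True by (simp add: estar_def e)
next
  case False
  show ?thesis
  proof (cases "even e")
    case True
    then obtain k where e: "e = 2 * k" by blast
    then have "odd k" using False by auto
    have "int k dvd y" using assms(2) by (simp add: e)
    moreover have "2 dvd y" using assms(1) unfolding e by (metis dvd_trans dvd_triv_left even_power of_nat_mult of_nat_numeral)
    moreover have "coprime 2 (int k)" using \<open>odd k\<close> by simp
    ultimately have "2 * int k dvd y" by (intro divides_mult)
    then show ?thesis using False by (simp add: estar_def e)
  next
    case odd: False
    then have "coprime (int e) 2" by simp
    then have "int e dvd y" using assms(2) by (simp add: coprime_dvd_mult_right_iff)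
    then show ?thesis using False by (simp add: estar_def)
  qed
qed

text \<open>Necessary conditions on a divisor \<open>e\<close> of a defect. If \<open>e\<close>
  divides both \<open>A = e * p\<close> and \<open>B = e * q\<close>, then
  \<open>4 * A * C - B^2\<close> is \<open>e * (4 * p * C - e * q^2)\<close>, which gains extra
  factors 2 when \<open>e\<close> is even. Keeping track of them is what makes the later bound at
  the prime 2 strong enough.\<close>

definition adm :: "int \<Rightarrow> nat set" where
  "adm D = {e. e > 0 \<and> int e dvd D \<and> (even e \<longrightarrow> 4 dvd D) \<and> (4 dvd e \<longrightarrow> 4 * int e dvd D)}"

text \<open>An upper bound for the mean of the defect: the defect is the sum of
  \<open>totient e\<close> over its divisors \<open>e\<close>, and the vectors whose defect is
  divisible by \<open>e\<close> have relative weight at most \<open>1 / estar e\<close>.\<close>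

definition gbound :: "int \<Rightarrow> real" where
  "gbound D = (\<Sum>e\<in>adm D. totient e / estar e)"

lemma finite_adm: "D > 0 \<Longrightarrow> finite (adm D)"
proof (rule finite_subset[of _ "{..nat D}"])
  assume "D > 0"
  then show "adm D \<subseteq> {..nat D}"
    unfolding adm_def using zdvd_imp_le by fastforce
qed simp

definition primitive_form :: "int \<Rightarrow> int \<Rightarrow> int \<Rightarrow> bool" where
  "primitive_form a b c \<longleftrightarrow> (\<forall>d. d dvd a \<longrightarrow> d dvd b \<longrightarrow> d dvd c \<longrightarrow> is_unit d)"

lemma primitive_lin:
  assumes "primitive_form a b c" "unimodular v u"
  shows "primitive_form (qf a b c v) (bil a b c v u) (qf a b c u)"
  unfolding primitive_form_def
proof (intro allI impI)
  fix d assume d: "d dvd qf a b c v" "d dvd bil a b c v u" "d dvd qf a b c u"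
  have all: "d dvd qf a b c w" for w
  proof -
    have "qf a b c w = qf (qf a b c v) (bil a b c v u) (qf a b c u) (lin_inv v u w)"
      unfolding qf_lin[symmetric] lin_inv_lin[OF assms(2)] ..
    also have "d dvd \<dots>" using d unfolding qf_def[of "qf a b c v"]
      by (intro dvd_add dvd_mult2) auto
    finally show ?thesis .
  qed
  have "d dvd a" "d dvd c" using all[of "(1, 0)"] all[of "(0, 1)"] by (simp_all add: qf_def)
  moreover have "d dvd qf a b c (1, 1) - (a + c)"
    using all[of "(1, 1)"] calculation by (intro dvd_diff dvd_add) auto
  then have "d dvd b" by (simp add: qf_def)
  ultimately show "is_unit d" using assms(1) by (simp add: primitive_form_def)
qed

lemma defect_divisor_adm:
  assumes "posdef a b c" "coprime (fst v) (snd v)" "int e dvd defect a b c v"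
  shows "e \<in> adm (disc a b c)"
proof -
  obtain u where u: "unimodular v u" using ex_unimodular[OF assms(2)] .
  have dvd: "int e dvd qf a b c v" "int e dvd bil a b c v u"
    by (rule dvd_trans[OF assms(3) defect_dvd_qf] dvd_trans[OF assms(3) defect_dvd_bil])+
  obtain p where p: "qf a b c v = int e * p" using dvd(1) by (rule dvdE)
  obtain q where q: "bil a b c v u = int e * q" using dvd(2) by (rule dvdE)
  note pq = p q
  have D: "disc a b c = int e * (4 * p * qf a b c u - int e * q\<^sup>2)"
    using disc_lin[OF u, of a b c] unfolding pq by (simp add: power2_eq_square algebra_simps)
  have "v \<noteq> (0, 0)" using assms(2) by auto
  then have "defect a b c v \<noteq> 0" using defect_pos[OF assms(1), of v] by simp
  then have "e > 0" using assms(3) by (cases e) auto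
  moreover have "4 dvd disc a b c" if ev: "even e"
  proof -
    obtain k where "e = 2 * k" using ev by blast
    then have "disc a b c = 4 * (k * (2 * p * qf a b c u - int k * q\<^sup>2))"
      unfolding D by (simp add: power2_eq_square algebra_simps)
    then show ?thesis by simp
  qed
  moreover have "4 * int e dvd disc a b c" if four: "4 dvd e"
  proof -
    obtain k where k: "e = 4 * k" using four by blast
    have "disc a b c = 4 * int e * (p * qf a b c u - int k * q\<^sup>2)"
      unfolding D k by (simp add: power2_eq_square algebra_simps)
    then show ?thesis by simp
  qed
  ultimately show ?thesis unfolding adm_def using D by simp
qed

lemma pdens_scale:
  assumes "m > 0"
  shows "pdens a (b * int m) (c * (int m)\<^sup>2) = pdens a b c / m"
proof -
  have "4 * a * (c * (int m)\<^sup>2) - (b * int m)\<^sup>2 = (disc a b c) * (int m)\<^sup>2"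
    by (simp add: power2_eq_square algebra_simps)
  then have "real_of_int (4 * a * (c * (int m)\<^sup>2) - (b * int m)\<^sup>2)
      = real_of_int (disc a b c) * (real m)\<^sup>2"
    by (simp only: of_int_mult of_int_power of_int_of_nat_eq)
  then show ?thesis unfolding pdens_def qdens_def using assms by (simp add: real_sqrt_mult)
qed

lemma pdens_lin: "unimodular v u \<Longrightarrow> pdens (qf a b c v) (bil a b c v u) (qf a b c u) = pdens a b c"
  unfolding pdens_def qdens_def by (simp only: disc_lin)

definition dsum :: "int \<Rightarrow> int \<Rightarrow> int \<Rightarrow> nat \<Rightarrow> real \<Rightarrow> real" where
  "dsum a b c e T = (\<Sum>v\<in>{v \<in> pball a b c T. int e dvd defect a b c v}. 1 / qf a b c v)"

text \<open>Fix one vector \<open>v\<close> whose defect is divisible by \<open>e\<close>. In a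
  basis \<open>v\<close>, \<open>u\<close> the coefficients \<open>A\<close>, \<open>B\<close> are
  divisible by \<open>e\<close>, so primitivity of the form makes \<open>C\<close> coprime to
  \<open>e\<close>. For another such vector with coordinates \<open>(x, y)\<close>, divisibility of
  its value and of its \<open>bil\<close> with \<open>u\<close> gives \<open>e dvd y^2\<close> and
  \<open>e dvd 2 * y\<close>. All of them thus lie in a sublattice of index \<open>estar e\<close>,
  where they are still primitive.\<close>

lemma dsum_upper:
  assumes pd: "posdef a b c" and prim: "primitive_form a b c" and "e > 0"
  obtains K where "\<And>T. T \<ge> 1 \<Longrightarrow> dsum a b c e T \<le> pdens a b c / estar e * ln T + K"
proof (cases "\<exists>v. coprime (fst v) (snd v) \<and> int e dvd defect a b c v")
  case False
  then have "dsum a b c e T = 0" for T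
    unfolding dsum_def by (intro sum.neutral) (auto simp: pball_def)
  moreover have "0 \<le> pdens a b c / estar e * ln T" if "T \<ge> 1" for T
    using qdens_pos[OF pd] that by (simp add: pdens_def)
  ultimately show thesis by (intro that[of 0]) simp
next
  case True
  then obtain v where v: "coprime (fst v) (snd v)" "int e dvd defect a b c v" by blast
  obtain u where u: "unimodular v u" using ex_unimodular[OF v(1)] .
  define A B C where "A = qf a b c v" and "B = bil a b c v u" and "C = qf a b c u"
  define m where "m = estar e"
  have m: "m > 0" using estar_pos \<open>e > 0\<close> by (simp add: m_def)
  have eAB: "int e dvd A" "int e dvd B"
    unfolding A_def B_def
    by (rule dvd_trans[OF v(2) defect_dvd_qf] dvd_trans[OF v(2) defect_dvd_bil])+
  have eC: "coprime (int e) C"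
  proof (rule coprimeI)
    fix d assume "d dvd int e" "d dvd C"
    then have "d dvd A" "d dvd B" "d dvd C" using dvd_trans[of d "int e"] eAB by auto
    then show "is_unit d"
      using primitive_lin[OF prim u] unfolding primitive_form_def A_def B_def C_def by blast
  qed
  have pd': "posdef A (B * int m) (C * (int m)\<^sup>2)"
  proof -
    have "posdef A B C" unfolding A_def B_def C_def by (rule posdef_lin[OF pd u])
    moreover have "4 * A * (C * (int m)\<^sup>2) - (B * int m)\<^sup>2 = (4 * A * C - B\<^sup>2) * (int m)\<^sup>2"
      by (simp add: power2_eq_square algebra_simps)
    ultimately show ?thesis using m unfolding posdef_def by simp
  qed
  define F where "F = (\<lambda>w. (fst (lin_inv v u w), snd (lin_inv v u w) div int m))"
  have key: "lin v u (fst (F w), int m * snd (F w)) = w \<and> coprime (fst (F w)) (snd (F w))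
      \<and> qf A (B * int m) (C * (int m)\<^sup>2) (F w) = qf a b c w"
    if w: "coprime (fst w) (snd w)" "int e dvd defect a b c w" for w
  proof -
    obtain x y where xy: "lin_inv v u w = (x, y)" by (cases "lin_inv v u w")
    have w_eq: "w = lin v u (x, y)" using lin_inv_lin(2)[OF u, of w] xy by simp
    have "int e dvd qf a b c w" by (rule dvd_trans[OF w(2) defect_dvd_qf])
    then have "int e dvd A * x\<^sup>2 + B * x * y + C * y\<^sup>2"
      unfolding w_eq qf_lin by (simp add: qf_def[of "qf a b c v"] A_def B_def C_def)
    moreover have "int e dvd A * x\<^sup>2 + B * x * y" using eAB by simp
    ultimately have "int e dvd C * y\<^sup>2" by (simp add: dvd_add_right_iff)
    then have 1: "int e dvd y\<^sup>2" using eC by (simp add: coprime_dvd_mult_right_iff)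
    have "int e dvd bil a b c w u" by (rule dvd_trans[OF w(2) defect_dvd_bil])
    also have "bil a b c w u = B * x + C * (2 * y)"
      unfolding w_eq by (simp add: bil_def lin_def B_def C_def qf_def power2_eq_square algebra_simps)
    finally have "int e dvd C * (2 * y)" using eAB(2) by (simp add: dvd_add_right_iff)
    then have 2: "int e dvd 2 * y" using eC by (simp add: coprime_dvd_mult_right_iff)
    obtain t where t: "y = int m * t" using estar_dvd[OF 1 2] by (auto simp: m_def)
    have Fw: "F w = (x, t)" using m by (simp add: F_def xy t)
    have "coprime x y" using w(1) coprime_lin[OF u, of "(x, y)"] unfolding w_eq by simp
    then have "coprime x t" unfolding t by simp
    moreover have "qf A (B * int m) (C * (int m)\<^sup>2) (x, t) = qf A B C (x, y)"
      unfolding t by (simp add: qf_def power2_eq_square algebra_simps)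
    moreover have "\<dots> = qf a b c w" unfolding w_eq qf_lin A_def B_def C_def ..
    ultimately show ?thesis unfolding Fw using w_eq t by simp
  qed
  have le: "dsum a b c e T \<le> psum A (B * int m) (C * (int m)\<^sup>2) T" for T
  proof -
    define S where "S = {v \<in> pball a b c T. int e dvd defect a b c v}"
    have S: "coprime (fst w) (snd w)" "int e dvd defect a b c w" if "w \<in> S" for w
      using that by (auto simp: S_def pball_def)
    have inj: "inj_on F S"
    proof (rule inj_onI)
      fix w w' assume "w \<in> S" "w' \<in> S" "F w = F w'"
      then show "w = w'" using key[OF S(1) S(2), of w] key[OF S(1) S(2), of w'] by metis
    qed
    have "F ` S \<subseteq> pball A (B * int m) (C * (int m)\<^sup>2) T"
    proof
      fix z assume "z \<in> F ` S"
      then obtain w where w: "w \<in> S" "z = F w" by blast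
      have "coprime (fst z) (snd z)" "qf A (B * int m) (C * (int m)\<^sup>2) z = qf a b c w"
        using key[OF S[OF w(1)]] w(2) by auto
      then show "z \<in> pball A (B * int m) (C * (int m)\<^sup>2) T"
        using w(1) by (auto simp: S_def pball_def qball_def)
    qed
    have "dsum a b c e T = (\<Sum>w\<in>S. 1 / real_of_int (qf A (B * int m) (C * (int m)\<^sup>2) (F w)))"
      unfolding dsum_def S_def[symmetric] using key[OF S] by (intro sum.cong) auto
    also have "\<dots> = (\<Sum>z\<in>F ` S. 1 / real_of_int (qf A (B * int m) (C * (int m)\<^sup>2) z))"
      by (subst sum.reindex[OF inj]) (simp add: o_def)
    also have "\<dots> \<le> psum A (B * int m) (C * (int m)\<^sup>2) T"
      unfolding psum_def using finite_pball[OF pd'] qf_nonneg[OF pd']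
      by (intro sum_mono2) (use \<open>F ` S \<subseteq> _\<close> in auto)
    finally show ?thesis .
  qed
  obtain K where K: "\<And>T. T \<ge> 1 \<Longrightarrow> \<bar>psum A (B * int m) (C * (int m)\<^sup>2) T
      - pdens A (B * int m) (C * (int m)\<^sup>2) * ln T\<bar> \<le> K"
    using psum_asymptotic[OF pd'] by blast
  have dens: "pdens A (B * int m) (C * (int m)\<^sup>2) = pdens a b c / estar e"
    unfolding pdens_scale[OF m] unfolding A_def B_def C_def pdens_lin[OF u] m_def ..
  show thesis
  proof (rule that[of K])
    fix T :: real assume "T \<ge> 1"
    then show "dsum a b c e T \<le> pdens a b c / estar e * ln T + K"
      using le[of T] K[of T] unfolding dens by linarith
  qed
qed

lemma wsum_upper:
  assumes pd: "posdef a b c" and prim: "primitive_form a b c"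
  obtains K where "\<And>T. T \<ge> 1 \<Longrightarrow>
    wsum a b c T \<le> gbound (disc a b c) * pdens a b c * ln T + K"
proof -
  define D where "D = disc a b c"
  have D: "D > 0" using pd by (simp add: D_def posdef_def)
  \<comment> \<open>Gauss's identity for totients, followed by an exchange of sums;
    \<open>adm D\<close> is a finite index set containing every divisor of every defect.\<close>
  have eq: "wsum a b c T = (\<Sum>e\<in>adm D. totient e * dsum a b c e T)" for T
  proof -
    have "wsum a b c T = (\<Sum>v\<in>pball a b c T. \<Sum>e\<in>{e \<in> adm D. int e dvd defect a b c v}.
        totient e * (1 / qf a b c v))"
      unfolding wsum_def
    proof (intro sum.cong refl)
      fix v assume v: "v \<in> pball a b c T"
      then have cop: "coprime (fst v) (snd v)" "v \<noteq> (0, 0)" by (auto simp: pball_def qball_def)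
      define h where "h = nat (defect a b c v)"
      have h: "defect a b c v = int h" using defect_pos[OF pd cop(2)] by (simp add: h_def)
      have "{e \<in> adm D. int e dvd defect a b c v} = {e. e dvd h}"
        using defect_divisor_adm[OF pd cop(1)] unfolding D_def h by auto
      then have "(\<Sum>e\<in>{e \<in> adm D. int e dvd defect a b c v}. totient e * (1 / qf a b c v))
          = real (\<Sum>e | e dvd h. totient e) * (1 / qf a b c v)"
        by (simp add: sum_divide_distrib)
      then show "defect a b c v / qf a b c v
          = (\<Sum>e\<in>{e \<in> adm D. int e dvd defect a b c v}. totient e * (1 / qf a b c v))"
        unfolding totient_divisor_sum by (simp add: h)
    qed
    also have "\<dots> = (\<Sum>e\<in>adm D. \<Sum>v\<in>{v \<in> pball a b c T. int e dvd defect a b c v}.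
        totient e * (1 / qf a b c v))"
      by (rule sum.swap_restrict[OF finite_pball[OF pd] finite_adm[OF D]])
    finally show ?thesis by (simp add: dsum_def sum_distrib_left)
  qed
  have "\<forall>e\<in>adm D. \<exists>K. \<forall>T\<ge>1. dsum a b c e T \<le> pdens a b c / estar e * ln T + K"
  proof
    fix e assume "e \<in> adm D"
    then have "e > 0" by (simp add: adm_def)
    show "\<exists>K. \<forall>T\<ge>1. dsum a b c e T \<le> pdens a b c / estar e * ln T + K"
      using dsum_upper[OF pd prim \<open>e > 0\<close>] by blast
  qed
  then obtain K where K: "\<And>e T. e \<in> adm D \<Longrightarrow> T \<ge> 1 \<Longrightarrow>
      dsum a b c e T \<le> pdens a b c / estar e * ln T + K e"
    by metis
  show thesis
  proof (rule that[of "\<Sum>e\<in>adm D. totient e * K e"])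
    fix T :: real assume T: "T \<ge> 1"
    have "wsum a b c T \<le> (\<Sum>e\<in>adm D. totient e * (pdens a b c / estar e * ln T + K e))"
      unfolding eq using K T by (intro sum_mono mult_left_mono) auto
    also have "\<dots> = gbound D * pdens a b c * ln T + (\<Sum>e\<in>adm D. totient e * K e)"
      unfolding gbound_def by (simp add: sum.distrib sum_distrib_left sum_distrib_right algebra_simps)
    finally show "wsum a b c T \<le> gbound (disc a b c) * pdens a b c * ln T
        + (\<Sum>e\<in>adm D. totient e * K e)" unfolding D_def .
  qed
qed

text \<open>Splitting the primitive vectors according to whether \<open>p\<close> divides their defect, \<open>\<sigma>\<close> maps one part
  into the other while multiplying \<open>f\<close> by \<open>p\<close>; so the vectors with defect divisible by \<open>p\<close>
  carry at least the share \<open>1 / (p + 1)\<close> of the sum.\<close>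

lemma wsum_lower:
  fixes p :: nat
  assumes pd: "posdef a b c" and p: "p \<ge> 1"
    and inj: "inj \<sigma>"
    and scale: "\<And>w. qf a b c (\<sigma> w) = int p * qf a b c w"
    and sig: "\<And>w. coprime (fst w) (snd w) \<Longrightarrow> int p dvd defect a b c w \<or>
        coprime (fst (\<sigma> w)) (snd (\<sigma> w)) \<and> int p dvd defect a b c (\<sigma> w)"
  obtains K where "\<And>T::real. T \<ge> real p \<Longrightarrow> 2 * p / (p + 1) * pdens a b c * ln T - K \<le> wsum a b c T"
proof -
  obtain K where K: "\<And>T. T \<ge> 1 \<Longrightarrow> \<bar>psum a b c T - pdens a b c * ln T\<bar> \<le> K"
    using psum_asymptotic[OF pd] by blast
  have K0: "K \<ge> 0" using K[of 1] by auto
  have dens: "pdens a b c > 0" using qdens_pos[OF pd] by (simp add: pdens_def)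
  \<comment> \<open>Vectors of \<open>P1\<close> already belong to \<open>Q\<close>. Those of
    \<open>P2\<close> are moved into \<open>Q\<close> injectively, where \<open>1 / f\<close> is
    smaller by the factor \<open>p\<close>; together this gives \<open>1 + p\<close> copies of the
    sum over \<open>Q\<close>.\<close>
  have S: "psum a b c (T / p) \<le> (p + 1) * dsum a b c p T" for T
  proof -
    define P1 where "P1 = {w \<in> pball a b c (T / p). int p dvd defect a b c w}"
    define P2 where "P2 = {w \<in> pball a b c (T / p). \<not> int p dvd defect a b c w}"
    define Q where "Q = {w \<in> pball a b c T. int p dvd defect a b c w}"
    have fin: "finite P1" "finite P2" "finite Q"
      unfolding P1_def P2_def Q_def using finite_pball[OF pd] by auto
    have "pball a b c (T / p) = P1 \<union> P2" "P1 \<inter> P2 = {}" by (auto simp: P1_def P2_def)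
    then have "psum a b c (T / p) = (\<Sum>w\<in>P1. 1 / qf a b c w) + (\<Sum>w\<in>P2. 1 / qf a b c w)"
      unfolding psum_def using fin by (simp add: sum.union_disjoint)
    moreover have "(\<Sum>w\<in>P1. 1 / qf a b c w) \<le> (\<Sum>w\<in>Q. 1 / qf a b c w)"
    proof (intro sum_mono2 fin)
      show "P1 \<subseteq> Q"
      proof
        fix w assume w: "w \<in> P1"
        then have le: "real_of_int (qf a b c w) \<le> T / p" by (auto simp: P1_def pball_def qball_def)
        have "real_of_int (qf a b c w) * 1 \<le> real_of_int (qf a b c w) * p"
          using p qf_nonneg[OF pd] by (intro mult_left_mono) auto
        also have "\<dots> \<le> T" using le p by (simp add: pos_le_divide_eq)
        finally show "w \<in> Q" using w by (auto simp: P1_def Q_def pball_def qball_def)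
      qed
    qed (use qf_nonneg[OF pd] in auto)
    moreover have "(\<Sum>w\<in>P2. 1 / qf a b c w) \<le> p * (\<Sum>w\<in>Q. 1 / qf a b c w)"
    proof -
      have "\<sigma> ` P2 \<subseteq> Q"
      proof
        fix z assume "z \<in> \<sigma> ` P2"
        then obtain w where w: "w \<in> P2" "z = \<sigma> w" by blast
        then have "coprime (fst w) (snd w)" "\<not> int p dvd defect a b c w"
          by (auto simp: P2_def pball_def)
        then have *: "coprime (fst z) (snd z)" "int p dvd defect a b c z"
          using sig[of w] w(2) by auto
        have "real_of_int (qf a b c w) \<le> T / p" using w by (auto simp: P2_def pball_def qball_def)
        then have "real_of_int (qf a b c z) \<le> T"
          unfolding w(2) scale using p by (simp add: pos_le_divide_eq mult.commute)
        moreover have "z \<noteq> (0, 0)" using *(1) by auto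
        ultimately show "z \<in> Q" using * by (simp add: Q_def pball_def qball_def)
      qed
      have "(\<Sum>w\<in>P2. 1 / qf a b c w) = (\<Sum>w\<in>P2. p * (1 / qf a b c (\<sigma> w)))"
        unfolding scale using p by (intro sum.cong) auto
      also have "\<dots> = p * (\<Sum>z\<in>\<sigma> ` P2. 1 / qf a b c z)"
        using sum.reindex[OF inj_on_subset[OF inj subset_UNIV], of "\<lambda>z. 1 / real_of_int (qf a b c z)" P2]
        by (simp add: o_def sum_distrib_left)
      also have "\<dots> \<le> p * (\<Sum>w\<in>Q. 1 / qf a b c w)"
        using \<open>\<sigma> ` P2 \<subseteq> Q\<close> fin qf_nonneg[OF pd] by (intro mult_left_mono sum_mono2) auto
      finally show ?thesis .
    qed
    ultimately show ?thesis unfolding dsum_def Q_def[symmetric] by (simp add: algebra_simps)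
  qed
  \<comment> \<open>The defect is at least 1 everywhere and at least \<open>p\<close> where
    \<open>p\<close> divides it.\<close>
  have W: "psum a b c T + (p - 1) * dsum a b c p T \<le> wsum a b c T" for T
  proof -
    have "dsum a b c p T = (\<Sum>v\<in>pball a b c T. if int p dvd defect a b c v then 1 / qf a b c v else 0)"
      unfolding dsum_def using finite_pball[OF pd] by (simp add: sum.inter_filter)
    then have "psum a b c T + (p - 1) * dsum a b c p T = (\<Sum>v\<in>pball a b c T. 1 / qf a b c v
        + real (p - 1) * (if int p dvd defect a b c v then 1 / qf a b c v else 0))"
      by (simp add: psum_def sum.distrib sum_distrib_left)
    also have "\<dots> \<le> wsum a b c T"
      unfolding wsum_def
    proof (intro sum_mono)
      fix v assume "v \<in> pball a b c T"
      then have v: "v \<noteq> (0, 0)" by (auto simp: pball_def qball_def)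
      have q: "real_of_int (qf a b c v) > 0" using qf_pos[OF pd v] by simp
      have h: "defect a b c v \<ge> 1" using defect_pos[OF pd v] by simp
      show "1 / qf a b c v + real (p - 1) * (if int p dvd defect a b c v then 1 / qf a b c v else 0)
          \<le> defect a b c v / qf a b c v"
      proof (cases "int p dvd defect a b c v")
        case True
        then have "int p \<le> defect a b c v" using h zdvd_imp_le by simp
        then have "real p \<le> real_of_int (defect a b c v)" by linarith
        then have "real p / qf a b c v \<le> defect a b c v / qf a b c v"
          using q by (intro divide_right_mono) auto
        moreover have "1 / qf a b c v + real (p - 1) * (1 / qf a b c v) = real p / qf a b c v"
          using p by (simp add: of_nat_diff add_divide_distrib[symmetric])
        ultimately show ?thesis using True by simp
      next
        case False
        then show ?thesis using h q by (simp add: divide_right_mono)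
      qed
    qed
    finally show ?thesis .
  qed
  show thesis
  proof (rule that[of "2 * K + pdens a b c * ln p"])
    fix T :: real assume T: "T \<ge> real p"
    then have T1: "T \<ge> 1" "T / p \<ge> 1" using p by auto
    have "pdens a b c * ln T - K \<le> psum a b c T" using K[OF T1(1)] by linarith
    moreover have "pdens a b c * ln (T / p) - K \<le> psum a b c (T / p)" using K[OF T1(2)] by linarith
    then have "pdens a b c * (ln T - ln p) - K \<le> (p + 1) * dsum a b c p T"
      using S[of T] T1 p by (simp add: ln_div)
    then have "(pdens a b c * (ln T - ln p) - K) / (p + 1) \<le> dsum a b c p T"
      by (simp add: divide_le_eq mult.commute)
    then have "real (p - 1) * ((pdens a b c * (ln T - ln p) - K) / (p + 1)) \<le> (p - 1) * dsum a b c p T"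
      by (intro mult_left_mono) auto
    ultimately have "pdens a b c * ln T - K + (p - 1) * ((pdens a b c * (ln T - ln p) - K) / (p + 1)) \<le> wsum a b c T"
      using W[of T] by linarith
    moreover have "pdens a b c * ln T - K + (p - 1) * ((pdens a b c * (ln T - ln p) - K) / (p + 1))
        = 2 * p / (p + 1) * pdens a b c * ln T - K - real (p - 1) / (p + 1) * (pdens a b c * ln p + K)"
    proof -
      \<comment> \<open>The share \<open>1 / (p + 1)\<close> carries the additional weight
        \<open>p - 1\<close>, and \<open>1 + (p - 1) / (p + 1)\<close> is
        \<open>2 * p / (p + 1)\<close>.\<close>
      define r where "r = real (p - 1) / (p + 1)"
      have r: "2 * p / (p + 1) = 1 + r" using p by (simp add: r_def of_nat_diff field_simps)
      have "(p - 1) * ((pdens a b c * (ln T - ln p) - K) / (p + 1))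
          = r * (pdens a b c * (ln T - ln p) - K)" by (simp add: r_def)
      then show ?thesis unfolding r r_def[symmetric] by (simp add: algebra_simps)
    qed
    moreover have "real (p - 1) / (p + 1) * (pdens a b c * ln p + K) \<le> 1 * (pdens a b c * ln p + K)"
      using p K0 dens by (intro mult_right_mono) (auto simp: divide_le_eq)
    moreover have "x - (2 * K + l) \<le> W"
      if "z \<le> W" "z = x - K - y" "y \<le> 1 * (l + K)" for x y z l W :: real
      using that unfolding mult_1 by linarith
    ultimately show "2 * p / (p + 1) * pdens a b c * ln T - (2 * K + pdens a b c * ln p) \<le> wsum a b c T"
      by blast
  qed
qed

text \<open>The factor is \<open>2 * p / (p + 1)\<close> for \<open>p = 3\<close>; dividing by the
  square root of the discriminant 3 yields \<open>sqrt 3 / 2\<close>.\<close>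

lemma wsum_lower_eisenstein:
  obtains K where "\<And>T. T \<ge> 3 \<Longrightarrow> 3 / 2 * pdens 1 1 1 * ln T - K \<le> wsum 1 1 1 T"
proof -
  \<comment> \<open>multiplication by \<open>2 * \<omega> - 1\<close>, a square root of \<open>-3\<close>, where \<open>\<omega>\<^sup>2 = \<omega> - 1\<close>\<close>
  define \<sigma> :: "int \<times> int \<Rightarrow> int \<times> int" where "\<sigma> = (\<lambda>(x, y). (- x - 2 * y, 2 * x + y))"
  obtain K where "\<And>T::real. T \<ge> real 3 \<Longrightarrow> 2 * real 3 / (real 3 + 1) * pdens 1 1 1 * ln T - K \<le> wsum 1 1 1 T"
  proof (rule wsum_lower[of 1 1 1 3 \<sigma>])
    show "inj \<sigma>" by (auto simp: inj_def \<sigma>_def)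
    show "qf 1 1 1 (\<sigma> w) = int 3 * qf 1 1 1 w" for w
      by (cases w) (simp add: \<sigma>_def qf_def power2_eq_square algebra_simps)
    fix w :: "int \<times> int" assume w: "coprime (fst w) (snd w)"
    obtain x y where xy: "w = (x, y)" by (cases w)
    show "int 3 dvd defect 1 1 1 w \<or> coprime (fst (\<sigma> w)) (snd (\<sigma> w)) \<and> int 3 dvd defect 1 1 1 (\<sigma> w)"
    \<comment> \<open>Modulo 3 the form is \<open>(x - y)^2\<close> and both gradient coordinates
      are \<open>x - y\<close> up to sign, so this is the condition that 3 divides the
      defect.\<close>
    proof (cases "3 dvd x - y")
      case True
      then obtain k where k: "x = y + 3 * k" by (metis add.commute diff_add_cancel dvdE)
      have "qf 1 1 1 w = 3 * (y\<^sup>2 + 3 * k * y + 3 * k\<^sup>2)"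
        "2 * x + y = 3 * (y + 2 * k)" "x + 2 * y = 3 * (y + k)"
        by (simp_all add: xy k qf_def power2_eq_square algebra_simps)
      then have "3 dvd qf 1 1 1 w" "3 dvd 2 * x + y" "3 dvd x + 2 * y" by (metis dvd_triv_left)+
      then have "int 3 dvd defect 1 1 1 w" unfolding defect_def by (simp add: xy)
      then show ?thesis ..
    next
      case False
      have "coprime (- x - 2 * y) (2 * x + y)"
      proof (rule coprimeI)
        fix d assume d: "d dvd - x - 2 * y" "d dvd 2 * x + y"
        have "d dvd 3 * x" "d dvd 3 * y"
          using dvd_add[OF d(1) dvd_mult[OF d(2), of 2]] dvd_diff[OF dvd_mult[OF d(1), of "-2"] d(2)]
          by simp_all
        then have "d dvd gcd (3 * x) (3 * y)" by simp
        also have "gcd (3 * x) (3 * y) = 3"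
          using w by (simp add: xy gcd_mult_left coprime_iff_gcd_eq_1)
        finally have "d dvd 3" .
        \<comment> \<open>The first coordinate of the image is congruent to \<open>y - x\<close>
          modulo 3, so the only possible nontrivial common divisor is excluded.\<close>
        have "\<not> 3 dvd d"
        proof
          assume "3 dvd d"
          then have "3 dvd - x - 2 * y" using d(1) by (rule dvd_trans)
          then have "3 dvd x - y" by presburger
          then show False using False by simp
        qed
        moreover have "prime (3::int)" by simp
        ultimately have "coprime 3 d" by (simp add: prime_imp_coprime)
        then show "is_unit d" using \<open>d dvd 3\<close> by (metis coprime_common_divisor dvd_refl)
      qed
      moreover have "int 3 dvd defect 1 1 1 (\<sigma> w)"
      proof -
        have "qf 1 1 1 (\<sigma> w) = 3 * qf 1 1 1 w"
          by (simp add: xy \<sigma>_def qf_def power2_eq_square algebra_simps)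
        then show ?thesis unfolding defect_def by (simp add: xy \<sigma>_def)
      qed
      ultimately show ?thesis by (simp add: xy \<sigma>_def)
    qed
  qed (auto simp: posdef_def)
  then show thesis by (intro that[of K]) simp
qed

text \<open>Here \<open>p = 2\<close>, and \<open>4 / 3\<close> divided by the square root of the
  discriminant 4 gives \<open>2 / 3\<close>.\<close>

lemma wsum_lower_gauss:
  obtains K where "\<And>T. T \<ge> 2 \<Longrightarrow> 4 / 3 * pdens 1 0 1 * ln T - K \<le> wsum 1 0 1 T"
proof -
  \<comment> \<open>multiplication by \<open>1 + i\<close>\<close>
  define \<sigma> :: "int \<times> int \<Rightarrow> int \<times> int" where "\<sigma> = (\<lambda>(x, y). (x - y, x + y))"
  obtain K where "\<And>T::real. T \<ge> real 2 \<Longrightarrow> 2 * real 2 / (real 2 + 1) * pdens 1 0 1 * ln T - K \<le> wsum 1 0 1 T"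
  proof (rule wsum_lower[of 1 0 1 2 \<sigma>])
    show "inj \<sigma>" by (auto simp: inj_def \<sigma>_def)
    show "qf 1 0 1 (\<sigma> w) = int 2 * qf 1 0 1 w" for w
      by (cases w) (simp add: \<sigma>_def qf_def power2_eq_square algebra_simps)
    fix w :: "int \<times> int" assume w: "coprime (fst w) (snd w)"
    obtain x y where xy: "w = (x, y)" by (cases w)
    show "int 2 dvd defect 1 0 1 w \<or> coprime (fst (\<sigma> w)) (snd (\<sigma> w)) \<and> int 2 dvd defect 1 0 1 (\<sigma> w)"
    proof (cases "even (x - y)")
      case True
      then have "int 2 dvd defect 1 0 1 w" unfolding defect_def by (simp add: xy qf_def)
      then show ?thesis ..
    next
      case False
      have "coprime (x - y) (x + y)"
      proof (rule coprimeI)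
        fix d assume d: "d dvd x - y" "d dvd x + y"
        have "d dvd 2 * x" "d dvd 2 * y"
          using dvd_add[OF d(2,1)] dvd_diff[OF d(2,1)] by simp_all
        then have "d dvd gcd (2 * x) (2 * y)" by simp
        also have "gcd (2 * x) (2 * y) = 2"
          using w by (simp add: xy gcd_mult_left coprime_iff_gcd_eq_1)
        finally have "d dvd 2" .
        moreover have "odd d" using False dvd_trans[OF _ d(1), of 2] by blast
        then have "coprime d 2" by simp
        ultimately show "is_unit d" by (metis coprime_common_divisor dvd_refl)
      qed
      moreover have "int 2 dvd defect 1 0 1 (\<sigma> w)"
      proof -
        have "qf 1 0 1 (\<sigma> w) = 2 * qf 1 0 1 w"
          by (simp add: xy \<sigma>_def qf_def power2_eq_square algebra_simps)
        then show ?thesis unfolding defect_def by (simp add: xy \<sigma>_def)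
      qed
      ultimately show ?thesis by (simp add: xy \<sigma>_def)
    qed
  qed (auto simp: posdef_def)
  then show thesis by (intro that[of K]) simp
qed

section \<open>Bounding the mean defect in terms of the discriminant\<close>

text \<open>The mean of \<open>gcd k n\<close> over the residues \<open>k\<close> modulo
  \<open>n\<close>. It is the contribution of odd divisors to \<open>gbound\<close>, because
  \<open>estar e\<close> is \<open>e\<close> for odd \<open>e\<close>.\<close>

definition tsum :: "nat \<Rightarrow> real" where
  "tsum n = (\<Sum>d | d dvd n. totient d / d)"

lemma tsum_1 [simp]: "tsum (Suc 0) = 1"
  by (simp add: tsum_def)

lemma tsum_nonneg: "tsum n \<ge> 0"
  unfolding tsum_def by (intro sum_nonneg) simp

lemma totient_prime_power_ratio:
  assumes "prime p" "i > 0"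
  shows "real (totient (p ^ i)) / real (p ^ i) = 1 - 1 / p"
proof -
  have p: "p > 0" using assms(1) by (simp add: prime_gt_0_nat)
  obtain j where i: "i = Suc j" using assms(2) by (cases i) auto
  have "totient (p ^ i) = p ^ j * (p - 1)"
    unfolding i by (rule totient_prime_power_Suc[OF assms(1)])
  then show ?thesis using p by (simp add: i of_nat_diff Suc_leI field_simps)
qed

text \<open>Every divisor is a product of some \<open>p ^ i\<close> and a divisor of
  \<open>m\<close>; each of the \<open>k\<close> positive exponents contributes the factor
  \<open>1 - 1 / p\<close>.\<close>

lemma tsum_prime_power_mult:
  assumes p: "prime p" and m: "\<not> p dvd m" "m > 0"
  shows "tsum (p ^ k * m) \<le> (1 + k * (1 - 1 / p)) * tsum m"
proof -
  define w where "w = (\<lambda>d::nat. real (totient d) / real d)"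
  have sub: "{e. e dvd p ^ k * m} \<subseteq> (\<lambda>(i, d). p ^ i * d) ` ({..k} \<times> {d. d dvd m})"
  proof
    fix e assume "e \<in> {e. e dvd p ^ k * m}"
    then have "e dvd p ^ k * m" by simp
    then obtain b d where bd: "e = b * d" "b dvd p ^ k" "d dvd m"
      using division_decomp[of e "p ^ k" m] by blast
    then obtain i where "i \<le> k" "b = p ^ i" using divides_primepow_nat[OF p] by blast
    then show "e \<in> (\<lambda>(i, d). p ^ i * d) ` ({..k} \<times> {d. d dvd m})"
      using bd by (auto simp: image_iff)
  qed
  have fin: "finite ({..k} \<times> {d. d dvd m})" using m by simp
  have "tsum (p ^ k * m) \<le> sum w ((\<lambda>(i, d). p ^ i * d) ` ({..k} \<times> {d. d dvd m}))"
    unfolding tsum_def w_def using sub fin by (intro sum_mono2) auto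
  also have "\<dots> \<le> sum (w \<circ> (\<lambda>(i, d). p ^ i * d)) ({..k} \<times> {d. d dvd m})"
    using fin by (intro sum_image_le) (auto simp: w_def)
  also have "\<dots> = (\<Sum>i\<le>k. \<Sum>d | d dvd m. w (p ^ i * d))"
    by (simp add: sum.cartesian_product case_prod_unfold)
  also have "\<dots> = (\<Sum>i\<le>k. \<Sum>d | d dvd m. w (p ^ i) * w d)"
  proof (intro sum.cong refl)
    fix i d assume "d \<in> {d. d dvd m}"
    then have "\<not> p dvd d" using m(1) dvd_trans[of p d m] by blast
    then have "coprime (p ^ i) d" using p by (simp add: prime_imp_coprime)
    then show "w (p ^ i * d) = w (p ^ i) * w d" by (simp add: w_def totient_mult_coprime)
  qed
  also have "\<dots> = (\<Sum>i\<le>k. w (p ^ i)) * tsum m"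
    by (simp only: sum_product tsum_def w_def)
  also have "(\<Sum>i\<le>k. w (p ^ i)) = w (p ^ 0) + (\<Sum>i=1..k. w (p ^ i))"
    by (simp add: sum.atMost_shift sum.atLeast1_atMost_eq)
  also have "(\<Sum>i=1..k. w (p ^ i)) = (\<Sum>i=1..k. 1 - 1 / p)"
    unfolding w_def using totient_prime_power_ratio[OF p] by (intro sum.cong) auto
  finally show ?thesis by (simp add: w_def)
qed

text \<open>From \<open>k = 1\<close> on, one step multiplies the left side by at most 3/2 and the
  right side by \<open>s\<close>, so checking the exponent \<open>k0\<close> suffices.\<close>

lemma linear_le_power_from:
  fixes w s c :: real
  assumes "0 \<le> w" "w \<le> 1" "3 / 2 \<le> s" "1 \<le> k0" "1 + k0 * w \<le> c * s ^ k0" "k0 \<le> k"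
  shows "1 + real k * w \<le> c * s ^ k"
  using assms(6)
proof (induction k rule: dec_induct)
  case (step k)
  have "1 \<le> real k" using step assms(4) by simp
  then have "w \<le> real k * w" using assms(1) mult_right_mono[of 1 "real k" w] by simp
  then have "1 + real (Suc k) * w \<le> 3 / 2 * (1 + real k * w)" using assms(2) by (simp add: algebra_simps)
  also have "\<dots> \<le> s * (1 + real k * w)" using assms(1,3) by (intro mult_right_mono) auto
  also have "\<dots> \<le> s * (c * s ^ k)" using assms(3) step by (intro mult_left_mono) auto
  finally show ?case by (simp add: algebra_simps)
qed (use assms in simp)

lemma prime_factor_split:
  fixes n p :: nat
  assumes "prime p" "p dvd n" "n > 0"
  obtains k m where "n = p ^ k * m" "\<not> p dvd m" "k \<ge> 1" "m > 0" "m < n"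
proof -
  have p: "p > 1" using assms(1) by (rule prime_gt_1_nat)
  obtain m where m: "n = p ^ multiplicity p n * m" "\<not> p dvd m"
    using multiplicity_decompose'[of n p] assms p by auto
  have k: "multiplicity p n \<ge> 1"
  proof (rule ccontr)
    assume "\<not> multiplicity p n \<ge> 1"
    then have "multiplicity p n = 0" by simp
    then have "m = n" using m(1) by (metis mult_1 power_0)
    then show False using m(2) assms(2) by simp
  qed
  have "m > 0" using m(2) by (cases "m = 0") auto
  have "1 < p ^ multiplicity p n" using k p by (intro one_less_power) auto
  then have "1 * m < p ^ multiplicity p n * m" using \<open>m > 0\<close> by (intro mult_strict_right_mono) auto
  then have "m < n" using m(1) by (metis mult_1)
  then show thesis by (rule that[OF m k \<open>m > 0\<close>])
qed

lemma sqrt_ge_17_10: "sqrt (real p) \<ge> 17 / 10" if "p \<ge> 3"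
  using that by (intro real_le_rsqrt) (simp add: power2_eq_square)

text \<open>The constant \<open>c\<close> is gained on a single prime power; the cofactor is charged
  only \<open>sqrt m\<close>.\<close>

lemma tsum_split_le:
  fixes p m k k0 :: nat
  assumes p: "prime p" "p \<ge> 3" and m: "\<not> p dvd m" "m > 0" "tsum m \<le> sqrt m"
    and c: "c \<ge> 0" "1 + real k0 * (1 - 1 / p) \<le> c * sqrt p ^ k0" "1 \<le> k0" "k0 \<le> k"
  shows "tsum (p ^ k * m) \<le> c * sqrt (real (p ^ k * m))"
proof -
  have "1 + real k * (1 - 1 / p) \<le> c * sqrt p ^ k"
    using c(2) sqrt_ge_17_10[OF p(2)] p(2) by (intro linear_le_power_from[OF _ _ _ c(3) _ c(4)]) auto
  then have "(1 + k * (1 - 1 / p)) * tsum m \<le> (c * sqrt p ^ k) * sqrt m"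
    using m(3) p(2) c(1) tsum_nonneg by (intro mult_mono) auto
  then show ?thesis
    using tsum_prime_power_mult[OF p(1) m(1,2), of k] by (simp add: real_sqrt_mult real_sqrt_power)
qed

lemma tsum_le_sqrt: "odd n \<Longrightarrow> tsum n \<le> sqrt n"
proof (induction n rule: less_induct)
  case (less n)
  show ?case
  proof (cases "n = 1")
    case False
    have n: "n > 0" using less.prems by (cases n) auto
    obtain p where p: "prime p" "p dvd n" using prime_factor_nat[OF False] by blast
    have p3: "p \<ge> 3"
    proof -
      have "p \<noteq> 2" using p(2) less.prems by auto
      then show ?thesis using prime_ge_2_nat[OF p(1)] by simp
    qed
    obtain k m where km: "n = p ^ k * m" "\<not> p dvd m" "k \<ge> 1" "m > 0" "m < n"
      using prime_factor_split[OF p n] .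
    have "odd m" using less.prems km(1) by simp
    then have m: "tsum m \<le> sqrt m" using less.IH km(5) by blast
    define s where "s = sqrt p"
    have s: "s \<ge> 17 / 10" "s\<^sup>2 = p" using sqrt_ge_17_10[OF p3] by (auto simp: s_def)
    \<comment> \<open>The claim \<open>2 - 1 / p \<le> sqrt p\<close> amounts to
      \<open>s^3 - 2 * s^2 + 1 \<ge> 0\<close>, whose left side factors as
      \<open>(s - 1) * (s^2 - s - 1)\<close>.\<close>
    have "s\<^sup>2 - s - 1 \<ge> 0"
    proof -
      have "s * (s - 1) \<ge> 17 / 10 * (7 / 10)" using s by (intro mult_mono) auto
      then show ?thesis by (simp add: power2_eq_square algebra_simps)
    qed
    then have "0 \<le> (s - 1) * (s\<^sup>2 - s - 1)" using s by simp
    then have "2 * s\<^sup>2 - 1 \<le> s * s\<^sup>2" by (simp add: power2_eq_square algebra_simps)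
    moreover have "s\<^sup>2 > 0" using s(1) by simp
    ultimately have "(2 * s\<^sup>2 - 1) / s\<^sup>2 \<le> s" by (simp only: pos_divide_le_eq)
    then have "2 - 1 / s\<^sup>2 \<le> s" using \<open>s\<^sup>2 > 0\<close> by (simp add: diff_divide_distrib)
    then have "1 + real 1 * (1 - 1 / real p) \<le> 1 * sqrt p ^ 1" unfolding s(2) s_def by simp
    then have "tsum (p ^ k * m) \<le> 1 * sqrt (real (p ^ k * m))"
      using m km p3 by (intro tsum_split_le[OF p(1), of _ _ 1]) auto
    then show ?thesis by (simp only: km(1)[symmetric] mult_1)
  qed simp
qed

text \<open>One prime factor \<open>p \<ge> 5\<close> already gives the gain, \<open>p = 5\<close>
  being tight with about 0.805. Otherwise \<open>n\<close> is a power of 3; the number 3 itself has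
  the ratio 0.962 and is the true exception.\<close>

lemma tsum_le_081_sqrt:
  assumes "odd n" "n \<noteq> 1" "n \<noteq> 3"
  shows "tsum n \<le> 81 / 100 * sqrt n"
proof -
  have n: "n > 0" using assms(1) by (cases n) auto
  show ?thesis
  proof (cases "\<exists>p. prime p \<and> p dvd n \<and> p \<ge> 5")
    case True
    then obtain p where p: "prime p" "p dvd n" "p \<ge> 5" by blast
    obtain k m where km: "n = p ^ k * m" "\<not> p dvd m" "k \<ge> 1" "m > 0" "m < n"
      using prime_factor_split[OF p(1,2) n] .
    have "odd m" using assms(1) km(1) by simp
    then have m: "tsum m \<le> sqrt m" by (rule tsum_le_sqrt)
    have "1 + real 1 * (1 - 1 / real p) \<le> 81 / 100 * sqrt p ^ 1"
    proof (cases "p = 5")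
      case True
      have "223 / 100 \<le> sqrt 5" by (intro real_le_rsqrt) (simp add: power2_eq_square)
      then show ?thesis by (simp add: True)
    next
      case False
      have "p \<noteq> 6" using p(1) by (auto simp: prime_nat_iff dest!: spec[of _ 2])
      then have "p \<ge> 7" using False p(3) by linarith
      then have "25 / 10 \<le> sqrt p" by (intro real_le_rsqrt) (simp add: power2_eq_square)
      moreover have "1 / real p \<ge> 0" by simp
      ultimately show ?thesis unfolding of_nat_1 power_one_right mult_1 by linarith
    qed
    then have "tsum (p ^ k * m) \<le> 81 / 100 * sqrt (real (p ^ k * m))"
      using m km p by (intro tsum_split_le[OF p(1), of _ _ 1]) auto
    then show ?thesis by (simp only: km(1)[symmetric] mult_1)
  next
    case False
    have three: "p = 3" if "prime p" "p dvd n" for p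
    proof -
      have "p < 5" using False that by (meson not_le)
      moreover have "p \<noteq> 2" "p \<noteq> 4" using that(2) assms(1) by auto
      ultimately show ?thesis using prime_ge_2_nat[OF that(1)] by linarith
    qed
    obtain p where p: "prime p" "p dvd n" using prime_factor_nat[OF assms(2)] by blast
    then have p3: "prime (3::nat)" "3 dvd n" using three by auto
    obtain k m where km: "n = 3 ^ k * m" "\<not> 3 dvd m" "k \<ge> 1" "m > 0" "m < n"
      using prime_factor_split[OF p3 n] .
    have m1: "m = 1"
    proof (rule ccontr)
      assume "m \<noteq> 1"
      then obtain r where r: "prime r" "r dvd m" using prime_factor_nat by blast
      then have "r = 3" using three[of r] km(1) by simp
      then show False using r km(2) by simp
    qed
    have "k \<noteq> 1" using assms(3) km(1) m1 by auto
    then have "k \<ge> 2" using km(3) by simp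
    \<comment> \<open>For powers of 3 the estimate starts at exponent 2, where it reads
      \<open>7 / 3 \<le> 81 / 100 * 3\<close>.\<close>
    then have "tsum (3 ^ k * m) \<le> 81 / 100 * sqrt (real (3 ^ k * m))"
      using m1 by (intro tsum_split_le[OF p3(1), of m "81 / 100" 2 k]) auto
    then show ?thesis by (simp only: km(1)[symmetric] mult_1)
  qed
qed

text \<open>The factor of \<open>gbound\<close> at the prime 2 when \<open>2 ^ j\<close> exactly
  divides the discriminant. The ratio of \<open>totient\<close> and \<open>estar\<close> at
  \<open>2 ^ i\<close> is 1 for \<open>i = 0\<close>, then 1/2 for \<open>i = 1\<close> and 1 for
  \<open>i \<ge> 2\<close>; the last case is admissible only for
  \<open>i \<le> j - 2\<close>.\<close>

definition tau :: "nat \<Rightarrow> real" where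
  "tau j = (if j < 2 then 1 else if j < 4 then 3 / 2 else j - 3 / 2)"

text \<open>Equality holds at \<open>j = 2\<close>. From \<open>j = 4\<close> on, the square of the
  left side at most doubles in each step.\<close>

lemma tau_le:
  assumes "j \<ge> 2"
  shows "tau j \<le> 3 / 4 * sqrt (2 ^ j)"
proof -
  consider "j = 2" | "j = 3" | "j \<ge> 4" using assms by linarith
  then show ?thesis
  proof cases
    case 1
    then show ?thesis by (simp add: tau_def)
  next
    case 2
    have "2 \<le> sqrt (8::real)" by (intro real_le_rsqrt) simp
    then show ?thesis using 2 by (simp add: tau_def)
  next
    case 3
    then have "(real j - 3 / 2)\<^sup>2 \<le> 9 / 16 * 2 ^ j"
    proof (induction j rule: dec_induct)
      case (step j)
      have "(real (Suc j) - 3 / 2)\<^sup>2 \<le> 2 * (real j - 3 / 2)\<^sup>2"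
      proof -
        have "0 \<le> (real j - 4) * (real j - 1)" using step(1) by simp
        then show ?thesis by (simp add: power2_eq_square algebra_simps)
      qed
      then show ?case using step by simp
    qed (simp add: power2_eq_square)
    then have "real j - 3 / 2 \<le> sqrt (9 / 16 * 2 ^ j)" by (rule real_le_rsqrt)
    also have "\<dots> = 3 / 4 * sqrt (2 ^ j)" by (simp add: real_sqrt_mult real_sqrt_divide)
    finally show ?thesis using 3 by (simp add: tau_def)
  qed
qed

lemma gbound_le:
  assumes D: "D = int (2 ^ j * n)" and n: "odd n"
  shows "gbound D \<le> tau j * tsum n"
proof -
  define w where "w = (\<lambda>e. real (totient e) / real (estar e))"
  \<comment> \<open>The exponents of 2 compatible with \<open>adm\<close>: a positive one needs
    \<open>j \<ge> 2\<close>, and one from 2 on needs \<open>i + 2 \<le> j\<close>.\<close>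
  define I where "I = (if j < 2 then {0} else {0, 1} \<union> {2..j - 2})"
  define c where "c = (\<lambda>i::nat. if i = 1 then 1 / 2 else 1 :: real)"
  have n0: "n > 0" using n by (cases n) auto
  have fin: "finite (I \<times> {d. d dvd n})" using n0 by (simp add: I_def)
  have sub: "adm D \<subseteq> (\<lambda>(i, d). 2 ^ i * d) ` (I \<times> {d. d dvd n})"
  proof
    fix e assume e: "e \<in> adm D"
    then have "e dvd 2 ^ j * n" unfolding adm_def D by (simp only: mem_Collect_eq int_dvd_int_iff)
    then obtain b d where bd: "e = b * d" "b dvd 2 ^ j" "d dvd n"
      using division_decomp[of e "2 ^ j" n] by blast
    then obtain i where i: "i \<le> j" "b = 2 ^ i" using divides_primepow_nat[OF two_is_prime_nat] by blast
    have "odd d" using n dvd_trans[OF _ bd(3), of 2] by blast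
    have "j \<ge> 2" if "i \<ge> 1"
    proof -
      have "even e" using that i bd(1) by simp
      then have "(4::int) dvd D" using e by (simp add: adm_def)
      then have "int (2 ^ 2) dvd int (2 ^ j * n)" by (simp add: D)
      then have "2 ^ 2 dvd 2 ^ j * n" by (simp only: int_dvd_int_iff)
      moreover have "coprime (2 ^ 2) n" unfolding coprime_power_left_iff using n by simp
      ultimately have "2 ^ 2 dvd (2::nat) ^ j" by (simp only: coprime_dvd_mult_left_iff)
      then show ?thesis by (simp only: power_dvd_imp_le[of 2 2 j])
    qed
    moreover have "i \<le> j - 2" if "i \<ge> 2"
    proof -
      have "4 dvd e" using le_imp_power_dvd[OF that, of "2::nat"] i bd(1) by simp
      then have "4 * int e dvd D" using e by (simp add: adm_def)
      then have "int (2 ^ (i + 2) * d) dvd int (2 ^ j * n)" by (simp add: D bd i mult_ac power_add)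
      then have "2 ^ (i + 2) * d dvd 2 ^ j * n" by (simp only: int_dvd_int_iff)
      then have "2 ^ (i + 2) dvd 2 ^ j * n" by (rule dvd_mult_left)
      moreover have "coprime (2 ^ (i + 2)) n" unfolding coprime_power_left_iff using n by simp
      ultimately have "2 ^ (i + 2) dvd (2::nat) ^ j" by (simp only: coprime_dvd_mult_left_iff)
      then have "i + 2 \<le> j" by (rule power_dvd_imp_le) simp
      then show ?thesis by simp
    qed
    ultimately have "i \<in> I" unfolding I_def by (cases "i = 0"; cases "i = 1") auto
    then show "e \<in> (\<lambda>(i, d). 2 ^ i * d) ` (I \<times> {d. d dvd n})"
      using bd i by (auto simp: image_iff)
  qed
  have val: "w (2 ^ i * d) = c i * (totient d / d)" if "d dvd n" for i d
  proof -
    have od: "odd d" using n dvd_trans[OF _ that, of 2] by blast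
    have tot: "totient (2 ^ i * d) = totient (2 ^ i) * totient d"
      using od by (intro totient_mult_coprime) simp
    consider "i = 0" | "i = 1" | k where "i = Suc (Suc k)" by (cases i; cases "i - 1") auto
    then show ?thesis
    proof cases
      case 1
      have "\<not> 4 dvd d" using od by auto
      then show ?thesis by (simp add: w_def c_def 1 estar_def)
    next
      case 2
      have "\<not> 4 dvd 2 * d" using od by auto
      moreover have "totient (2 * d) = totient d" using tot by (simp add: 2)
      ultimately show ?thesis by (simp add: w_def c_def 2 estar_def)
    next
      case 3
      have "totient (2 ^ i) = 2 ^ Suc k"
        unfolding 3 by (subst totient_prime_power_Suc) auto
      moreover have "estar (2 ^ i * d) = 2 ^ Suc k * d" by (simp add: estar_def 3)
      ultimately show ?thesis using tot by (simp add: w_def c_def 3)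
    qed
  qed
  have "gbound D \<le> sum w ((\<lambda>(i, d). 2 ^ i * d) ` (I \<times> {d. d dvd n}))"
    unfolding gbound_def w_def using sub fin by (intro sum_mono2) auto
  also have "\<dots> \<le> sum (w \<circ> (\<lambda>(i, d). 2 ^ i * d)) (I \<times> {d. d dvd n})"
    using fin by (intro sum_image_le) (auto simp: w_def)
  also have "\<dots> = (\<Sum>i\<in>I. \<Sum>d | d dvd n. w (2 ^ i * d))"
    by (simp add: sum.cartesian_product case_prod_unfold)
  also have "\<dots> = (\<Sum>i\<in>I. \<Sum>d | d dvd n. c i * (totient d / d))"
    using val by (intro sum.cong) auto
  also have "\<dots> = sum c I * tsum n"
    by (simp only: sum_product tsum_def)
  also have "sum c I = tau j"
  proof (cases "j < 4")
    case True
    then show ?thesis by (auto simp: I_def c_def tau_def)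
  next
    case False
    have "sum c {2..j - 2} = real (j - 3)"
      using False by (subst sum.cong[OF refl, of _ c "\<lambda>_. 1"]) (auto simp: c_def)
    moreover have "sum c ({0, 1} \<union> {2..j - 2}) = sum c {0, 1} + sum c {2..j - 2}"
      by (intro sum.union_disjoint) auto
    ultimately show ?thesis using False by (simp add: I_def tau_def c_def of_nat_diff)
  qed
  finally show ?thesis .
qed

lemma two_power_odd_decomp:
  fixes D :: int
  assumes "D > 0"
  obtains j n where "D = int (2 ^ j * n)" "odd n"
proof -
  have ex: "\<exists>j n. m = 2 ^ j * n \<and> odd n" if "m > 0" for m :: nat
    using that
  proof (induction m rule: less_induct)
    case (less m)
    show ?case
    proof (cases "odd m")
      case True
      then show ?thesis by (intro exI[of _ 0] exI[of _ m]) simp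
    next
      case False
      then obtain k where k: "m = 2 * k" by blast
      have "k < m" "k > 0" using less.prems k by simp_all
      then obtain j n where jn: "k = 2 ^ j * n" "odd n" using less.IH by blast
      have "m = 2 ^ Suc j * n" by (simp add: k jn(1))
      then show ?thesis using jn(2) by blast
    qed
  qed
  have "nat D > 0" using assms by simp
  from ex[OF this] obtain j n where jn: "nat D = 2 ^ j * n" "odd n" by blast
  have "D = int (nat D)" using assms by simp
  then have "D = int (2 ^ j * n)" unfolding jn(1) .
  then show thesis using jn(2) by (rule that)
qed

text \<open>An odd \<open>D\<close> is covered by the estimate 0.81 for odd numbers. Otherwise 4
  divides \<open>D\<close>, and the powers of 2 alone push the ratio down to 3/4.\<close>

lemma gbound_general:
  fixes D :: int
  assumes "D > 0" "D mod 4 = 0 \<or> D mod 4 = 3" "D \<noteq> 3"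
  shows "gbound D \<le> 81 / 100 * sqrt D"
proof -
  obtain j n where jn: "D = int (2 ^ j * n)" "odd n" using two_power_odd_decomp[OF assms(1)] .
  have sq: "sqrt D = sqrt (2 ^ j) * sqrt n" by (simp add: jn(1) real_sqrt_mult)
  have g: "gbound D \<le> tau j * tsum n" by (rule gbound_le[OF jn])
  show ?thesis
  proof (cases "j = 0")
    case True
    then have "n \<noteq> 1" "n \<noteq> 3" using assms(2,3) jn(1) by auto
    then have "tsum n \<le> 81 / 100 * sqrt n" by (rule tsum_le_081_sqrt[OF jn(2)])
    then show ?thesis using g sq True by (simp add: tau_def)
  next
    case False
    have "j \<noteq> 1"
    proof
      assume "j = 1"
      then have "D = 2 * int n" using jn(1) by simp
      moreover have "odd (int n)" using jn(2) by simp
      ultimately show False using assms(2) by presburger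
    qed
    then have "tau j * tsum n \<le> 3 / 4 * sqrt (2 ^ j) * sqrt n"
      using False tsum_le_sqrt[OF jn(2)] tsum_nonneg tau_le[of j] by (intro mult_mono) auto
    also have "\<dots> \<le> 81 / 100 * sqrt D" unfolding sq by simp
    finally show ?thesis using g by simp
  qed
qed

text \<open>For odd \<open>D\<close> the ratio is at most 3/2 * 0.81 / 2 = 0.6075; the exceptional
  odd numbers 1 and 3 are excluded since \<open>D\<close> is not -1 and since -3 is 1 modulo 4. For
  even \<open>D\<close>, squarefreeness leaves exactly \<open>2 ^ 3\<close> in the discriminant, and
  the ratio is at most \<open>3 / (2 * sqrt 8)\<close>, about 0.53.\<close>

lemma gbound_squarefree:
  fixes D :: int
  assumes "D < 0" "squarefree D" "D mod 4 \<noteq> 1" "D \<noteq> -1"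
  shows "gbound (- 4 * D) \<le> 61 / 100 * sqrt (- 4 * D)"
proof -
  have D4: "D mod 4 \<noteq> 0"
  proof
    assume "D mod 4 = 0"
    then have "2\<^sup>2 dvd D" by (simp add: dvd_eq_mod_eq_0)
    then show False using assms(2) unfolding squarefree_def by (metis odd_one)
  qed
  show ?thesis
  proof (cases "odd D")
    case True
    define n where "n = nat (- D)"
    have n: "D = - int n" "odd n" using assms(1) True by (auto simp: n_def even_nat_iff)
    have "n \<noteq> 1" "n \<noteq> 3" using assms(3,4) n(1) by auto
    then have t: "tsum n \<le> 81 / 100 * sqrt n" by (rule tsum_le_081_sqrt[OF n(2)])
    have "gbound (- 4 * D) \<le> tau 2 * tsum n" by (rule gbound_le) (use n in auto)
    also have "\<dots> = 3 / 2 * tsum n" by (simp add: tau_def)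
    also have "\<dots> \<le> 61 / 100 * (2 * sqrt n)"
    proof -
      have "0 \<le> sqrt (real n)" by simp
      then show ?thesis using t by linarith
    qed
    also have "2 * sqrt n = sqrt (- 4 * D)" by (simp add: n(1) real_sqrt_mult)
    finally show ?thesis by simp
  next
    case False
    define n where "n = nat (- (D div 2))"
    have "D = 2 * (D div 2)" "odd (D div 2)" using False D4 by presburger+
    then have n: "D = - (2 * int n)" "odd n" using assms(1) by (auto simp: n_def even_nat_iff)
    have "gbound (- 4 * D) \<le> tau 3 * tsum n" by (rule gbound_le) (use n in auto)
    also have "\<dots> \<le> 3 / 2 * sqrt n" using tsum_le_sqrt[OF n(2)] by (simp add: tau_def)
    also have "\<dots> \<le> 61 / 100 * (sqrt 8 * sqrt n)"
    proof -
      have "28 / 10 \<le> sqrt (8::real)" by (intro real_le_rsqrt) (simp add: power2_eq_square)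
      then have "3 / 2 \<le> 61 / 100 * sqrt (8::real)" by simp
      then have "3 / 2 * sqrt n \<le> 61 / 100 * sqrt 8 * sqrt n" by (intro mult_right_mono) auto
      then show ?thesis by simp
    qed
    also have "sqrt 8 * sqrt n = sqrt (- 4 * D)" by (simp add: n(1) flip: real_sqrt_mult)
    finally show ?thesis by simp
  qed
qed

section \<open>Comparison of normalised energies\<close>

text \<open>Scaling by \<open>2 / sqrt D\<close> turns a form of discriminant \<open>-D\<close> into that of a lattice of covolume 1.\<close>

definition form_energy :: "int \<Rightarrow> int \<Rightarrow> int \<Rightarrow> real \<Rightarrow> nat" where
  "form_energy a b c N = card (energy_pairs a b c (N * sqrt (real_of_int (disc a b c)) / 2))"

text \<open>Equal to 6, as \<open>quarter_disc\<close> is pi/4. The energy grows like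
  \<open>lead_const * g * N * ln N\<close>, where \<open>g\<close> is the mean defect divided by the
  square root of the discriminant.\<close>

definition lead_const :: real where
  "lead_const = 96 * quarter_disc\<^sup>2 / pi\<^sup>2"

lemma lead_const_pos: "lead_const > 0"
  using quarter_disc_pos by (simp add: lead_const_def)

text \<open>Normalising the covolume turns \<open>qdens a b c * X\<close> into
  \<open>4 * quarter_disc * N\<close>, the same for all forms; the form survives only in
  \<open>wsum\<close>.\<close>

lemma form_energy_estimate:
  assumes pd: "posdef a b c"
  defines "s \<equiv> sqrt (real_of_int (disc a b c))"
  obtains K where "\<And>N. N \<ge> 2 / s \<Longrightarrow>
    \<bar>2 * real (form_energy a b c N) - 4 * quarter_disc * N * wsum a b c (2 * s * N)\<bar> \<le> K * N"
proof -
  have s: "s > 0" using pd unfolding s_def posdef_def by (simp flip: of_int_power of_int_mult of_int_diff)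
  obtain K where K: "\<And>X. X \<ge> 1 \<Longrightarrow>
    \<bar>2 * real (card (energy_pairs a b c X)) - qdens a b c * X * wsum a b c (4 * X)\<bar> \<le> K * X"
    using energy_asymptotic[OF pd] by blast
  show thesis
  proof (rule that[of "K * s / 2"])
    fix N assume N: "N \<ge> 2 / s"
    then have X: "N * s / 2 \<ge> 1" using s by (simp add: pos_divide_le_eq)
    have "qdens a b c = 8 * quarter_disc / s" unfolding qdens_def s_def ..
    then have 1: "qdens a b c * (N * s / 2) = 4 * quarter_disc * N" using s by simp
    have 2: "4 * (N * s / 2) = 2 * s * N" "K * (N * s / 2) = K * s / 2 * N" by simp_all
    have 3: "form_energy a b c N = card (energy_pairs a b c (N * s / 2))"
      unfolding form_energy_def s_def ..
    show "\<bar>2 * real (form_energy a b c N) - 4 * quarter_disc * N * wsum a b c (2 * s * N)\<bar> \<le> K * s / 2 * N"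
      using K[OF X] unfolding 1 2 3 .
  qed
qed

lemma pdens_lead:
  "2 * quarter_disc * pdens a b c = lead_const / sqrt (real_of_int (disc a b c))"
  by (simp add: pdens_def qdens_def lead_const_def power2_eq_square)

lemma form_energy_upper:
  assumes pd: "posdef a b c" and prim: "primitive_form a b c"
    and g: "gbound (disc a b c) \<le> g * sqrt (real_of_int (disc a b c))"
  obtains K where "\<forall>\<^sub>F N in at_top. real (form_energy a b c N) \<le> lead_const * g * N * ln N + K * N"
proof -
  define s where "s = sqrt (real_of_int (disc a b c))"
  have s: "s > 0" using pd unfolding s_def posdef_def by (simp flip: of_int_power of_int_mult of_int_diff)
  obtain K1 where K1: "\<And>N. N \<ge> 2 / s \<Longrightarrow>
    \<bar>2 * real (form_energy a b c N) - 4 * quarter_disc * N * wsum a b c (2 * s * N)\<bar> \<le> K1 * N"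
    using form_energy_estimate[OF pd] unfolding s_def by blast
  obtain K2 where K2: "\<And>T. T \<ge> 1 \<Longrightarrow> wsum a b c T \<le> gbound (disc a b c) * pdens a b c * ln T + K2"
    using wsum_upper[OF pd prim] by blast
  define q where "q = quarter_disc"
  have q: "q > 0" using quarter_disc_pos by (simp add: q_def)
  have gp: "2 * q * (gbound (disc a b c) * pdens a b c) \<le> lead_const * g"
  proof -
    have "2 * q * pdens a b c = lead_const / s" unfolding q_def s_def by (rule pdens_lead)
    then have "2 * q * (gbound (disc a b c) * pdens a b c) = gbound (disc a b c) * (lead_const / s)"
      by (metis mult.assoc mult.commute)
    also have "\<dots> \<le> g * s * (lead_const / s)"
      using g s lead_const_pos unfolding s_def[symmetric] by (intro mult_right_mono) auto
    finally show ?thesis using s by (simp add: mult.commute)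
  qed
  show thesis
  proof (rule that[of "lead_const * g * ln (2 * s) + 2 * q * K2 + K1 / 2"], rule eventually_mono)
    show "\<forall>\<^sub>F N in at_top. N \<ge> 2 / s \<and> N \<ge> 1" by (intro eventually_conj eventually_ge_at_top)
    fix N assume N: "N \<ge> 2 / s \<and> N \<ge> 1"
    then have "4 \<le> 2 * s * N" using s by (simp add: pos_divide_le_eq mult_ac)
    then have T: "2 * s * N \<ge> 1" by linarith
    have lnT: "ln (2 * s * N) = ln (2 * s) + ln N" using s N by (simp add: ln_mult)
    have "2 * q * wsum a b c (2 * s * N) \<le> 2 * q * (gbound (disc a b c) * pdens a b c * ln (2 * s * N) + K2)"
      using K2[OF T] q by (intro mult_left_mono) auto
    also have "\<dots> = 2 * q * (gbound (disc a b c) * pdens a b c) * ln (2 * s * N) + 2 * q * K2"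
      by (simp add: algebra_simps)
    also have "\<dots> \<le> lead_const * g * ln (2 * s * N) + 2 * q * K2"
      using gp T by (intro add_right_mono mult_right_mono) auto
    finally have "N * (2 * q * wsum a b c (2 * s * N)) \<le> N * (lead_const * g * ln (2 * s * N) + 2 * q * K2)"
      using N by (intro mult_left_mono) auto
    moreover have "2 * real (form_energy a b c N) \<le> 2 * (N * (2 * q * wsum a b c (2 * s * N))) + K1 * N"
      using K1[of N] N unfolding q_def[symmetric] by (simp add: mult_ac)
    moreover have "N * (lead_const * g * ln (2 * s * N) + 2 * q * K2) + K1 / 2 * N
        = lead_const * g * N * ln N + (lead_const * g * ln (2 * s) + 2 * q * K2 + K1 / 2) * N"
      unfolding lnT by (simp add: algebra_simps)
    ultimately show "real (form_energy a b c N)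
        \<le> lead_const * g * N * ln N + (lead_const * g * ln (2 * s) + 2 * q * K2 + K1 / 2) * N"
      by linarith
  qed
qed

lemma form_energy_lower:
  assumes pd: "posdef a b c"
    and w: "\<And>T. T \<ge> T0 \<Longrightarrow> r * pdens a b c * ln T - K0 \<le> wsum a b c T"
  obtains K where "\<forall>\<^sub>F N in at_top.
    lead_const * (r / sqrt (real_of_int (disc a b c))) * N * ln N - K * N \<le> real (form_energy a b c N)"
proof -
  define s where "s = sqrt (real_of_int (disc a b c))"
  have s: "s > 0" using pd unfolding s_def posdef_def by (simp flip: of_int_power of_int_mult of_int_diff)
  obtain K1 where K1: "\<And>N. N \<ge> 2 / s \<Longrightarrow>
    \<bar>2 * real (form_energy a b c N) - 4 * quarter_disc * N * wsum a b c (2 * s * N)\<bar> \<le> K1 * N"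
    using form_energy_estimate[OF pd] unfolding s_def by blast
  define q where "q = quarter_disc"
  have q: "q > 0" using quarter_disc_pos by (simp add: q_def)
  have gp: "2 * q * pdens a b c = lead_const / s" unfolding q_def s_def by (rule pdens_lead)
  define l where "l = lead_const * (r / s)"
  show thesis
  proof (rule that[of "2 * q * K0 + K1 / 2 - l * ln (2 * s)"], rule eventually_mono)
    show "\<forall>\<^sub>F N in at_top. N \<ge> 2 / s \<and> N \<ge> 1 \<and> N \<ge> T0 / (2 * s)"
      by (intro eventually_conj eventually_ge_at_top)
    fix N assume N: "N \<ge> 2 / s \<and> N \<ge> 1 \<and> N \<ge> T0 / (2 * s)"
    then have T: "2 * s * N \<ge> T0" using s by (simp add: pos_divide_le_eq mult_ac)
    have lnT: "ln (2 * s * N) = ln (2 * s) + ln N" using s N by (simp add: ln_mult)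
    have "2 * q * (r * pdens a b c * ln (2 * s * N) - K0) \<le> 2 * q * wsum a b c (2 * s * N)"
      using w[OF T] q by (intro mult_left_mono) auto
    moreover have "2 * q * (r * pdens a b c * ln (2 * s * N) - K0)
        = 2 * q * pdens a b c * (r * ln (2 * s * N)) - 2 * q * K0" by (simp add: algebra_simps)
    moreover have "\<dots> = l * ln (2 * s * N) - 2 * q * K0" unfolding gp l_def by simp
    ultimately have "l * ln (2 * s * N) - 2 * q * K0 \<le> 2 * q * wsum a b c (2 * s * N)" by simp
    then have "N * (l * ln (2 * s * N) - 2 * q * K0) \<le> N * (2 * q * wsum a b c (2 * s * N))"
      using N by (intro mult_left_mono) auto
    moreover have "2 * (N * (2 * q * wsum a b c (2 * s * N))) - K1 * N \<le> 2 * real (form_energy a b c N)"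
      using K1[of N] N unfolding q_def[symmetric] by (simp add: mult_ac)
    moreover have "N * (l * ln (2 * s * N) - 2 * q * K0) - K1 / 2 * N
        = l * N * ln N - (2 * q * K0 + K1 / 2 - l * ln (2 * s)) * N"
      unfolding lnT by (simp add: algebra_simps)
    ultimately have "l * N * ln N - (2 * q * K0 + K1 / 2 - l * ln (2 * s)) * N \<le> real (form_energy a b c N)"
      by linarith
    then show "lead_const * (r / sqrt (real_of_int (disc a b c))) * N * ln N
        - (2 * q * K0 + K1 / 2 - l * ln (2 * s)) * N \<le> real (form_energy a b c N)"
      by (simp add: l_def s_def)
  qed
qed

text \<open>Any gap between the coefficients of \<open>N * ln N\<close> eventually outweighs the
  linear errors.\<close>

lemma eventually_less_of_NlnN:
  fixes E F :: "real \<Rightarrow> nat"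
  assumes E: "\<forall>\<^sub>F N in at_top. real (E N) \<le> lead_const * g * N * ln N + K1 * N"
    and F: "\<forall>\<^sub>F N in at_top. lead_const * h * N * ln N - K2 * N \<le> real (F N)"
    and "g < h"
  shows "\<forall>\<^sub>F N in at_top. E N < F N"
proof -
  define d where "d = lead_const * (h - g)"
  have d: "d > 0" using assms(3) lead_const_pos by (simp add: d_def)
  have "\<forall>\<^sub>F N::real in at_top. ln N > (K1 + K2) / d"
    using ln_at_top by (simp add: filterlim_at_top_dense)
  with E F eventually_gt_at_top[of 0] show ?thesis
  proof eventually_elim
    case (elim N)
    have "K1 + K2 < d * ln N" using elim(4) d by (simp add: pos_divide_less_eq mult.commute)
    then have "(K1 + K2) * N < d * ln N * N" using elim(3) by (intro mult_strict_right_mono) auto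
    moreover have "d * ln N * N = lead_const * h * N * ln N - lead_const * g * N * ln N"
      by (simp add: d_def algebra_simps)
    ultimately have "real (E N) < real (F N)" using elim(1,2) by (simp add: algebra_simps)
    then show ?case by simp
  qed
qed

lemma eisenstein_energy_lower:
  obtains K where "\<forall>\<^sub>F N in at_top. lead_const * (sqrt 3 / 2) * N * ln N - K * N \<le> real (form_energy 1 1 1 N)"
proof -
  obtain K0 where "\<And>T. T \<ge> 3 \<Longrightarrow> 3 / 2 * pdens 1 1 1 * ln T - K0 \<le> wsum 1 1 1 T"
    using wsum_lower_eisenstein by blast
  then obtain K where K: "\<forall>\<^sub>F N in at_top. lead_const * (3 / 2 / sqrt (real_of_int (4 * 1 * 1 - 1\<^sup>2))) * N * ln N
      - K * N \<le> real (form_energy 1 1 1 N)"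
    using form_energy_lower[of 1 1 1 3 "3 / 2" K0] by (auto simp: posdef_def)
  have eq: "3 / 2 / sqrt (real_of_int (4 * 1 * 1 - 1\<^sup>2)) = sqrt 3 / 2"
    by (simp add: real_div_sqrt divide_simps)
  show thesis using K unfolding eq by (rule that)
qed

lemma gauss_energy_lower:
  obtains K where "\<forall>\<^sub>F N in at_top. lead_const * (2 / 3) * N * ln N - K * N \<le> real (form_energy 1 0 1 N)"
proof -
  obtain K0 where "\<And>T. T \<ge> 2 \<Longrightarrow> 4 / 3 * pdens 1 0 1 * ln T - K0 \<le> wsum 1 0 1 T"
    using wsum_lower_gauss by blast
  then obtain K where K: "\<forall>\<^sub>F N in at_top. lead_const * (4 / 3 / sqrt (real_of_int (4 * 1 * 1 - 0\<^sup>2))) * N * ln N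
      - K * N \<le> real (form_energy 1 0 1 N)"
    using form_energy_lower[of 1 0 1 2 "4 / 3" K0] by (auto simp: posdef_def)
  have eq: "4 / 3 / sqrt (real_of_int (4 * 1 * 1 - 0\<^sup>2)) = 2 / 3" by simp
  show thesis using K unfolding eq by (rule that)
qed

lemma sqrt_3_half: "81 / 100 < sqrt 3 / 2"
proof -
  have "163 / 100 < sqrt (3::real)" by (intro real_less_rsqrt) (simp add: power2_eq_square)
  then show ?thesis by simp
qed

lemma form_energy_less_eisenstein:
  assumes pd: "posdef a b c" and prim: "primitive_form a b c" and "disc a b c \<noteq> 3"
  shows "\<forall>\<^sub>F N in at_top. form_energy a b c N < form_energy 1 1 1 N"
proof -
  have "(disc a b c) mod 4 = 0 \<or> (disc a b c) mod 4 = 3"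
  proof (cases "even b")
    case True
    then obtain k where "b = 2 * k" by blast
    then have "disc a b c = 4 * (a * c - k\<^sup>2)" by (simp add: power2_eq_square algebra_simps)
    then show ?thesis by simp
  next
    case False
    then obtain k where "b = 2 * k + 1" by (elim oddE)
    then have "disc a b c = 4 * (a * c - k\<^sup>2 - k - 1) + 3" by (simp add: power2_eq_square algebra_simps)
    then show ?thesis by presburger
  qed
  then have "gbound (disc a b c) \<le> 81 / 100 * sqrt (real_of_int (disc a b c))"
    using pd assms(3) by (intro gbound_general) (auto simp: posdef_def)
  then obtain K1 where K1: "\<forall>\<^sub>F N in at_top. real (form_energy a b c N) \<le> lead_const * (81 / 100) * N * ln N + K1 * N"
    using form_energy_upper[OF pd prim] by blast
  obtain K2 where K2: "\<forall>\<^sub>F N in at_top. lead_const * (sqrt 3 / 2) * N * ln N - K2 * N \<le> real (form_energy 1 1 1 N)"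
    using eisenstein_energy_lower by blast
  show ?thesis by (rule eventually_less_of_NlnN[OF K1 K2 sqrt_3_half])
qed

lemma linear_less_eisenstein:
  assumes "\<forall>\<^sub>F N in at_top. real (E N) \<le> K * N"
  shows "\<forall>\<^sub>F N in at_top. E N < form_energy 1 1 1 N"
proof -
  obtain K2 where K2: "\<forall>\<^sub>F N in at_top. lead_const * (sqrt 3 / 2) * N * ln N - K2 * N \<le> real (form_energy 1 1 1 N)"
    using eisenstein_energy_lower by blast
  have "\<forall>\<^sub>F N in at_top. real (E N) \<le> lead_const * 0 * N * ln N + K * N" using assms by simp
  from eventually_less_of_NlnN[OF this K2] show ?thesis by simp
qed

lemma form_energy_less_gauss:
  assumes "D < 0" "squarefree D" "D mod 4 \<noteq> 1" "D \<noteq> -1"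
  shows "\<forall>\<^sub>F N in at_top. form_energy 1 0 (- D) N < form_energy 1 0 1 N"
proof -
  have pd: "posdef 1 0 (- D)" using assms(1) by (simp add: posdef_def)
  have prim: "primitive_form 1 0 (- D)" by (simp add: primitive_form_def)
  have "gbound (4 * 1 * (- D) - 0\<^sup>2) \<le> 61 / 100 * sqrt (real_of_int (4 * 1 * (- D) - 0\<^sup>2))"
    using gbound_squarefree[OF assms] by simp
  then obtain K1 where K1: "\<forall>\<^sub>F N in at_top. real (form_energy 1 0 (- D) N) \<le> lead_const * (61 / 100) * N * ln N + K1 * N"
    using form_energy_upper[OF pd prim] by blast
  obtain K2 where K2: "\<forall>\<^sub>F N in at_top. lead_const * (2 / 3) * N * ln N - K2 * N \<le> real (form_energy 1 0 1 N)"
    using gauss_energy_lower by blast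
  show ?thesis by (rule eventually_less_of_NlnN[OF K1 K2]) simp
qed

section \<open>Norm forms and planar lattices\<close>

lemma Q_form_eq_qf:
  assumes "D < 0"
  obtains b c where "posdef 1 b c" "primitive_form 1 b c" "4 * 1 * c - b\<^sup>2 = (if D mod 4 = 1 then - D else - 4 * D)"
    "\<And>x y. Q_form D x y = qf 1 b c (x, y)"
proof -
  define b where "b = (if D mod 4 = 1 then 1 else 0 :: int)"
  define c where "c = (if D mod 4 = 1 then (1 - D) div 4 else - D)"
  have disc: "4 * 1 * c - b\<^sup>2 = (if D mod 4 = 1 then - D else - 4 * D)"
  proof (cases "D mod 4 = 1")
    case True
    then have "4 * ((1 - D) div 4) = 1 - D" by presburger
    then show ?thesis using True by (simp add: b_def c_def)
  qed (simp add: b_def c_def)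
  have "posdef 1 b c" using assms disc by (simp add: posdef_def split: if_splits)
  moreover have "primitive_form 1 b c" by (simp add: primitive_form_def)
  moreover have "Q_form D x y = qf 1 b c (x, y)" for x y
    by (simp add: Q_form_def qf_def b_def c_def)
  ultimately show thesis using disc by (intro that[of b c])
qed

lemma card_energy_pairs_levels:
  assumes pd: "posdef a b c"
  shows "card (energy_pairs a b c X)
    = (\<Sum>n | real n \<le> X. (card {v. qf a b c v = int n})\<^sup>2)"
proof -
  define I where "I = {n. real n \<le> X}"
  have "I \<subseteq> {..nat \<lfloor>X\<rfloor>}" unfolding I_def by (auto simp: le_nat_floor)
  then have finI: "finite I" using finite_subset by blast
  define R where "R = (\<lambda>n::nat. {v. qf a b c v = int n})"
  have finR: "finite (R n)" for n
  proof (rule finite_subset[OF _ finite_ball[OF pd, of "real n"]])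
    show "R n \<subseteq> {p. real_of_int (qf a b c p) \<le> real n}" by (auto simp: R_def)
  qed
  have "energy_pairs a b c X = (\<Union>n\<in>I. R n \<times> R n)"
  proof (intro equalityI subsetI)
    fix w assume "w \<in> energy_pairs a b c X"
    then obtain p q where w: "w = (p, q)" "qf a b c p = qf a b c q" "real_of_int (qf a b c q) \<le> X"
      by (auto simp: energy_pairs_def)
    have "int (nat (qf a b c q)) = qf a b c q" using qf_nonneg[OF pd] by simp
    then have "w \<in> R (nat (qf a b c q)) \<times> R (nat (qf a b c q))" "nat (qf a b c q) \<in> I"
      using w qf_nonneg[OF pd, of q] by (auto simp: R_def I_def)
    then show "w \<in> (\<Union>n\<in>I. R n \<times> R n)" by blast
  qed (auto simp: energy_pairs_def R_def I_def)
  also have "card \<dots> = (\<Sum>n\<in>I. card (R n \<times> R n))"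
    using finI finR by (intro card_UN_disjoint) (auto simp: R_def)
  finally show ?thesis by (simp add: I_def R_def card_cartesian_product power2_eq_square)
qed

text \<open>In both congruence classes the square of \<open>S_scale D\<close> is 2 divided by the
  square root of the discriminant \<open>4 * c - b^2\<close>.\<close>

lemma energy2_eq_form_energy:
  assumes "D < 0" "4 * 1 * c - b\<^sup>2 = (if D mod 4 = 1 then - D else - 4 * D)" "posdef 1 b c"
    and Q: "\<And>x y. Q_form D x y = qf 1 b c (x, y)"
  shows "energy2 D N = form_energy 1 b c N"
proof -
  define d where "d = - real_of_int D"
  have d: "d > 0" using assms(1) by (simp add: d_def)
  have "(d powr (- 1 / 4))\<^sup>2 = d powr (- 1 / 4 * 2)"
    using d by (simp add: power2_eq_square flip: powr_add)
  also have "d powr (- 1 / 4 * 2) = 1 / sqrt d"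
    using d powr_minus_divide[of d "1 / 2"] by (simp add: powr_half_sqrt)
  finally have p: "(d powr (- 1 / 4))\<^sup>2 = 1 / sqrt d" .
  have "N / (S_scale D)\<^sup>2 = N * sqrt (real_of_int (4 * 1 * c - b\<^sup>2)) / 2"
  proof (cases "D mod 4 = 1")
    case True
    have S: "(S_scale D)\<^sup>2 = 2 * (1 / sqrt d)"
      unfolding S_scale_def d_def[symmetric] using True p by (simp add: power_mult_distrib)
    have e: "real_of_int (- D) = d" by (simp add: d_def)
    show ?thesis unfolding assms(2) if_P[OF True] S e by simp
  next
    case False
    have S: "(S_scale D)\<^sup>2 = 1 / sqrt d"
      unfolding S_scale_def d_def[symmetric] using False p by simp
    have e: "real_of_int (- 4 * D) = 4 * d" by (simp add: d_def)
    show ?thesis unfolding assms(2) if_not_P[OF False] S e by (simp add: real_sqrt_mult)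
  qed
  moreover have "rep_count D n = card {v. qf 1 b c v = int n}" for n
    unfolding rep_count_def Q by (rule arg_cong[where f = card]) auto
  ultimately show ?thesis
    unfolding energy2_def form_energy_def card_energy_pairs_levels[OF assms(3)] by (simp only:)
qed

lemma energy2_less_eisenstein:
  assumes "D < 0" "D mod 4 = 1" "D \<noteq> -3"
  shows "\<forall>\<^sub>F N in at_top. energy2 D N < energy2 (-3) N"
proof -
  obtain b c where bc: "posdef 1 b c" "primitive_form 1 b c"
    "4 * 1 * c - b\<^sup>2 = (if D mod 4 = 1 then - D else - 4 * D)" "\<And>x y. Q_form D x y = qf 1 b c (x, y)"
    using Q_form_eq_qf[OF assms(1)] by metis
  have "energy2 D N = form_energy 1 b c N" for N
    by (rule energy2_eq_form_energy[OF assms(1) bc(3,1,4)])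
  moreover have "energy2 (-3) N = form_energy 1 1 1 N" for N
    by (rule energy2_eq_form_energy) (auto simp: posdef_def Q_form_def qf_def)
  moreover have "4 * 1 * c - b\<^sup>2 \<noteq> 3" using bc(3) assms(2,3) by simp
  ultimately show ?thesis using form_energy_less_eisenstein[OF bc(1,2)] by simp
qed

lemma energy2_less_gauss:
  assumes "D < 0" "squarefree D" "D mod 4 \<noteq> 1" "D \<noteq> -1"
  shows "\<forall>\<^sub>F N in at_top. energy2 D N < energy2 (-1) N"
proof -
  have "energy2 D N = form_energy 1 0 (- D) N" for N
    using assms by (intro energy2_eq_form_energy) (auto simp: posdef_def Q_form_def qf_def)
  moreover have "energy2 (-1) N = form_energy 1 0 1 N" for N
    by (rule energy2_eq_form_energy) (auto simp: posdef_def Q_form_def qf_def)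
  ultimately show ?thesis using form_energy_less_gauss[OF assms] by simp
qed

section \<open>Lattices whose Gram matrix is a multiple of an integral form\<close>

definition lattice_point :: "real^2 \<Rightarrow> real^2 \<Rightarrow> int \<times> int \<Rightarrow> real^2" where
  "lattice_point u v w = of_int (fst w) *\<^sub>R u + of_int (snd w) *\<^sub>R v"

lemma lattice_of_eq_range: "lattice_of u v = range (lattice_point u v)"
proof (intro equalityI subsetI)
  fix x assume "x \<in> lattice_of u v"
  then obtain m n where "x = of_int m *\<^sub>R u + of_int n *\<^sub>R v" unfolding lattice_of_def by blast
  then have "x = lattice_point u v (m, n)" by (simp add: lattice_point_def)
  then show "x \<in> range (lattice_point u v)" by (rule range_eqI)
qed (auto simp: lattice_of_def lattice_point_def)

lemma inj_lattice_point:
  assumes "det (vector [u, v] :: real^2^2) \<noteq> 0"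
  shows "inj (lattice_point u v)"
proof (rule injI)
  fix w z assume eq: "lattice_point u v w = lattice_point u v z"
  define x y where "x = real_of_int (fst w - fst z)" and "y = real_of_int (snd w - snd z)"
  have 1: "x * u $ i + y * v $ i = 0" for i
    using arg_cong[OF eq, of "\<lambda>p. p $ i"] by (simp add: lattice_point_def x_def y_def algebra_simps)
  define d where "d = u $ 1 * v $ 2 - u $ 2 * v $ 1"
  have d: "d \<noteq> 0" using assms by (simp add: det_2 d_def mult.commute)
  have "x * d = (x * u $ 1 + y * v $ 1) * v $ 2 - (x * u $ 2 + y * v $ 2) * v $ 1"
    "y * d = (x * u $ 2 + y * v $ 2) * u $ 1 - (x * u $ 1 + y * v $ 1) * u $ 2"
    by (simp_all add: d_def algebra_simps)
  then have "x = 0" "y = 0" using d unfolding 1 by simp_all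
  then show "w = z" by (simp add: x_def y_def prod_eq_iff)
qed

lemma det_vector_2: "det (vector [u, v] :: real^2^2) = u $ 1 * v $ 2 - u $ 2 * v $ 1"
  by (simp add: det_2 mult.commute)

lemma inner_vec_2: "(x :: real^2) \<bullet> y = x $ 1 * y $ 1 + x $ 2 * y $ 2"
  by (simp add: inner_vec_def sum_2)

lemma gram_det:
  "(u \<bullet> u) * (v \<bullet> v) - (u \<bullet> v)\<^sup>2 = (det (vector [u, v] :: real^2^2))\<^sup>2"
  unfolding det_vector_2 inner_vec_2 by (simp add: power2_eq_square algebra_simps)

lemma lattice_energy2_eq_card:
  assumes "det (vector [u, v] :: real^2^2) \<noteq> 0"
  shows "lattice_energy2 (lattice_of u v) N
    = card {(p, q). (norm (lattice_point u v p))\<^sup>2 = (norm (lattice_point u v q))\<^sup>2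
        \<and> (norm (lattice_point u v q))\<^sup>2 \<le> N}"
proof -
  define f where "f = lattice_point u v"
  have f: "inj f" unfolding f_def by (rule inj_lattice_point[OF assms])
  have "{(p1, p2). p1 \<in> lattice_of u v \<and> p2 \<in> lattice_of u v \<and> (norm p1)\<^sup>2 = (norm p2)\<^sup>2 \<and> (norm p2)\<^sup>2 \<le> N}
      = map_prod f f ` {(p, q). (norm (f p))\<^sup>2 = (norm (f q))\<^sup>2 \<and> (norm (f q))\<^sup>2 \<le> N}"
    unfolding lattice_of_eq_range f_def[symmetric] by (auto simp: image_iff)
  then show ?thesis unfolding lattice_energy2_def f_def[symmetric]
    using prod.inj_map[OF f f] by (simp add: card_image inj_on_subset)
qed

lemma norm_lattice_point:
  "(norm (lattice_point u v w))\<^sup>2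
    = (u \<bullet> u) * (fst w)\<^sup>2 + 2 * (u \<bullet> v) * fst w * snd w + (v \<bullet> v) * (snd w)\<^sup>2"
  unfolding lattice_point_def power2_norm_eq_inner
  by (simp add: inner_add_left inner_add_right inner_commute[of v u] power2_eq_square algebra_simps)

text \<open>The factor 2 at the mixed product admits odd \<open>b\<close>, so that squared lengths
  are \<open>l\<close> times the values of an arbitrary integral form.\<close>

definition has_gram :: "real^2 \<Rightarrow> real^2 \<Rightarrow> real \<Rightarrow> int \<Rightarrow> int \<Rightarrow> int \<Rightarrow> bool" where
  "has_gram u v l a b c \<longleftrightarrow> u \<bullet> u = l * a \<and> 2 * (u \<bullet> v) = l * b \<and> v \<bullet> v = l * c"

lemma has_gram_norm:
  assumes "has_gram u v l a b c"
  shows "(norm (lattice_point u v w))\<^sup>2 = l * qf a b c w"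
  using assms unfolding norm_lattice_point has_gram_def qf_def
  by (simp add: algebra_simps)

text \<open>Covolume 1 makes the Gram determinant equal to 1, so \<open>l^2\<close> times the
  discriminant is 4.\<close>

lemma has_gram_scale:
  assumes g: "has_gram u v l a b c" and l: "l > 0" and det: "\<bar>det (vector [u, v] :: real^2^2)\<bar> = 1"
  shows "posdef a b c" "l = 2 / sqrt (real_of_int (disc a b c))"
proof -
  define D where "D = real_of_int (disc a b c)"
  have "(det (vector [u, v] :: real^2^2))\<^sup>2 = 1" using det by (metis one_power2 power2_abs)
  then have "4 * ((u \<bullet> u) * (v \<bullet> v)) - (2 * (u \<bullet> v))\<^sup>2 = 4"
    using gram_det[of u v] by (simp add: power_mult_distrib)
  moreover have "u \<bullet> u = l * a" "2 * (u \<bullet> v) = l * b" "v \<bullet> v = l * c"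
    using g by (auto simp: has_gram_def)
  ultimately have "4 * ((l * a) * (l * c)) - (l * b)\<^sup>2 = 4" by (simp only:)
  then have lD: "l\<^sup>2 * D = 4"
    unfolding D_def by (simp add: power2_eq_square algebra_simps)
  then have D: "D > 0" using l by (metis zero_less_mult_pos zero_less_numeral zero_less_power)
  have "u \<noteq> 0" using det by (auto simp: det_vector_2)
  then have "l * a > 0" using g by (metis has_gram_def inner_gt_zero_iff)
  then have "a > 0" using l by (simp add: zero_less_mult_iff)
  then show "posdef a b c" using D by (simp add: posdef_def D_def flip: of_int_power of_int_mult of_int_diff)
  have "(l * sqrt D)\<^sup>2 = l\<^sup>2 * D" using D by (simp add: power_mult_distrib)
  also have "\<dots> = 2\<^sup>2" unfolding lD by simp
  finally have "l * sqrt D = 2" by (rule power2_eq_imp_eq) (use l D in auto)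
  then show "l = 2 / sqrt (real_of_int (disc a b c))" using D unfolding D_def[symmetric] by (simp add: field_simps)
qed

lemma has_gram_energy:
  assumes g: "has_gram u v l a b c" and l: "l > 0" and det: "\<bar>det (vector [u, v] :: real^2^2)\<bar> = 1"
  shows "lattice_energy2 (lattice_of u v) N = form_energy a b c N"
proof -
  have d: "det (vector [u, v] :: real^2^2) \<noteq> 0" using det by auto
  define s where "s = sqrt (real_of_int (disc a b c))"
  have ls: "l = 2 / s" unfolding s_def by (rule has_gram_scale(2)[OF assms])
  then have s: "s > 0" using l by (simp add: zero_less_divide_iff)
  have "l * qf a b c q \<le> N \<longleftrightarrow> real_of_int (qf a b c q) \<le> N * s / 2" for q
    unfolding ls using s by (simp add: field_simps)
  then have "{(p, q). (norm (lattice_point u v p))\<^sup>2 = (norm (lattice_point u v q))\<^sup>2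
        \<and> (norm (lattice_point u v q))\<^sup>2 \<le> N} = energy_pairs a b c (N * s / 2)"
    unfolding has_gram_norm[OF g] energy_pairs_def using l by auto
  then show ?thesis unfolding lattice_energy2_eq_card[OF d] form_energy_def s_def by simp
qed

lemma has_gram_primitive:
  assumes g: "has_gram u v l a b c" and l: "l > 0" and a: "a > 0"
  obtains l' a' b' c' where "has_gram u v l' a' b' c'" "l' > 0" "primitive_form a' b' c'"
proof -
  define g where "g = gcd a (gcd b c)"
  have g0: "g > 0" using a by (simp add: g_def)
  have "g dvd a" "g dvd b" "g dvd c" unfolding g_def by (auto intro: dvd_trans[OF gcd_dvd2])
  then obtain a' b' c' where abc: "a = g * a'" "b = g * b'" "c = g * c'" by (meson dvdE)
  have "has_gram u v (l * g) a' b' c'" using assms(1) by (simp add: has_gram_def abc mult.assoc)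
  moreover have "primitive_form a' b' c'"
    unfolding primitive_form_def
  proof (intro allI impI)
    fix d assume "d dvd a'" "d dvd b'" "d dvd c'"
    then have "g * d dvd a" "g * d dvd b" "g * d dvd c" by (simp_all add: abc)
    then have "g * d dvd gcd a (gcd b c)" by simp
    then have "g * d dvd g * 1" by (simp add: g_def)
    then show "is_unit d" using g0 by (simp only: dvd_mult_cancel_left) auto
  qed
  moreover have "l * g > 0" using l g0 by simp
  ultimately show thesis by (intro that)
qed

section \<open>Discriminant 3 and the hexagonal lattice\<close>

lemma bil_lin_lin:
  "bil a b c (lin v u w) (lin v u w') = bil (qf a b c v) (bil a b c v u) (qf a b c u) w w'"
  by (simp add: qf_def bil_def lin_def power2_eq_square algebra_simps)

lemma unimodular_lin:
  assumes "unimodular v u" "unimodular w w'"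
  shows "unimodular (lin v u w) (lin v u w')"
proof -
  have "fst (lin v u w) * snd (lin v u w') - snd (lin v u w) * fst (lin v u w')
      = (fst v * snd u - snd v * fst u) * (fst w * snd w' - snd w * fst w')"
    by (simp add: lin_def algebra_simps)
  then show ?thesis using assms by simp
qed

text \<open>Gauss reduction as a descent on \<open>a + c\<close>: while the middle coefficient
  exceeds an outer one in absolute value, shearing one basis vector lowers this sum. A reduced form
  has \<open>b^2 \<le> a * c\<close>, so discriminant 3 forces \<open>a = c = 1\<close>.\<close>

lemma disc_3_equivalent_eisenstein:
  assumes "posdef a b c" "disc a b c = 3"
  shows "\<exists>v u. unimodular v u \<and> qf a b c v = 1 \<and> bil a b c v u = 1 \<and> qf a b c u = 1"
  using assms
proof (induction "nat (a + c)" arbitrary: a b c rule: less_induct)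
  case less
  have a: "a > 0" using less.prems(1) by (simp add: posdef_def)
  have c: "c > 0" using qf_pos[OF less.prems(1), of "(0, 1)"] by (simp add: qf_def)
  have step: ?case if vu: "unimodular v u" and lt: "qf a b c v + qf a b c u < a + c" for v u
  proof -
    have pd: "posdef (qf a b c v) (bil a b c v u) (qf a b c u)"
      by (rule posdef_lin[OF less.prems(1) vu])
    have "u \<noteq> (0, 0)" "v \<noteq> (0, 0)" using vu by auto
    then have "qf a b c u \<ge> 1" "qf a b c v \<ge> 1" using qf_pos[OF less.prems(1)] by auto
    then have "nat (qf a b c v + qf a b c u) < nat (a + c)" using lt by simp
    moreover have "4 * qf a b c v * qf a b c u - (bil a b c v u)\<^sup>2 = 3"
      using disc_lin[OF vu, of a b c] less.prems(2) by simp
    ultimately obtain w w' where "unimodular w w'"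
      "qf (qf a b c v) (bil a b c v u) (qf a b c u) w = 1"
      "bil (qf a b c v) (bil a b c v u) (qf a b c u) w w' = 1"
      "qf (qf a b c v) (bil a b c v u) (qf a b c u) w' = 1"
      using less.hyps[OF _ pd] by blast
    then show ?thesis
      using unimodular_lin[OF vu] qf_lin[of a b c v u] bil_lin_lin[of a b c v u] by metis
  qed
  \<comment> \<open>The shear direction: its sign is chosen so that the mixed term is
    subtracted.\<close>
  define e :: int where "e = (if b \<ge> 0 then - 1 else 1)"
  have e: "e * b = - \<bar>b\<bar>" "e\<^sup>2 = 1" by (auto simp: e_def)
  consider "\<bar>b\<bar> > a" | "\<bar>b\<bar> > c" | "\<bar>b\<bar> \<le> a" "\<bar>b\<bar> \<le> c" by linarith
  then show ?case
  proof cases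
    case 1
    have "qf a b c (1, 0) + qf a b c (e, 1) < a + c"
      using e 1 by (simp add: qf_def mult.commute)
    then show ?thesis by (intro step[of "(1, 0)" "(e, 1)"]) auto
  next
    case 2
    have "qf a b c (1, e) + qf a b c (0, 1) < a + c"
      using e 2 by (simp add: qf_def mult.commute)
    then show ?thesis by (intro step[of "(1, e)" "(0, 1)"]) auto
  next
    case 3
    have "\<bar>b\<bar> * \<bar>b\<bar> \<le> a * c" using 3 a by (intro mult_mono) auto
    then have "b\<^sup>2 \<le> a * c" by (simp add: power2_eq_square)
    then have ac: "a * c \<le> 1" using less.prems(2) by simp
    moreover have "a * 1 \<le> a * c" "1 * c \<le> a * c" using a c by (intro mult_mono; simp)+
    ultimately have "a = 1" "c = 1" using a c by linarith+
    moreover from this have "b\<^sup>2 = 1" using less.prems(2) by simp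
    then have "b = 1 \<or> b = - 1" by (simp add: power2_eq_1_iff)
    ultimately consider "a = 1" "c = 1" "b = 1" | "a = 1" "c = 1" "b = - 1" by blast
    then show ?thesis
    proof cases
      case 1
      then show ?thesis by (intro exI[of _ "(1, 0)"] exI[of _ "(0, 1)"]) (simp add: qf_def bil_def)
    next
      \<comment> \<open>Replacing the second basis vector by \<open>(1, 1)\<close> turns the middle
        coefficient -1 into 1.\<close>
      case 2
      then show ?thesis by (intro exI[of _ "(1, 0)"] exI[of _ "(1, 1)"]) (simp add: qf_def bil_def)
    qed
  qed
qed

lemma lattice_point_lin:
  "lattice_point (lattice_point u v r) (lattice_point u v s) w = lattice_point u v (lin r s w)"
  by (simp add: lattice_point_def lin_def scaleR_add_right scaleR_add_left algebra_simps)

lemma lattice_of_unimodular: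
  assumes "unimodular r s"
  shows "lattice_of (lattice_point u v r) (lattice_point u v s) = lattice_of u v"
proof -
  have "surj (lin r s)" by (metis lin_inv_lin(2)[OF assms] surjI)
  then have "range (\<lambda>w. lattice_point u v (lin r s w)) = range (lattice_point u v)"
    by (metis image_image)
  then show ?thesis unfolding lattice_of_eq_range by (simp add: lattice_point_lin[abs_def])
qed

lemma det_lattice_point:
  "det (vector [lattice_point u v r, lattice_point u v s] :: real^2^2)
    = of_int (fst r * snd s - snd r * fst s) * det (vector [u, v] :: real^2^2)"
  unfolding det_vector_2 by (simp add: lattice_point_def algebra_simps)

lemma inner_lattice_point:
  "lattice_point u v r \<bullet> lattice_point u v s
    = (u \<bullet> u) * (fst r * fst s) + (u \<bullet> v) * (fst r * snd s + snd r * fst s) + (v \<bullet> v) * (snd r * snd s)"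
  unfolding lattice_point_def
  by (simp add: inner_add_left inner_add_right inner_commute[of v u] algebra_simps)

lemma has_gram_lin:
  assumes "has_gram u v l a b c"
  shows "has_gram (lattice_point u v r) (lattice_point u v s) l (qf a b c r) (bil a b c r s) (qf a b c s)"
proof -
  have e: "u \<bullet> u = l * a" "u \<bullet> v = l * b / 2" "v \<bullet> v = l * c"
    using assms by (auto simp: has_gram_def)
  have "2 * (lattice_point u v r \<bullet> lattice_point u v s) = l * bil a b c r s"
    unfolding inner_lattice_point e bil_def by (simp add: algebra_simps)
  moreover have "lattice_point u v r \<bullet> lattice_point u v r = l * qf a b c r" for r
    unfolding inner_lattice_point e qf_def by (simp add: power2_eq_square algebra_simps)
  ultimately show ?thesis by (simp add: has_gram_def)
qed

lemma hexagonal_basis: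
  obtains x y where "hexagonal_lattice = lattice_of x y" "det (vector [x, y] :: real^2^2) = 1"
    "has_gram x y (2 / sqrt 3) 1 1 1" "x $ 2 = 0" "x $ 1 > 0"
proof -
  define a :: real where "a = sqrt (2 / sqrt 3)"
  have a: "a > 0" "a\<^sup>2 = 2 / sqrt 3" by (auto simp: a_def)
  define x y :: "real^2" where "x = vector [a, 0]" and "y = vector [1 / 2 * a, 1 / a]"
  have "hexagonal_lattice = lattice_of x y"
    by (simp add: hexagonal_lattice_def a_def x_def y_def Let_def)
  moreover have "det (vector [x, y] :: real^2^2) = 1"
    using a by (simp add: det_vector_2 x_def y_def)
  moreover have "y \<bullet> y = 2 / sqrt 3"
  proof -
    have "y \<bullet> y = a\<^sup>2 / 4 + 1 / a\<^sup>2" by (simp add: inner_vec_2 y_def power2_eq_square)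
    also have "\<dots> = 2 / sqrt 3" unfolding a(2) by (simp add: field_simps)
    finally show ?thesis .
  qed
  then have "has_gram x y (2 / sqrt 3) 1 1 1"
    using a(2) by (simp add: has_gram_def inner_vec_2 x_def y_def power2_eq_square)
  ultimately show thesis using a(1) by (intro that[of x y]) (auto simp: x_def)
qed

lemma lattice_energy2_hexagonal: "lattice_energy2 hexagonal_lattice N = form_energy 1 1 1 N"
proof -
  obtain x y where xy: "hexagonal_lattice = lattice_of x y" "det (vector [x, y] :: real^2^2) = 1"
    "has_gram x y (2 / sqrt 3) 1 1 1"
    using hexagonal_basis by metis
  show ?thesis unfolding xy(1) by (rule has_gram_energy[OF xy(3)]) (use xy(2) in auto)
qed

lemma rotation_matrix_transformation:
  assumes "rotation_matrix (R :: real^2^2)"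
  shows "norm (R *v x) = norm x" "inj ((*v) R)"
proof -
  have R: "orthogonal_transformation ((*v) R)"
    using assms by (simp add: rotation_matrix_def orthogonal_transformation_matrix)
  then show "norm (R *v x) = norm x" by (rule orthogonal_transformation_norm)
  show "inj ((*v) R)" using R by (rule orthogonal_transformation_inj)
qed

lemma hexagonal_energy:
  assumes "is_hexagonal L"
  shows "lattice_energy2 L N = lattice_energy2 hexagonal_lattice N"
proof -
  obtain R :: "real^2^2" where R: "rotation_matrix R" "L = (*v) R ` hexagonal_lattice"
    using assms unfolding is_hexagonal_def by blast
  note rot = rotation_matrix_transformation[OF R(1)]
  have "{(p1, p2). p1 \<in> L \<and> p2 \<in> L \<and> (norm p1)\<^sup>2 = (norm p2)\<^sup>2 \<and> (norm p2)\<^sup>2 \<le> N}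
      = map_prod ((*v) R) ((*v) R) ` {(p1, p2). p1 \<in> hexagonal_lattice \<and> p2 \<in> hexagonal_lattice
          \<and> (norm p1)\<^sup>2 = (norm p2)\<^sup>2 \<and> (norm p2)\<^sup>2 \<le> N}"
    unfolding R(2) by (auto simp: image_iff rot(1))
  then show ?thesis unfolding lattice_energy2_def
    using prod.inj_map[OF rot(2) rot(2)] by (simp add: card_image inj_on_subset)
qed

text \<open>The model vector \<open>x\<close> lies on the positive first axis and has the length of
  \<open>u\<close>, so the rotation is complex multiplication by \<open>u / a\<close>. Orientation
  matters here: the determinant must be 1, not just of absolute value 1.\<close>

lemma has_gram_eisenstein_hexagonal:
  assumes g: "has_gram u v l 1 1 1" and l: "l > 0" and det: "det (vector [u, v] :: real^2^2) = 1"
  shows "is_hexagonal (lattice_of u v)"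
proof -
  obtain x y where xy: "hexagonal_lattice = lattice_of x y" "det (vector [x, y] :: real^2^2) = 1"
    "has_gram x y (2 / sqrt 3) 1 1 1" "x $ 2 = 0" "x $ 1 > 0"
    using hexagonal_basis by metis
  have l_eq: "l = 2 / sqrt 3" using has_gram_scale(2)[OF g l] det by simp
  define a where "a = x $ 1"
  have a: "a > 0" "a\<^sup>2 = l" using xy(3,4,5) by (auto simp: a_def l_eq has_gram_def inner_vec_2 power2_eq_square)
  have y: "y $ 2 = 1 / a" "y $ 1 = a / 2"
  proof -
    show "y $ 2 = 1 / a" using xy(2,4) a(1) by (simp add: det_vector_2 a_def field_simps)
    have "2 * (a * y $ 1) = a * a" using xy(3,4) a(2) by (simp add: has_gram_def inner_vec_2 a_def l_eq power2_eq_square)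
    then show "y $ 1 = a / 2" using a(1) by simp
  qed
  have u: "u $ 1 * u $ 1 + u $ 2 * u $ 2 = a\<^sup>2" "2 * (u $ 1 * v $ 1 + u $ 2 * v $ 2) = a\<^sup>2"
    using g a(2) by (auto simp: has_gram_def inner_vec_2)
  have d: "u $ 1 * v $ 2 - u $ 2 * v $ 1 = 1" using det by (simp add: det_vector_2)
  define R :: "real^2^2" where "R = vector [vector [u $ 1 / a, - (u $ 2 / a)], vector [u $ 2 / a, u $ 1 / a]]"
  have one: "u $ 1 / a * (u $ 1 / a) + u $ 2 / a * (u $ 2 / a) = 1"
    using u(1) a(1) by (simp add: field_simps power2_eq_square)
  have "rotation_matrix R"
    unfolding rotation_matrix_def orthogonal_matrix
  proof
    show "transpose R ** R = mat 1"
      using one by (simp add: vec_eq_iff forall_2 matrix_matrix_mult_def transpose_def mat_def sum_2 R_def algebra_simps)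
    show "det R = 1" using one by (simp add: det_2 R_def)
  qed
  moreover have Rx: "R *v x = u"
    using a(1) xy(4) by (simp add: vec_eq_iff forall_2 matrix_vector_mult_def sum_2 R_def a_def)
  \<comment> \<open>Given \<open>u\<close>, the vector \<open>v\<close> is recovered from its inner
    product and its determinant with \<open>u\<close>.\<close>
  moreover have Ry: "R *v y = v"
  proof -
    have "a\<^sup>2 * v $ 1 = (u $ 1 * u $ 1 + u $ 2 * u $ 2) * v $ 1" using u(1) by simp
    also have "\<dots> = u $ 1 * (u $ 1 * v $ 1 + u $ 2 * v $ 2) - u $ 2 * (u $ 1 * v $ 2 - u $ 2 * v $ 1)"
      by (simp add: algebra_simps)
    also have "\<dots> = u $ 1 * (a\<^sup>2 / 2) - u $ 2" using u(2) d by simp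
    finally have v1: "v $ 1 = u $ 1 / 2 - u $ 2 / a\<^sup>2" using a(1) by (simp add: field_simps)
    have "a\<^sup>2 * v $ 2 = (u $ 1 * u $ 1 + u $ 2 * u $ 2) * v $ 2" using u(1) by simp
    also have "\<dots> = u $ 2 * (u $ 1 * v $ 1 + u $ 2 * v $ 2) + u $ 1 * (u $ 1 * v $ 2 - u $ 2 * v $ 1)"
      by (simp add: algebra_simps)
    also have "\<dots> = u $ 2 * (a\<^sup>2 / 2) + u $ 1" using u(2) d by simp
    finally have v2: "v $ 2 = u $ 2 / 2 + u $ 1 / a\<^sup>2" using a(1) by (simp add: field_simps)
    show ?thesis
      using a(1) by (simp add: vec_eq_iff forall_2 matrix_vector_mult_def sum_2 R_def y v1 v2 power2_eq_square)
  qed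
  moreover have "lattice_of u v = (*v) R ` lattice_of x y"
  proof -
    have "R *v lattice_point x y w = lattice_point u v w" for w
      by (simp add: lattice_point_def matrix_vector_right_distrib matrix_vector_mult_scaleR Rx Ry)
    then show ?thesis unfolding lattice_of_eq_range image_image by simp
  qed
  ultimately show ?thesis unfolding is_hexagonal_def xy(1) by blast
qed

lemma disc_3_hexagonal:
  assumes g: "has_gram u v l a b c" and l: "l > 0" and det: "\<bar>det (vector [u, v] :: real^2^2)\<bar> = 1"
    and disc: "disc a b c = 3"
  shows "is_hexagonal (lattice_of u v)"
proof -
  have pd: "posdef a b c" by (rule has_gram_scale(1)[OF g l det])
  obtain r s where rs: "unimodular r s" "qf a b c r = 1" "bil a b c r s = 1" "qf a b c s = 1"
    using disc_3_equivalent_eisenstein[OF pd disc] by blast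
  define x y where "x = lattice_point u v r" and "y = lattice_point u v s"
  have L: "lattice_of x y = lattice_of u v" unfolding x_def y_def by (rule lattice_of_unimodular[OF rs(1)])
  have gxy: "has_gram x y l 1 1 1" using has_gram_lin[OF g, of r s] rs by (simp add: x_def y_def)
  have dxy: "det (vector [x, y] :: real^2^2) = det (vector [u, v] :: real^2^2)"
    unfolding x_def y_def det_lattice_point rs(1) by simp
  show ?thesis
  proof (cases "det (vector [x, y] :: real^2^2) = 1")
    case True
    then show ?thesis using has_gram_eisenstein_hexagonal[OF gxy l] L by simp
  next
    \<comment> \<open>A negatively oriented basis is repaired by swapping its vectors, which leaves
      the symmetric Gram data unchanged.\<close>
    case False
    then have "det (vector [x, y] :: real^2^2) = - 1" using det unfolding dxy by auto
    then have "det (vector [y, x] :: real^2^2) = 1" by (simp add: det_vector_2 mult.commute)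
    moreover have "has_gram y x l 1 1 1" using gxy by (simp add: has_gram_def inner_commute)
    ultimately have "is_hexagonal (lattice_of y x)" using l by (intro has_gram_eisenstein_hexagonal)
    moreover have "lattice_of y x = lattice_of x y" unfolding lattice_of_def by (auto; metis add.commute)
    ultimately show ?thesis using L by simp
  qed
qed

section \<open>Lattices that are not similar to an integral one\<close>

definition parallel :: "int \<times> int \<Rightarrow> int \<times> int \<Rightarrow> bool" where
  "parallel d w \<longleftrightarrow> fst d * snd w = snd d * fst w"

text \<open>An orthogonal pair of lattice vectors is an integral linear relation between the Gram entries
  \<open>A\<close>, \<open>B\<close>, \<open>C\<close>. Two independent relations make the Gram matrix proportional to an integral one;
  proportional relations factor into the same two linear forms.\<close>

lemma gram_or_few_orthogonal:
  assumes det: "det (vector [u, v] :: real^2^2) \<noteq> 0"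
    and no: "\<nexists>l a b c. has_gram u v l a b c \<and> l > 0 \<and> a > 0"
  obtains v0 w0 where "v0 \<noteq> (0, 0)" "w0 \<noteq> (0, 0)"
    "\<And>d s. d \<noteq> (0, 0) \<Longrightarrow> s \<noteq> (0, 0) \<Longrightarrow> lattice_point u v d \<bullet> lattice_point u v s = 0
      \<Longrightarrow> parallel d v0 \<or> parallel d w0"
proof (cases "\<exists>v0 w0. v0 \<noteq> (0, 0) \<and> w0 \<noteq> (0, 0) \<and> lattice_point u v v0 \<bullet> lattice_point u v w0 = 0")
  case False
  then show thesis by (intro that[of "(1, 0)" "(1, 0)"]) auto
next
  case True
  then obtain v0 w0 where vw: "v0 \<noteq> (0, 0)" "w0 \<noteq> (0, 0)"
    and orth0: "lattice_point u v v0 \<bullet> lattice_point u v w0 = 0" by blast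
  define A B C where "A = u \<bullet> u" and "B = u \<bullet> v" and "C = v \<bullet> v"
  have "u \<noteq> 0" using det by (auto simp: det_vector_2)
  then have A: "A > 0" by (simp add: A_def)
  define r1 r2 r3 where "r1 = fst v0 * fst w0" and "r2 = fst v0 * snd w0 + snd v0 * fst w0"
    and "r3 = snd v0 * snd w0"
  have R: "A * r1 + B * r2 + C * r3 = 0"
    using orth0 unfolding inner_lattice_point A_def B_def C_def r1_def r2_def r3_def by simp
  show thesis
  proof (rule that[OF vw])
    fix d s :: "int \<times> int"
    assume d: "d \<noteq> (0, 0)" "s \<noteq> (0, 0)" and orth: "lattice_point u v d \<bullet> lattice_point u v s = 0"
    define t1 t2 t3 where "t1 = fst d * fst s" and "t2 = fst d * snd s + snd d * fst s"
      and "t3 = snd d * snd s"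
    have T: "A * t1 + B * t2 + C * t3 = 0"
      using orth unfolding inner_lattice_point A_def B_def C_def t1_def t2_def t3_def by simp
    \<comment> \<open>The cross product of the two relations. The vector \<open>(A, B, C)\<close> is
      orthogonal to both, hence proportional to it; if it is nonzero, the Gram matrix is integral up
      to scale, and the sign is adjusted to make the leading entry positive.\<close>
    define c1 c2 c3 where "c1 = t2 * r3 - t3 * r2" and "c2 = t3 * r1 - t1 * r3" and "c3 = t1 * r2 - t2 * r1"
    have "A * c2 - B * c1 = t3 * (A * r1 + B * r2 + C * r3) - r3 * (A * t1 + B * t2 + C * t3)"
      by (simp add: c1_def c2_def algebra_simps)
    then have Ac2: "A * c2 = B * c1" unfolding R T by simp
    have "A * c3 - C * c1 = r2 * (A * t1 + B * t2 + C * t3) - t2 * (A * r1 + B * r2 + C * r3)"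
      by (simp add: c1_def c3_def algebra_simps)
    then have Ac3: "A * c3 = C * c1" unfolding R T by simp
    have c1: "c1 = 0"
    proof (rule ccontr)
      assume nz: "c1 \<noteq> 0"
      have B_eq: "B = A / c1 * c2" and C_eq: "C = A / c1 * c3" using nz Ac2 Ac3 by (simp_all add: field_simps)
      have sg: "A / \<bar>c1\<bar> * (sgn c1 * k) = A / c1 * k" for k :: int
        using nz by (cases "c1 > 0") (auto simp: sgn_if)
      have "has_gram u v (A / \<bar>c1\<bar>) \<bar>c1\<bar> (sgn c1 * (2 * c2)) (sgn c1 * c3)"
        unfolding has_gram_def A_def[symmetric] B_def[symmetric] C_def[symmetric] of_int_abs
        using nz B_eq C_eq sg[of "2 * c2"] sg[of c3] by simp
      moreover have "A / \<bar>c1\<bar> > 0" "\<bar>c1\<bar> > 0" using A nz by auto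
      ultimately show False using no by blast
    qed
    then have c: "c2 = 0" "c3 = 0" using Ac2 Ac3 A by simp_all
    \<comment> \<open>\<open>P\<close> is the binary form attached to the relation \<open>r\<close>,
      evaluated at \<open>d\<close>. The form of the relation \<open>t\<close> has a linear factor
      vanishing at \<open>d\<close>; since \<open>r\<close> and \<open>t\<close> are proportional
      and \<open>t\<close> is nonzero, \<open>P\<close> vanishes as well, so \<open>d\<close> lies
      on one of the two lines of \<open>r\<close>.\<close>
    define P where "P = (fst v0 * snd d - snd v0 * fst d) * (fst w0 * snd d - snd w0 * fst d)"
    have P: "P = r1 * (snd d)\<^sup>2 - r2 * fst d * snd d + r3 * (fst d)\<^sup>2"
      by (simp add: P_def r1_def r2_def r3_def power2_eq_square algebra_simps)
    have Z: "t1 * (snd d)\<^sup>2 - t2 * fst d * snd d + t3 * (fst d)\<^sup>2 = 0"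
      by (simp add: t1_def t2_def t3_def power2_eq_square algebra_simps)
    have z1: "t2 * r3 = t3 * r2" "t3 * r1 = t1 * r3" "t1 * r2 = t2 * r1"
      using c1 c by (simp_all add: c1_def c2_def c3_def)
    have "t1 * P = r1 * (t1 * (snd d)\<^sup>2 - t2 * fst d * snd d + t3 * (fst d)\<^sup>2)
        - (t1 * r2 - t2 * r1) * fst d * snd d + (t1 * r3 - t3 * r1) * (fst d)\<^sup>2"
      unfolding P by (simp add: algebra_simps)
    then have 1: "t1 * P = 0" unfolding Z using z1 by simp
    have "t2 * P = r2 * (t1 * (snd d)\<^sup>2 - t2 * fst d * snd d + t3 * (fst d)\<^sup>2)
        - (t1 * r2 - t2 * r1) * (snd d)\<^sup>2 + (t2 * r3 - t3 * r2) * (fst d)\<^sup>2"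
      unfolding P by (simp add: algebra_simps)
    then have 2: "t2 * P = 0" unfolding Z using z1 by simp
    have "t3 * P = r3 * (t1 * (snd d)\<^sup>2 - t2 * fst d * snd d + t3 * (fst d)\<^sup>2)
        + (t3 * r1 - t1 * r3) * (snd d)\<^sup>2 - (t3 * r2 - t2 * r3) * fst d * snd d"
      unfolding P by (simp add: algebra_simps)
    then have 3: "t3 * P = 0" unfolding Z using z1 by simp
    have "t1 \<noteq> 0 \<or> t2 \<noteq> 0 \<or> t3 \<noteq> 0"
      using d unfolding t1_def t2_def t3_def by (cases d; cases s) auto
    then have "P = 0" using 1 2 3 by auto
    then show "parallel d v0 \<or> parallel d w0"
      unfolding P_def parallel_def mult_eq_0_iff by (elim disjE) (simp_all add: mult.commute)
  qed
qed

text \<open>If \<open>p\<close> and \<open>p - D\<close> have equal length, then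
  \<open>2 * (p \<bullet> D) = D \<bullet> D\<close>. On a given line through the origin this
  equation has at most one nonzero solution; the conclusion is applied to each coordinate of the two
  differences in turn.\<close>

lemma parallel_reflection_unique:
  fixes p D D' :: "real^2"
  assumes "\<alpha> *\<^sub>R D' = \<alpha>' *\<^sub>R D" "2 * (p \<bullet> D) = D \<bullet> D" "2 * (p \<bullet> D') = D' \<bullet> D'" "D \<noteq> 0" "D' \<noteq> 0"
  shows "\<alpha> = \<alpha>'"
proof -
  have "\<alpha> * (D' \<bullet> D') = \<alpha>' * (D \<bullet> D)"
  proof -
    have "\<alpha> * (2 * (p \<bullet> D')) = 2 * (p \<bullet> (\<alpha> *\<^sub>R D'))" by simp
    also have "\<dots> = \<alpha>' * (2 * (p \<bullet> D))" unfolding assms(1) by simp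
    finally show ?thesis unfolding assms(2,3) .
  qed
  moreover have "\<alpha>\<^sup>2 * (D' \<bullet> D') = \<alpha>'\<^sup>2 * (D \<bullet> D)"
  proof -
    have "\<alpha>\<^sup>2 * (D' \<bullet> D') = (\<alpha> *\<^sub>R D') \<bullet> (\<alpha> *\<^sub>R D')" by (simp add: power2_eq_square)
    also have "\<dots> = \<alpha>'\<^sup>2 * (D \<bullet> D)" unfolding assms(1) by (simp add: power2_eq_square)
    finally show ?thesis .
  qed
  ultimately have "\<alpha> * (\<alpha>' * (D \<bullet> D)) = \<alpha>'\<^sup>2 * (D \<bullet> D)"
    by (simp add: power2_eq_square mult.assoc)
  moreover have "D \<bullet> D > 0" "D' \<bullet> D' > 0" using assms by auto
  ultimately have "\<alpha> * \<alpha>' = \<alpha>' * \<alpha>'" by (simp add: power2_eq_square)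
  then have "\<alpha> = \<alpha>' \<or> \<alpha>' = 0" by auto
  then show ?thesis using \<open>\<alpha> * (D' \<bullet> D') = \<alpha>' * (D \<bullet> D)\<close> \<open>D' \<bullet> D' > 0\<close> by auto
qed

text \<open>By Cayley-Hamilton for the Gram matrix, whose determinant is 1, its trace
  \<open>M\<close> times the form is \<open>x^2 + y^2\<close> plus two squares. A lattice ball thus
  embeds in a ball of the standard integer lattice.\<close>

lemma lattice_ball_linear:
  assumes det: "\<bar>det (vector [u, v] :: real^2^2)\<bar> = 1"
  obtains K where "\<forall>\<^sub>F N in at_top. finite {p. (norm (lattice_point u v p))\<^sup>2 \<le> N}
    \<and> real (card {p. (norm (lattice_point u v p))\<^sup>2 \<le> N}) \<le> K * N"
proof -
  define A B C where "A = u \<bullet> u" and "B = u \<bullet> v" and "C = v \<bullet> v"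
  have "(det (vector [u, v] :: real^2^2))\<^sup>2 = 1" using det by (metis one_power2 power2_abs)
  then have disc: "A * C - B\<^sup>2 = 1" using gram_det[of u v] by (simp add: A_def B_def C_def)
  have "u \<noteq> 0" using det by (auto simp: det_vector_2)
  then have A: "A > 0" by (simp add: A_def)
  have C: "C \<ge> 0" by (simp add: C_def)
  define M where "M = A + C"
  have M: "M > 0" using A C by (simp add: M_def)
  have pd: "posdef 1 0 1" by (simp add: posdef_def)
  obtain K where K: "K > 0" "\<And>T. T \<ge> 1 \<Longrightarrow> \<bar>card (qball 1 0 1 T) - qdens 1 0 1 * T\<bar> \<le> K * sqrt T"
    using card_qball[OF pd] by blast
  define K' where "K' = (1 + qdens 1 0 1 + K) * M"
  show thesis
  proof (rule that[of K'], rule eventually_mono[OF eventually_ge_at_top])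
    fix N assume N: "1 / M \<le> N"
    then have MN: "1 \<le> M * N" using M by (simp add: pos_divide_le_eq mult.commute)
    have sub: "{p. (norm (lattice_point u v p))\<^sup>2 \<le> N} \<subseteq> insert (0, 0) (qball 1 0 1 (M * N))"
    proof
      fix p assume "p \<in> {p. (norm (lattice_point u v p))\<^sup>2 \<le> N}"
      then have le: "(norm (lattice_point u v p))\<^sup>2 \<le> N" by simp
      define x y where "x = real_of_int (fst p)" and "y = real_of_int (snd p)"
      have n: "(norm (lattice_point u v p))\<^sup>2 = A * x\<^sup>2 + 2 * B * x * y + C * y\<^sup>2"
        unfolding norm_lattice_point A_def B_def C_def x_def y_def by simp
      have "M * (A * x\<^sup>2 + 2 * B * x * y + C * y\<^sup>2)
          = (A * C - B\<^sup>2) * (x\<^sup>2 + y\<^sup>2) + (A * x + B * y)\<^sup>2 + (B * x + C * y)\<^sup>2"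
        by (simp add: M_def power2_eq_square algebra_simps)
      then have "x\<^sup>2 + y\<^sup>2 \<le> M * (norm (lattice_point u v p))\<^sup>2" unfolding n disc by simp
      also have "\<dots> \<le> M * N" using le M by simp
      finally have "real_of_int (qf 1 0 1 p) \<le> M * N" by (simp add: qf_def x_def y_def)
      then show "p \<in> insert (0, 0) (qball 1 0 1 (M * N))" by (auto simp: qball_def)
    qed
    have fin: "finite (insert (0, 0) (qball 1 0 1 (M * N)))" using finite_qball[OF pd] by simp
    have "card {p. (norm (lattice_point u v p))\<^sup>2 \<le> N} \<le> card (insert (0, 0) (qball 1 0 1 (M * N)))"
      by (rule card_mono[OF fin sub])
    also have "\<dots> = Suc (card (qball 1 0 1 (M * N)))"
      using finite_qball[OF pd] by (simp add: qball_def)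
    finally have "real (card {p. (norm (lattice_point u v p))\<^sup>2 \<le> N}) \<le> 1 + real (card (qball 1 0 1 (M * N)))"
      by linarith
    also have "\<dots> \<le> 1 + qdens 1 0 1 * (M * N) + K * sqrt (M * N)" using K(2)[OF MN] by linarith
    also have "\<dots> \<le> M * N + qdens 1 0 1 * (M * N) + K * (M * N)"
      using MN K(1) M qdens_pos[OF pd]
      by (intro add_mono mult_left_mono) (auto simp: real_le_lsqrt self_le_power)
    also have "\<dots> = K' * N" by (simp add: K'_def algebra_simps)
    finally show "finite {p. (norm (lattice_point u v p))\<^sup>2 \<le> N}
        \<and> real (card {p. (norm (lattice_point u v p))\<^sup>2 \<le> N}) \<le> K' * N"
      using finite_subset[OF sub fin] by simp
  qed
qed

text \<open>For vectors of equal length \<open>p - q\<close> is orthogonal to \<open>p + q\<close>.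
  Unless one of these vanishes, \<open>p - q\<close> lies on one of two lines, and each line allows
  at most one \<open>q\<close> for a given \<open>p\<close>. With \<open>q = p\<close> and
  \<open>q = - p\<close> this makes at most four partners per point.\<close>

lemma few_orthogonal_energy:
  assumes det: "\<bar>det (vector [u, v] :: real^2^2)\<bar> = 1"
    and vw: "v0 \<noteq> (0, 0)" "w0 \<noteq> (0, 0)"
    and orth: "\<And>d s. d \<noteq> (0, 0) \<Longrightarrow> s \<noteq> (0, 0) \<Longrightarrow> lattice_point u v d \<bullet> lattice_point u v s = 0
      \<Longrightarrow> parallel d v0 \<or> parallel d w0"
    and fin: "finite {p. (norm (lattice_point u v p))\<^sup>2 \<le> N}"
  shows "lattice_energy2 (lattice_of u v) N \<le> 4 * card {p. (norm (lattice_point u v p))\<^sup>2 \<le> N}"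
proof -
  define f where "f = lattice_point u v"
  have d0: "det (vector [u, v] :: real^2^2) \<noteq> 0" using det by auto
  have inj: "inj f" unfolding f_def by (rule inj_lattice_point[OF d0])
  have f0: "f w = 0 \<longleftrightarrow> w = (0, 0)" for w
    using injD[OF inj, of w "(0, 0)"] by (auto simp: f_def lattice_point_def)
  define ball where "ball = {p. (norm (f p))\<^sup>2 \<le> N}"
  have finb: "finite ball" using fin by (simp add: ball_def f_def)
  define P where "P = {(p, q). (norm (f p))\<^sup>2 = (norm (f q))\<^sup>2 \<and> (norm (f q))\<^sup>2 \<le> N}"
  define dif where "dif = (\<lambda>p q :: int \<times> int. (fst p - fst q, snd p - snd q))"
  have fdif: "f (dif p q) = f p - f q" for p q
    by (simp add: f_def dif_def lattice_point_def algebra_simps)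
  define S where "S = (\<lambda>z. {(p, q) \<in> P. p \<noteq> q \<and> parallel (dif p q) z})"
  have cardS: "card (S z) \<le> card ball" if z: "z \<noteq> (0, 0)" for z
  proof (rule card_inj_on_le[OF _ _ finb])
    show "fst ` S z \<subseteq> ball" by (auto simp: S_def P_def ball_def)
    show "inj_on fst (S z)"
    proof (rule inj_onI)
      fix x y assume xy: "x \<in> S z" "y \<in> S z" "fst x = fst y"
      obtain p q q' where x: "x = (p, q)" and y: "y = (p, q')" using xy(3) by (cases x; cases y) auto
      define d d' where "d = dif p q" and "d' = dif p q'"
      have par: "parallel d z" "parallel d' z" using xy by (auto simp: S_def x y d_def d'_def)
      have ne: "p \<noteq> q" "p \<noteq> q'" using xy by (auto simp: S_def x y)
      then have "d \<noteq> (0, 0)" "d' \<noteq> (0, 0)"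
        by (auto simp: d_def d'_def dif_def prod_eq_iff)
      then have nz: "f d \<noteq> 0" "f d' \<noteq> 0" by (simp_all add: f0)
      have cross: "fst d * snd d' = snd d * fst d'"
      proof (cases "fst z = 0")
        case True
        then have "snd z \<noteq> 0" using z by (cases z) auto
        then have "fst d = 0" "fst d' = 0" using par True by (auto simp: parallel_def)
        then show ?thesis by simp
      next
        case False
        have e: "snd d' * fst z = fst d' * snd z" "snd d * fst z = fst d * snd z"
          using par by (simp_all add: parallel_def)
        have "(fst d * snd d' - snd d * fst d') * fst z
            = fst d * (snd d' * fst z) - (snd d * fst z) * fst d'" by (simp add: algebra_simps)
        also have "\<dots> = 0" unfolding e by simp
        finally show ?thesis using False by simp
      qed
      have refl: "2 * (f p \<bullet> f (dif p r)) = f (dif p r) \<bullet> f (dif p r)" if "(p, r) \<in> P" for r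
      proof -
        have "f p \<bullet> f p = f r \<bullet> f r" using that by (simp add: P_def power2_norm_eq_inner)
        then show ?thesis unfolding fdif
          by (simp add: inner_diff_left inner_diff_right inner_commute)
      qed
      have inP: "(p, q) \<in> P" "(p, q') \<in> P" using xy by (auto simp: S_def x y)
      have r: "2 * (f p \<bullet> f d) = f d \<bullet> f d" "2 * (f p \<bullet> f d') = f d' \<bullet> f d'"
        unfolding d_def d'_def by (rule refl[OF inP(1)], rule refl[OF inP(2)])
      have cross': "real_of_int (fst d) * snd d' = real_of_int (snd d) * fst d'"
        using cross by (metis of_int_mult)
      have "real_of_int (fst d) *\<^sub>R f d' = real_of_int (fst d') *\<^sub>R f d"
        using cross' by (simp add: f_def lattice_point_def scaleR_add_right mult.commute)
      then have "real_of_int (fst d) = fst d'"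
        by (rule parallel_reflection_unique[OF _ r nz])
      moreover have "real_of_int (snd d) *\<^sub>R f d' = real_of_int (snd d') *\<^sub>R f d"
        using cross' by (simp add: f_def lattice_point_def scaleR_add_right mult.commute)
      then have "real_of_int (snd d) = snd d'"
        by (rule parallel_reflection_unique[OF _ r nz])
      ultimately have "q = q'" by (simp add: d_def d'_def dif_def prod_eq_iff)
      then show "x = y" by (simp add: x y)
    qed
  qed
  define D1 where "D1 = (\<lambda>p. (p, p)) ` ball"
  define D2 where "D2 = (\<lambda>p. (p, (- fst p, - snd p))) ` ball"
  have cD: "card D1 \<le> card ball" "card D2 \<le> card ball" unfolding D1_def D2_def by (auto intro: card_image_le finb)
  have sub: "P \<subseteq> (D1 \<union> D2) \<union> (S v0 \<union> S w0)"
  proof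
    fix w assume w: "w \<in> P"
    obtain p q where pq: "w = (p, q)" by (cases w)
    have eq: "(norm (f p))\<^sup>2 = (norm (f q))\<^sup>2" and le: "(norm (f q))\<^sup>2 \<le> N" using w by (auto simp: P_def pq)
    define s where "s = (fst p + fst q, snd p + snd q)"
    have fs: "f s = f p + f q" by (simp add: f_def s_def lattice_point_def algebra_simps)
    have o: "f (dif p q) \<bullet> f s = 0"
      using eq unfolding fdif fs power2_norm_eq_inner by (simp add: inner_diff_left inner_add_right inner_commute[of "f q" "f p"])
    consider "p = q" | "s = (0, 0)" | "p \<noteq> q" "s \<noteq> (0, 0)" by blast
    then show "w \<in> (D1 \<union> D2) \<union> (S v0 \<union> S w0)"
    proof cases
      case 1
      then show ?thesis using le by (auto simp: D1_def ball_def pq)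
    next
      case 2
      then have "q = (- fst p, - snd p)" by (auto simp: s_def prod_eq_iff)
      then show ?thesis using eq le by (auto simp: D2_def ball_def pq)
    next
      case 3
      then have "dif p q \<noteq> (0, 0)" by (auto simp: dif_def prod_eq_iff)
      then have "parallel (dif p q) v0 \<or> parallel (dif p q) w0"
        using orth 3(2) o unfolding f_def by blast
      then show ?thesis using w 3(1) by (auto simp: S_def pq)
    qed
  qed
  have finP: "finite P"
    by (rule finite_subset[of _ "ball \<times> ball"]) (use finb in \<open>auto simp: P_def ball_def\<close>)
  have "finite ((D1 \<union> D2) \<union> (S v0 \<union> S w0))"
    using finP finb by (auto simp: D1_def D2_def S_def intro: rev_finite_subset)
  then have "card P \<le> card ((D1 \<union> D2) \<union> (S v0 \<union> S w0))" by (rule card_mono[OF _ sub])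
  also have "\<dots> \<le> card (D1 \<union> D2) + card (S v0 \<union> S w0)" by (rule card_Un_le)
  also have "\<dots> \<le> (card D1 + card D2) + (card (S v0) + card (S w0))"
    by (intro add_mono card_Un_le)
  also have "\<dots> \<le> 4 * card ball" using cD cardS[OF vw(1)] cardS[OF vw(2)] by linarith
  finally show ?thesis
    unfolding lattice_energy2_eq_card[OF d0] P_def ball_def f_def .
qed

lemma lattice_energy_less_hexagonal:
  assumes L: "is_lattice L" "covolume L = 1" and nh: "\<not> is_hexagonal L"
  shows "\<forall>\<^sub>F N in at_top. lattice_energy2 L N < lattice_energy2 hexagonal_lattice N"
proof -
  obtain u v where d: "det (vector [u, v] :: real^2^2) \<noteq> 0" and uv: "L = lattice_of u v"
    using L(1) unfolding is_lattice_def by blast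
  have det: "\<bar>det (vector [u, v] :: real^2^2)\<bar> = 1" using L(2) unfolding uv covolume_lattice_of .
  show ?thesis
  proof (cases "\<exists>l a b c. has_gram u v l a b c \<and> l > 0 \<and> a > 0")
    case True
    then obtain l a b c where g: "has_gram u v l a b c" "l > 0" and prim: "primitive_form a b c"
      using has_gram_primitive by metis
    have pd: "posdef a b c" by (rule has_gram_scale(1)[OF g det])
    have "disc a b c \<noteq> 3" using disc_3_hexagonal[OF g det] nh uv by blast
    from form_energy_less_eisenstein[OF pd prim this] show ?thesis
      unfolding uv lattice_energy2_hexagonal has_gram_energy[OF g det] .
  next
    case False
    obtain v0 w0 where vw: "v0 \<noteq> (0, 0)" "w0 \<noteq> (0, 0)"
      "\<And>d s. d \<noteq> (0, 0) \<Longrightarrow> s \<noteq> (0, 0) \<Longrightarrow> lattice_point u v d \<bullet> lattice_point u v s = 0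
        \<Longrightarrow> parallel d v0 \<or> parallel d w0"
      using gram_or_few_orthogonal[OF d False] by blast
    obtain K where K: "\<forall>\<^sub>F N in at_top. finite {p. (norm (lattice_point u v p))\<^sup>2 \<le> N}
        \<and> real (card {p. (norm (lattice_point u v p))\<^sup>2 \<le> N}) \<le> K * N"
      using lattice_ball_linear[OF det] by blast
    have "\<forall>\<^sub>F N in at_top. real (lattice_energy2 L N) \<le> 4 * K * N"
      using K
    proof eventually_elim
      case (elim N)
      have "lattice_energy2 L N \<le> 4 * card {p. (norm (lattice_point u v p))\<^sup>2 \<le> N}"
        unfolding uv by (rule few_orthogonal_energy[OF det vw]) (use elim in auto)
      then have "real (lattice_energy2 L N) \<le> 4 * real (card {p. (norm (lattice_point u v p))\<^sup>2 \<le> N})"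
        by linarith
      then show ?case using elim by linarith
    qed
    then show ?thesis unfolding lattice_energy2_hexagonal by (rule linear_less_eisenstein)
  qed
qed

theorem theorem5p3:
  shows "(\<forall>D::int. D < 0 \<and> squarefree D \<and> D mod 4 = 1 \<and> D \<noteq> -3 \<longrightarrow>
            (\<forall>\<^sub>F N::real in at_top. energy2 D N < energy2 (-3) N)) \<and>
         (\<forall>D::int. D < 0 \<and> squarefree D \<and> D mod 4 \<noteq> 1 \<and> D \<noteq> -1 \<longrightarrow>
            (\<forall>\<^sub>F N::real in at_top. energy2 D N < energy2 (-1) N)) \<and>
         (\<forall>L::(real^2) set. is_lattice L \<and> covolume L = 1 \<longrightarrow>
            (\<forall>\<^sub>F N::real in at_top.
               lattice_energy2 L N \<le> lattice_energy2 hexagonal_lattice N \<and>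
               (lattice_energy2 L N = lattice_energy2 hexagonal_lattice N \<longleftrightarrow> is_hexagonal L)))"
proof (intro conjI allI impI)
  fix D :: int assume "D < 0 \<and> squarefree D \<and> D mod 4 = 1 \<and> D \<noteq> -3"
  then show "\<forall>\<^sub>F N in at_top. energy2 D N < energy2 (-3) N" by (intro energy2_less_eisenstein) auto
next
  fix D :: int assume "D < 0 \<and> squarefree D \<and> D mod 4 \<noteq> 1 \<and> D \<noteq> -1"
  then show "\<forall>\<^sub>F N in at_top. energy2 D N < energy2 (-1) N" by (intro energy2_less_gauss) auto
next
  fix L :: "(real^2) set" assume L: "is_lattice L \<and> covolume L = 1"
  show "\<forall>\<^sub>F N in at_top. lattice_energy2 L N \<le> lattice_energy2 hexagonal_lattice N \<and>
      (lattice_energy2 L N = lattice_energy2 hexagonal_lattice N \<longleftrightarrow> is_hexagonal L)"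
  proof (cases "is_hexagonal L")
    \<comment> \<open>A rotation preserves the energy for every \<open>N\<close>, which settles
      equality; in the other case strict inequality settles both claims.\<close>
    case True
    then show ?thesis by (simp add: hexagonal_energy)
  next
    case False
    have "\<forall>\<^sub>F N in at_top. lattice_energy2 L N < lattice_energy2 hexagonal_lattice N"
      using L False by (intro lattice_energy_less_hexagonal) auto
    then show ?thesis by eventually_elim (use False in auto)
  qed
qed

end
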